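(* Let $p\in(0,1)$ and $\alpha:=1/p-1$. For a function $g$ on $\mathbb R^n$ the following are equivalent: (i) $g\in L^\infty(\mathbb R^n)\cap\mathcal L^{\Phi_p}_{\rm loc}(\mathbb R^n)$; (ii) $g$ is a pointwise multiplier of $\Lambda_{n\alpha}(\mathbb R^n)$, i.e. there is $C_g>0$ with $\|gf\|_{\Lambda_{n\alpha}}\le C_g\|f\|_{\Lambda_{n\alpha}}$ for all $f\in\Lambda_{n\alpha}(\mathbb R^n)$. Moreover, there is a positive constant $C$ independent of $f,g$ such that, for $g$ as in (i) and all $f\in\Lambda_{n\alpha}(\mathbb R^n)$, $\|gf\|_{\Lambda_{n\alpha}(\mathbb R^n)}\le C[\|g\|_{L^\infty(\mathbb R^n)}+\|g\|_{\mathcal L^{\Phi_p}_{\rm loc}(\mathbb R^n)}]\|f\|_{\Lambda_{n\alpha}(\mathbb R^n)}$.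
   Context: For $\beta>0$, the inhomogeneous Lipschitz space $\Lambda_\beta(\mathbb R^n)$ is the set of measurable $f$ equal a.e. to a continuous $g$ with $\|f\|_{\Lambda_\beta}:=\|f\|_{L^\infty}+\sup_{x\in\mathbb R^n}\sup_{h\ne0}|D_h^{\lfloor\beta\rfloor+1}g(x)|/|h|^\beta<\infty$, where $D_hf(x):=f(x+h)-f(x)$ and $D_h^{k+1}:=D_h^kD_h$. $\Phi_p(\tau):=\tau/(1+\tau^{1-p})$, and $\|f\|_{L^{\Phi_p}}:=\inf\{\lambda>0:\int\Phi_p(|f|/\lambda)\le1\}$. For $g\in L^1_{\rm loc}$, a ball $B$ and $k\in\mathbb Z_+$, $P_B^kg$ is the unique polynomial $P$ of degree $\le k$ with $\int_B(g-P)R=0$ for all polynomials $R$ of degree $\le k$. With $d:=\lfloor n(1/p-1)\rfloor$, the local Orlicz Campanato space $\mathcal L^{\Phi_p}_{\rm loc}(\mathbb R^n)$ is the set of $g\in L^1_{\rm loc}$ with $\|g\|_{\mathcal L^{\Phi_p}_{\rm loc}}:=\sup_{B:|B|<1}\frac{1}{\|\mathbf 1_B\|_{L^{\Phi_p}}}\int_B|g-P_B^dg|\,dx+\sup_{B:|B|\ge1}\frac{1}{\|\mathbf 1_B\|_{L^{\Phi_p}}}\int_B|g|\,dx<\infty$ (suprema over balls $B\subset\mathbb R^n$). *)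

theory Defs
  imports "HOL-Probability.Probability"
begin

definition Linf_norm :: "('a::euclidean_space \<Rightarrow> real) \<Rightarrow> ereal" where
  "Linf_norm f = esssup lebesgue (\<lambda>x. ereal \<bar>f x\<bar>)"

definition in_Linf :: "('a::euclidean_space \<Rightarrow> real) \<Rightarrow> bool" where
  "in_Linf f \<longleftrightarrow> f \<in> borel_measurable lebesgue \<and> Linf_norm f < \<infinity>"

fun fdiff :: "'a::euclidean_space \<Rightarrow> nat \<Rightarrow> ('a \<Rightarrow> real) \<Rightarrow> 'a \<Rightarrow> real" where
  "fdiff h 0 g = g"
| "fdiff h (Suc k) g = fdiff h k (\<lambda>x. g (x + h) - g x)"

definition lip_semi :: "real \<Rightarrow> ('a::euclidean_space \<Rightarrow> real) \<Rightarrow> ereal" where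
  "lip_semi \<beta> g = (SUP x\<in>UNIV. SUP h\<in>UNIV - {0}.
      ereal (\<bar>fdiff h (nat \<lfloor>\<beta>\<rfloor> + 1) g x\<bar> / (norm h powr \<beta>)))"

definition cont_reps :: "('a::euclidean_space \<Rightarrow> real) \<Rightarrow> ('a \<Rightarrow> real) set" where
  "cont_reps f = {g. continuous_on UNIV g \<and> (AE x in lebesgue. f x = g x)}"

text \<open>The continuous representative is unique, so the infimum is just its seminorm.\<close>
definition Lambda_norm :: "real \<Rightarrow> ('a::euclidean_space \<Rightarrow> real) \<Rightarrow> ereal" where
  "Lambda_norm \<beta> f = Linf_norm f + (INF g\<in>cont_reps f. lip_semi \<beta> g)"

definition in_Lambda :: "real \<Rightarrow> ('a::euclidean_space \<Rightarrow> real) \<Rightarrow> bool" where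
  "in_Lambda \<beta> f \<longleftrightarrow> f \<in> borel_measurable lebesgue \<and>
     (\<exists>g\<in>cont_reps f. Linf_norm f + lip_semi \<beta> g < \<infinity>)"

definition Phi :: "real \<Rightarrow> real \<Rightarrow> real" where
  "Phi p \<tau> = \<tau> / (1 + \<tau> powr (1 - p))"

definition orlicz_norm :: "real \<Rightarrow> ('a::euclidean_space \<Rightarrow> real) \<Rightarrow> real" where
  "orlicz_norm p f = Inf {t. t > 0 \<and>
      (\<integral>\<^sup>+ x. ennreal (Phi p (\<bar>f x\<bar> / t)) \<partial>lebesgue) \<le> 1}"

definition multi_indices :: "nat \<Rightarrow> ('a::euclidean_space \<Rightarrow> nat) set" where
  "multi_indices d = {\<alpha>. (\<forall>b. b \<notin> Basis \<longrightarrow> \<alpha> b = 0) \<and> sum \<alpha> Basis \<le> d}"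

definition poly_deg_le :: "nat \<Rightarrow> ('a::euclidean_space \<Rightarrow> real) \<Rightarrow> bool" where
  "poly_deg_le d P \<longleftrightarrow> (\<exists>c. P = (\<lambda>x. \<Sum>\<alpha>\<in>multi_indices d. c \<alpha> * (\<Prod>b\<in>Basis. (x \<bullet> b) ^ \<alpha> b)))"

definition proj_poly :: "nat \<Rightarrow> 'a::euclidean_space set \<Rightarrow> ('a \<Rightarrow> real) \<Rightarrow> ('a \<Rightarrow> real)" where
  "proj_poly d B g = (THE P. poly_deg_le d P \<and>
      (\<forall>R. poly_deg_le d R \<longrightarrow> (LINT x:B|lebesgue. (g x - P x) * R x) = 0))"

definition L1_loc :: "('a::euclidean_space \<Rightarrow> real) \<Rightarrow> bool" where
  "L1_loc g \<longleftrightarrow> (\<forall>K. compact K \<longrightarrow> set_integrable lebesgue K g)"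

definition camp_d :: "'a::euclidean_space itself \<Rightarrow> real \<Rightarrow> nat" where
  "camp_d (_::'a itself) p = nat \<lfloor>real DIM('a) * (1 / p - 1)\<rfloor>"

definition campanato_norm :: "real \<Rightarrow> ('a::euclidean_space \<Rightarrow> real) \<Rightarrow> ereal" where
  "campanato_norm p g =
     (SUP B\<in>{ball c r | c r. r > 0 \<and> measure lebesgue (ball c r) < 1}.
        ereal (1 / orlicz_norm p (indicator B)) *
        enn2ereal (\<integral>\<^sup>+ x\<in>B. ennreal \<bar>g x - proj_poly (camp_d TYPE('a) p) B g x\<bar> \<partial>lebesgue))
   + (SUP B\<in>{ball c r | c r. r > 0 \<and> measure lebesgue (ball c r) \<ge> 1}.
        ereal (1 / orlicz_norm p (indicator B)) *
        enn2ereal (\<integral>\<^sup>+ x\<in>B. ennreal \<bar>g x\<bar> \<partial>lebesgue))"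

definition in_campanato :: "real \<Rightarrow> ('a::euclidean_space \<Rightarrow> real) \<Rightarrow> bool" where
  "in_campanato p g \<longleftrightarrow> L1_loc g \<and> campanato_norm p g < \<infinity>"

end

theory Submission
  imports Defs "HOL-Computational_Algebra.Polynomial"
begin

text \<open>Put \<open>\<beta> = n (1 / p - 1)\<close>, \<open>d = \<lfloor>\<beta>\<rfloor>\<close> and \<open>k = d + 1 > \<beta>\<close>. For small balls
  \<open>\<parallel>1\<^sub>B\<parallel>\<close> is comparable to \<open>|B|\<close> to the power \<open>1 / p\<close>, so that \<open>L\<^sup>\<infinity>\<close> together with the local
  Campanato condition says that \<open>g\<close> is bounded and within \<open>r\<close> to the power \<open>\<beta>\<close>, in the mean, of a
  polynomial of degree at most \<open>d\<close> on each ball of radius \<open>r\<close>; this is equivalent to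
  \<open>g \<in> \<Lambda>\<^sub>\<beta>\<close>. In one direction the values at the centres of the approximating polynomials on shrinking
  balls converge geometrically to a continuous representative, whose \<open>k\<close>-th differences are small
  because those of polynomials vanish. The other direction is a Whitney-type estimate.
  Finally \<open>\<Lambda>\<^sub>\<beta>\<close> is an algebra containing \<open>1\<close>: a \<open>k\<close>-th difference of a product is a sum of products of
  differences of orders \<open>i + j = k\<close>, and by Marchaud's inequality a difference of order \<open>j\<close> is
  \<open>O\<close> of \<open>|h|\<close> to the power \<open>\<beta> j / k\<close>.\<close>

section \<open>Polynomials of bounded degree\<close>

text \<open>For integral \<beta> a function in the space need not have derivatives of order \<beta>,
  so its own Taylor polynomials cannot serve as approximants. The Whitney-type estimate therefore
  averages against the truncated powers \<open>max 0 (a\<^sup>2 - y \<bullet> y) ^ k\<close>, whose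
  expansions follow from the binomial theorem alone. It yields an error
  \<open>C * (M + norm x ^ k * A)\<close> in which \<open>A\<close> is merely a bound for the
  function; because k > \<beta> strictly, shrinking the ball turns the share of \<open>A\<close>
  into a contraction that can be iterated. The same strict inequality keeps Marchaud's exponents
  below the orders of the differences, so that no logarithm appears for integral \<beta>. Three
  properties of polynomials carry the rest: differences of order d + 1 annihilate them, their values
  on any ball determine them, and their value at the centre of a ball is controlled by their mean
  over it. Estimates for small steps or small balls extend to large ones by boundedness.\<close>

lemma finite_multi_indices: "finite (multi_indices d :: ('a::euclidean_space \<Rightarrow> nat) set)"
proof -
  have "multi_indices d \<subseteq> {f :: 'a \<Rightarrow> nat. \<forall>x. (x \<in> Basis \<longrightarrow> f x \<in> {..d}) \<and> (x \<notin> Basis \<longrightarrow> f x = 0)}"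
  proof
    fix \<alpha> :: "'a \<Rightarrow> nat" assume a: "\<alpha> \<in> multi_indices d"
    { fix x :: 'a assume "x \<in> Basis"
      then have "\<alpha> x \<le> sum \<alpha> Basis" by (simp add: member_le_sum)
      also have "\<dots> \<le> d" using a by (simp add: multi_indices_def)
      finally have "\<alpha> x \<le> d" . }
    then show "\<alpha> \<in> {f :: 'a \<Rightarrow> nat. \<forall>x. (x \<in> Basis \<longrightarrow> f x \<in> {..d}) \<and> (x \<notin> Basis \<longrightarrow> f x = 0)}"
      using a by (auto simp: multi_indices_def)
  qed
  then show ?thesis
    by (rule finite_subset) (rule finite_set_of_finite_funs, auto)
qed

lemma poly_deg_le_sum_scaled:
  assumes "\<And>i. i \<in> I \<Longrightarrow> poly_deg_le d (P i)"
  shows "poly_deg_le d (\<lambda>x. \<Sum>i\<in>I. a i * P i x)"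
proof -
  obtain c where c: "\<And>i. i \<in> I \<Longrightarrow> P i = (\<lambda>x. \<Sum>\<alpha>\<in>multi_indices d. c i \<alpha> * (\<Prod>b\<in>Basis. (x \<bullet> b) ^ \<alpha> b))"
    using assms unfolding poly_deg_le_def by metis
  have "(\<lambda>x. \<Sum>i\<in>I. a i * P i x) =
        (\<lambda>x. \<Sum>\<alpha>\<in>multi_indices d. (\<Sum>i\<in>I. a i * c i \<alpha>) * (\<Prod>b\<in>Basis. (x \<bullet> b) ^ \<alpha> b))"
  proof
    fix x
    have "(\<Sum>i\<in>I. a i * P i x) = (\<Sum>i\<in>I. \<Sum>\<alpha>\<in>multi_indices d. a i * c i \<alpha> * (\<Prod>b\<in>Basis. (x \<bullet> b) ^ \<alpha> b))"
      by (rule sum.cong) (auto simp: c sum_distrib_left mult.assoc)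
    also have "\<dots> = (\<Sum>\<alpha>\<in>multi_indices d. (\<Sum>i\<in>I. a i * c i \<alpha>) * (\<Prod>b\<in>Basis. (x \<bullet> b) ^ \<alpha> b))"
      by (subst sum.swap) (simp add: sum_distrib_right)
    finally show "(\<Sum>i\<in>I. a i * P i x) = \<dots>" .
  qed
  then show ?thesis unfolding poly_deg_le_def by (intro exI)
qed

lemma poly_deg_le_sum:
  "(\<And>i. i \<in> I \<Longrightarrow> poly_deg_le d (P i)) \<Longrightarrow> poly_deg_le d (\<lambda>x. \<Sum>i\<in>I. P i x)"
  using poly_deg_le_sum_scaled[of I d P "\<lambda>_. 1"] by simp

lemma poly_deg_le_scale: "poly_deg_le d P \<Longrightarrow> poly_deg_le d (\<lambda>x. a * P x)"
  using poly_deg_le_sum_scaled[of "{()}" d "\<lambda>_. P" "\<lambda>_. a"] by simp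

lemma poly_deg_le_add:
  assumes "poly_deg_le d P" "poly_deg_le d Q" shows "poly_deg_le d (\<lambda>x. P x + Q x)"
  using poly_deg_le_sum[of "UNIV::bool set" d "\<lambda>b. if b then P else Q"] assms
  by (simp add: UNIV_bool add.commute)

lemma poly_deg_le_diff:
  assumes "poly_deg_le d P" "poly_deg_le d Q" shows "poly_deg_le d (\<lambda>x. P x - Q x)"
  using poly_deg_le_add[OF assms(1) poly_deg_le_scale[OF assms(2), of "-1"]] by simp

lemma poly_deg_le_monomial:
  fixes \<alpha> :: "'a::euclidean_space \<Rightarrow> nat"
  assumes "sum \<alpha> Basis \<le> d"
  shows "poly_deg_le d (\<lambda>x::'a. \<Prod>b\<in>Basis. (x \<bullet> b) ^ \<alpha> b)"
proof -
  \<comment> \<open>\<open>multi_indices\<close> admits only exponents that vanish off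
    \<open>Basis\<close>; cutting \<alpha> off there leaves the monomial unchanged.\<close>
  define \<alpha>' where "\<alpha>' = (\<lambda>b. if b \<in> Basis then \<alpha> b else 0)"
  have m: "\<alpha>' \<in> multi_indices d"
    using assms by (simp add: multi_indices_def \<alpha>'_def)
  have "(\<lambda>x::'a. \<Prod>b\<in>Basis. (x \<bullet> b) ^ \<alpha> b) =
     (\<lambda>x. \<Sum>\<gamma>\<in>multi_indices d. (if \<gamma> = \<alpha>' then 1 else 0) * (\<Prod>b\<in>Basis. (x \<bullet> b) ^ \<gamma> b))"
  proof
    fix x :: 'a
    have "(\<Sum>\<gamma>\<in>multi_indices d. (if \<gamma> = \<alpha>' then 1 else 0) * (\<Prod>b\<in>Basis. (x \<bullet> b) ^ \<gamma> b))
        = (\<Sum>\<gamma>\<in>multi_indices d. if \<gamma> = \<alpha>' then (\<Prod>b\<in>Basis. (x \<bullet> b) ^ \<gamma> b) else 0)"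
      by (rule sum.cong) auto
    also have "\<dots> = (\<Prod>b\<in>Basis. (x \<bullet> b) ^ \<alpha>' b)"
      using m by (simp add: finite_multi_indices)
    also have "\<dots> = (\<Prod>b\<in>Basis. (x \<bullet> b) ^ \<alpha> b)"
      by (rule prod.cong) (auto simp: \<alpha>'_def)
    finally show "(\<Prod>b\<in>Basis. (x \<bullet> b) ^ \<alpha> b) = (\<Sum>\<gamma>\<in>multi_indices d. (if \<gamma> = \<alpha>' then 1 else 0) * (\<Prod>b\<in>Basis. (x \<bullet> b) ^ \<gamma> b))" ..
  qed
  then show ?thesis unfolding poly_deg_le_def by (intro exI)
qed

lemma poly_deg_le_expand:
  assumes "poly_deg_le d P"
  obtains c where "P = (\<lambda>x. \<Sum>\<alpha>\<in>multi_indices d. c \<alpha> * (\<Prod>b\<in>Basis. (x \<bullet> b) ^ \<alpha> b))"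
  using assms unfolding poly_deg_le_def by blast

lemma poly_deg_le_mono:
  assumes "poly_deg_le d P" "d \<le> e" shows "poly_deg_le e P"
proof -
  obtain c where c: "P = (\<lambda>x. \<Sum>\<alpha>\<in>multi_indices d. c \<alpha> * (\<Prod>b\<in>Basis. (x \<bullet> b) ^ \<alpha> b))"
    using assms(1) by (rule poly_deg_le_expand)
  show ?thesis unfolding c using assms(2)
    by (intro poly_deg_le_sum_scaled poly_deg_le_monomial) (auto simp: multi_indices_def)
qed

lemma poly_deg_le_mult:
  assumes "poly_deg_le d P" "poly_deg_le e Q"
  shows "poly_deg_le (d + e) (\<lambda>x. P x * Q x)"
proof -
  obtain c where c: "P = (\<lambda>x. \<Sum>\<alpha>\<in>multi_indices d. c \<alpha> * (\<Prod>b\<in>Basis. (x \<bullet> b) ^ \<alpha> b))"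
    using assms(1) by (rule poly_deg_le_expand)
  obtain c' where c': "Q = (\<lambda>x. \<Sum>\<alpha>\<in>multi_indices e. c' \<alpha> * (\<Prod>b\<in>Basis. (x \<bullet> b) ^ \<alpha> b))"
    using assms(2) by (rule poly_deg_le_expand)
  have eq: "(\<lambda>x. P x * Q x) = (\<lambda>x. \<Sum>\<alpha>\<in>multi_indices d. c \<alpha> * (\<Sum>\<gamma>\<in>multi_indices e. c' \<gamma> * (\<Prod>b\<in>Basis. (x \<bullet> b) ^ (\<alpha> b + \<gamma> b))))"
    unfolding c c' by (auto simp: sum_product sum_distrib_left power_add prod.distrib mult_ac)
  show ?thesis unfolding eq
    by (intro poly_deg_le_sum_scaled poly_deg_le_monomial)
      (auto simp: multi_indices_def sum.distrib)
qed

lemma poly_deg_le_const: "poly_deg_le d (\<lambda>x. a)"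
  using poly_deg_le_scale[OF poly_deg_le_monomial[of "\<lambda>_. 0" d], of a] by simp

lemma poly_deg_le_coord: 
  assumes "b \<in> Basis" shows "poly_deg_le (Suc 0) (\<lambda>x. x \<bullet> b)"
proof -
  have "(\<Prod>c\<in>Basis. (x \<bullet> c) ^ (if c = b then 1 else 0)) = x \<bullet> b" for x
  proof -
    have "(\<Prod>c\<in>Basis. (x \<bullet> c) ^ (if c = b then 1 else 0)) = (\<Prod>c\<in>Basis. if c = b then x \<bullet> c else 1)"
      by (rule prod.cong) auto
    then show ?thesis using assms by simp
  qed
  then show ?thesis
    using poly_deg_le_monomial[of "\<lambda>c. if c = b then 1 else 0" "Suc 0"] assms by simp
qed

lemma poly_deg_le_inner: "poly_deg_le (Suc 0) (\<lambda>x. x \<bullet> (z::'a::euclidean_space))"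
proof -
  have eq: "(\<lambda>x::'a. x \<bullet> z) = (\<lambda>x. \<Sum>b\<in>Basis. (z \<bullet> b) * (x \<bullet> b))"
    by (simp add: euclidean_inner[of _ z] mult.commute)
  show ?thesis unfolding eq
    by (intro poly_deg_le_sum_scaled poly_deg_le_coord)
qed

lemma poly_deg_le_power:
  assumes "poly_deg_le d P" shows "poly_deg_le (m * d) (\<lambda>x. P x ^ m)"
  by (induction m) (auto intro: poly_deg_le_const poly_deg_le_mult[OF assms, simplified])

lemma poly_deg_le_prod:
  assumes "\<And>i. i \<in> I \<Longrightarrow> poly_deg_le (e i) (P i)"
  shows "poly_deg_le (sum e I) (\<lambda>x. \<Prod>i\<in>I. P i x)"
  using assms
proof (induction I rule: infinite_finite_induct)
  case (insert i I)
  then show ?case using poly_deg_le_mult[of "e i" "P i" "sum e I" "\<lambda>x. \<Prod>i\<in>I. P i x"] by simp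
qed (auto intro: poly_deg_le_const)

lemma poly_deg_le_affine:
  fixes P :: "'a::euclidean_space \<Rightarrow> real"
  assumes "poly_deg_le d P"
  shows "poly_deg_le d (\<lambda>x. P (a + s *\<^sub>R x))"
proof -
  obtain c where c: "P = (\<lambda>x. \<Sum>\<alpha>\<in>multi_indices d. c \<alpha> * (\<Prod>b\<in>Basis. (x \<bullet> b) ^ \<alpha> b))"
    using assms by (rule poly_deg_le_expand)
  have lin: "poly_deg_le (Suc 0) (\<lambda>x. (a + s *\<^sub>R x) \<bullet> b)" for b
    using poly_deg_le_add[OF poly_deg_le_const[of "Suc 0" "a \<bullet> b"] poly_deg_le_scale[OF poly_deg_le_inner[of b], of s]]
    by (simp add: inner_add_left)
  have "poly_deg_le d (\<lambda>x. \<Prod>b\<in>Basis. ((a + s *\<^sub>R x) \<bullet> b) ^ \<alpha> b)"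
    if "\<alpha> \<in> multi_indices d" for \<alpha>
  proof -
    have "poly_deg_le (sum \<alpha> Basis) (\<lambda>x. \<Prod>b\<in>Basis. ((a + s *\<^sub>R x) \<bullet> b) ^ \<alpha> b)"
      by (rule poly_deg_le_prod) (use poly_deg_le_power[OF lin] in simp)
    then show ?thesis by (rule poly_deg_le_mono) (use that in \<open>simp add: multi_indices_def\<close>)
  qed
  then show ?thesis unfolding c by (intro poly_deg_le_sum_scaled)
qed

lemma continuous_on_poly_deg_le: "poly_deg_le d P \<Longrightarrow> continuous_on S P"
  by (erule poly_deg_le_expand) (auto intro!: continuous_intros)

lemma borel_measurable_poly_deg_le [measurable_dest]:
  "poly_deg_le d P \<Longrightarrow> P \<in> borel_measurable borel"
  using continuous_on_poly_deg_le borel_measurable_continuous_onI by blast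

section \<open>Restriction to lines: identity theorem and vanishing differences\<close>

text \<open>Reduces questions in several variables to one variable: each linear factor of a monomial
  stays linear in \<open>t\<close>, so the total degree bounds the degree.\<close>

lemma poly_deg_le_on_line:
  fixes P :: "'a::euclidean_space \<Rightarrow> real"
  assumes "poly_deg_le d P"
  shows "\<exists>q. degree q \<le> d \<and> (\<forall>t. P (x + t *\<^sub>R h) = poly q t)"
proof -
  obtain c where c: "P = (\<lambda>x. \<Sum>\<alpha>\<in>multi_indices d. c \<alpha> * (\<Prod>b\<in>Basis. (x \<bullet> b) ^ \<alpha> b))"
    using assms by (rule poly_deg_le_expand)
  define q where "q = (\<Sum>\<alpha>\<in>multi_indices d. smult (c \<alpha>) (\<Prod>b\<in>Basis. [:x \<bullet> b, h \<bullet> b:] ^ \<alpha> b))"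
  have "degree (\<Prod>b\<in>Basis. [:x \<bullet> b, h \<bullet> b:] ^ \<alpha> b) \<le> d" if "\<alpha> \<in> multi_indices d" for \<alpha>
  proof -
    have "degree (\<Prod>b\<in>Basis. [:x \<bullet> b, h \<bullet> b:] ^ \<alpha> b) \<le> sum (degree \<circ> (\<lambda>b. [:x \<bullet> b, h \<bullet> b:] ^ \<alpha> b)) Basis"
      by (rule degree_prod_sum_le) simp
    also have "\<dots> \<le> sum \<alpha> Basis"
    proof (rule sum_mono)
      fix b :: 'a
      have "degree ([:x \<bullet> b, h \<bullet> b:] ^ \<alpha> b) \<le> degree [:x \<bullet> b, h \<bullet> b:] * \<alpha> b" by (rule degree_power_le)
      also have "\<dots> \<le> \<alpha> b" by simp
      finally show "(degree \<circ> (\<lambda>b. [:x \<bullet> b, h \<bullet> b:] ^ \<alpha> b)) b \<le> \<alpha> b" by simp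
    qed
    also have "\<dots> \<le> d" using that by (simp add: multi_indices_def)
    finally show ?thesis .
  qed
  then have "degree q \<le> d" unfolding q_def
    by (intro degree_sum_le finite_multi_indices) (meson degree_smult_le le_trans)
  moreover have "P (x + t *\<^sub>R h) = poly q t" for t
    by (simp add: c q_def poly_sum poly_prod inner_add_left)
  ultimately show ?thesis by blast
qed

text \<open>On the line from \<open>c\<close> to any point the polynomial has infinitely many zeros.
  This makes the L2 pairing of polynomials over a ball definite, which projections rely on.\<close>

lemma poly_deg_le_eq_0_of_ball:
  fixes P :: "'a::euclidean_space \<Rightarrow> real"
  assumes "poly_deg_le d P" "r > 0" "\<And>x. x \<in> ball c r \<Longrightarrow> P x = 0"
  shows "P = (\<lambda>x. 0)"
proof
  fix y
  obtain q where q: "\<And>t. P (c + t *\<^sub>R (y - c)) = poly q t"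
    using poly_deg_le_on_line[OF assms(1)] by blast
  \<comment> \<open>The summand 1 covers \<open>y = c\<close> and makes
    \<open>e * norm (y - c)\<close> strictly less than \<open>r\<close>.\<close>
  define e where "e = r / (1 + norm (y - c))"
  have e: "e > 0" using assms(2) by (simp add: e_def add_pos_nonneg)
  have "poly q t = 0" if t: "t \<in> {0<..<e}" for t
  proof -
    have "norm (t *\<^sub>R (y - c)) \<le> e * norm (y - c)" using t by (simp add: mult_right_mono)
    also have "\<dots> < e * (1 + norm (y - c))" using e by simp
    also have "\<dots> = r" unfolding e_def by (simp add: add_nonneg_eq_0_iff)
    finally have "c + t *\<^sub>R (y - c) \<in> ball c r" by (simp add: dist_norm)
    then show ?thesis using q[of t] assms(3) by simp
  qed
  then have "{0<..<e} \<subseteq> {t. poly q t = 0}" by auto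
  then have "infinite {t. poly q t = 0}"
    using e by (meson finite_subset infinite_Ioo)
  then have "q = 0" using poly_roots_finite by blast
  then show "P y = 0" using q[of 1] by simp
qed

text \<open>\<open>q(X + 1)\<close> and \<open>q\<close> share degree and leading coefficient, so
  the leading terms cancel.\<close>

lemma degree_forward_difference:
  fixes q :: "real poly"
  assumes "degree q \<le> Suc m"
  shows "degree (pcompose q [:1, 1:] - q) \<le> m"
proof (rule degree_le, intro allI impI)
  fix i assume i: "m < i"
  have dg: "degree (pcompose q [:1,1:]) = degree q" by (simp add: degree_pcompose)
  show "coeff (pcompose q [:1, 1:] - q) i = 0"
  proof (cases "i = degree q")
    case True
    have "coeff (pcompose q [:1,1:]) (degree q) = lead_coeff (pcompose q [:1,1:])" by (simp add: dg)
    also have "\<dots> = lead_coeff q" by (subst lead_coeff_comp) auto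
    finally show ?thesis using True by simp
  next
    case False
    then have "i > degree q" using i assms by linarith
    then show ?thesis using dg by (simp add: coeff_eq_0)
  qed
qed

text \<open>A difference at \<open>x\<close> sees only the nodes x + j h, hence agreement with
  \<open>q\<close> at natural numbers suffices. The induction trades \<open>g\<close> for its first
  difference and \<open>q\<close> for q(X + 1) - q, of lower degree bound.\<close>

lemma fdiff_poly_on_line:
  assumes "degree q \<le> d" "\<And>j::nat. g (x + real j *\<^sub>R h) = poly q (real j)"
  shows "fdiff h (Suc d) g x = 0"
  using assms
proof (induction d arbitrary: g q)
  case 0
  then have "\<exists>a. q = [:a:]" by (metis degree_eq_zeroE le_zero_eq)
  then obtain a where "q = [:a:]" by blast
  then show ?case using 0(2)[of 0] 0(2)[of 1] by simp
next
  case (Suc d)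
  have "fdiff h (Suc d) (\<lambda>x. g (x + h) - g x) x = 0"
  proof (rule Suc.IH)
    show "degree (pcompose q [:1, 1:] - q) \<le> d" using Suc.prems(1) by (rule degree_forward_difference)
    fix j :: nat
    have "g (x + real j *\<^sub>R h + h) = g (x + real (Suc j) *\<^sub>R h)"
      by (simp add: algebra_simps)
    then show "g (x + real j *\<^sub>R h + h) - g (x + real j *\<^sub>R h) = poly (pcompose q [:1, 1:] - q) (real j)"
      using Suc.prems(2)[of j] Suc.prems(2)[of "Suc j"] by (simp add: poly_pcompose)
  qed
  then show ?case by (metis fdiff.simps(2))
qed

lemma fdiff_poly_deg_le:
  assumes "poly_deg_le d P" shows "fdiff h (Suc d) P x = 0"
  using poly_deg_le_on_line[OF assms, of x h] fdiff_poly_on_line[of _ d P x h] by metis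

section \<open>Finite differences\<close>

text \<open>The definition peels off a difference of the function; here it is a difference of the
  values. In this form linearity and invariance follow by induction with only the point
  varying.\<close>

lemma fdiff_Suc_outer: "fdiff h (Suc k) g x = fdiff h k g (x + h) - fdiff h k g x"
proof (induction k arbitrary: g)
  case (Suc k)
  show ?case using Suc[of "\<lambda>x. g (x + h) - g x"] by (simp only: fdiff.simps)
qed simp

lemma fdiff_add: "fdiff h k (\<lambda>x. f x + g x) x = fdiff h k f x + fdiff h k g x"
  by (induction k arbitrary: x) (simp_all del: fdiff.simps(2) add: fdiff_Suc_outer)

lemma fdiff_scale: "fdiff h k (\<lambda>x. a * g x) x = a * fdiff h k g x"
  by (induction k arbitrary: x) (simp_all del: fdiff.simps(2) add: fdiff_Suc_outer algebra_simps)

lemma fdiff_diff: "fdiff h k (\<lambda>x. f x - g x) x = fdiff h k f x - fdiff h k g x"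
  by (induction k arbitrary: x) (simp_all del: fdiff.simps(2) add: fdiff_Suc_outer)

lemma fdiff_shift: "fdiff h k (\<lambda>x. g (x + a)) x = fdiff h k g (x + a)"
  by (induction k arbitrary: x) (simp_all del: fdiff.simps(2) add: fdiff_Suc_outer add_ac)

lemma fdiff_affine: "fdiff h k (\<lambda>x. g (a + r *\<^sub>R x)) x = fdiff (r *\<^sub>R h) k g (a + r *\<^sub>R x)"
  by (induction k arbitrary: x) (simp_all del: fdiff.simps(2) add: fdiff_Suc_outer add_ac scaleR_add_right)

lemma fdiff_zero: "0 < k \<Longrightarrow> fdiff 0 k g x = 0"
  by (cases k) (simp_all del: fdiff.simps(2) add: fdiff_Suc_outer)

lemma fdiff_const: "0 < k \<Longrightarrow> fdiff h k (\<lambda>x. a) x = 0"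
proof (induction k arbitrary: x)
  case (Suc k)
  then show ?case by (cases k) (simp_all del: fdiff.simps(2) add: fdiff_Suc_outer)
qed simp

lemma fdiff_binomial:
  "fdiff h k g x = (\<Sum>j\<le>k. (-1) ^ (k - j) * real (k choose j) * g (x + real j *\<^sub>R h))"
proof (induction k arbitrary: x)
  case (Suc k)
  let ?t = "\<lambda>j. g (x + real j *\<^sub>R h)"
  have a: "fdiff h k g (x + h) = (\<Sum>j\<le>k. (-1) ^ (k - j) * real (k choose j) * ?t (Suc j))"
    unfolding Suc by (intro sum.cong) (simp_all add: algebra_simps)
  \<comment> \<open>The added term \<open>j = Suc k\<close> has binomial coefficient 0; with it the
    sum can be split at \<open>j = 0\<close> and matched with the shifted sum
    \<open>a\<close>.\<close>
  have b: "fdiff h k g x = (\<Sum>j\<le>Suc k. (-1) ^ (k - j) * real (k choose j) * ?t j)"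
    unfolding Suc by simp
  also have "\<dots> = (-1)^k * ?t 0 + (\<Sum>j\<le>k. (-1) ^ (k - Suc j) * real (k choose Suc j) * ?t (Suc j))"
    by (subst sum.atMost_Suc_shift) simp
  finally have e: "fdiff h k g x = (-1)^k * ?t 0 + (\<Sum>j\<le>k. (-1) ^ (k - Suc j) * real (k choose Suc j) * ?t (Suc j))" .
  have b': "- fdiff h k g x = (-1)^Suc k * ?t 0 + (\<Sum>j\<le>k. (-1) ^ (Suc k - Suc j) * real (k choose Suc j) * ?t (Suc j))"
  proof -
    \<comment> \<open>For \<open>j = k\<close> truncated subtraction makes both exponents 0 instead
      of consecutive; there the coefficient \<open>k choose Suc k\<close> is 0.\<close>
    have "(-1::real) ^ (Suc k - Suc j) * real (k choose Suc j) = - ((-1) ^ (k - Suc j) * real (k choose Suc j))"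
      if "j \<le> k" for j
    proof (cases "j = k")
      case False
      then have "k - j = Suc (k - Suc j)" using that by simp
      then show ?thesis by simp
    qed simp
    then have "(\<Sum>j\<le>k. (-1) ^ (Suc k - Suc j) * real (k choose Suc j) * ?t (Suc j)) = - (\<Sum>j\<le>k. (-1) ^ (k - Suc j) * real (k choose Suc j) * ?t (Suc j))"
      by (simp add: sum_negf[symmetric])
    then show ?thesis using e by simp
  qed
  have "fdiff h (Suc k) g x = fdiff h k g (x + h) + - fdiff h k g x" by (simp only: fdiff_Suc_outer diff_conv_add_uminus)
  also have "\<dots> = (-1)^Suc k * ?t 0 + (\<Sum>j\<le>k. (-1) ^ (Suc k - Suc j) * real (Suc k choose Suc j) * ?t (Suc j))"
    unfolding a b' by (simp add: sum.distrib[symmetric] algebra_simps)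
  also have "\<dots> = (\<Sum>j\<le>Suc k. (-1) ^ (Suc k - j) * real (Suc k choose j) * ?t j)"
    by (subst sum.atMost_Suc_shift[of "\<lambda>j. (-1) ^ (Suc k - j) * real (Suc k choose j) * ?t j"]) simp
  finally show ?case .
qed simp

lemma abs_fdiff_le:
  assumes "\<And>j::nat. j \<le> k \<Longrightarrow> \<bar>g (x + real j *\<^sub>R h)\<bar> \<le> A"
  shows "\<bar>fdiff h k g x\<bar> \<le> 2 ^ k * A"
  using assms
proof (induction k arbitrary: x)
  case 0 then show ?case using 0[of 0] by simp
next
  case (Suc k)
  have 1: "\<bar>fdiff h k g x\<bar> \<le> 2 ^ k * A" using Suc by simp
  have 2: "\<bar>fdiff h k g (x + h)\<bar> \<le> 2 ^ k * A"
  proof (rule Suc.IH)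
    fix j :: nat assume "j \<le> k"
    then show "\<bar>g (x + h + real j *\<^sub>R h)\<bar> \<le> A"
      using Suc.prems[of "Suc j"] by (simp add: algebra_simps)
  qed
  show ?case unfolding fdiff_Suc_outer using 1 2 by simp
qed

text \<open>Discrete Leibniz rule: the difference of f g is (difference of f) times shifted g, plus
  f times (difference of g). Each order doubles the number of terms, and the points \<open>y\<close>
  and \<open>z\<close> are independent because the rule shifts one factor only.\<close>

lemma abs_fdiff_mult_le:
  assumes "\<And>i j y z. i + j = k \<Longrightarrow> \<bar>fdiff h i f y\<bar> * \<bar>fdiff h j g z\<bar> \<le> E"
  shows "\<bar>fdiff h k (\<lambda>x. f x * g x) x\<bar> \<le> 2 ^ k * E"
  using assms
proof (induction k arbitrary: f g)
  case 0 then show ?case using 0[of 0 0 x x] by (simp add: abs_mult)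
next
  case (Suc k)
  have 1: "\<bar>fdiff h k (\<lambda>x. (f (x + h) - f x) * g (x + h)) x\<bar> \<le> 2 ^ k * E"
  proof (rule Suc.IH)
    fix i j y z assume "i + j = k"
    then show "\<bar>fdiff h i (\<lambda>x. f (x + h) - f x) y\<bar> * \<bar>fdiff h j (\<lambda>x. g (x + h)) z\<bar> \<le> E"
      using Suc.prems[of "Suc i" j y "z + h"] by (simp add: fdiff_shift)
  qed
  have 2: "\<bar>fdiff h k (\<lambda>x. f x * (g (x + h) - g x)) x\<bar> \<le> 2 ^ k * E"
  proof (rule Suc.IH)
    fix i j y z assume "i + j = k"
    then show "\<bar>fdiff h i f y\<bar> * \<bar>fdiff h j (\<lambda>x. g (x + h) - g x) z\<bar> \<le> E"
      using Suc.prems[of i "Suc j" y z] by simp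
  qed
  have "fdiff h (Suc k) (\<lambda>x. f x * g x) x =
      fdiff h k (\<lambda>x. (f (x + h) - f x) * g (x + h) + f x * (g (x + h) - g x)) x"
    by (simp add: algebra_simps)
  then show ?case unfolding fdiff_add using 1 2 by simp
qed

section \<open>Doubling the step and Marchaud's inequality\<close>

text \<open>With T the shift by \<open>h\<close>, T T - 1 = (T + 1)(T - 1), and each of the
  \<open>j\<close> factors T + 1 costs at most 2.\<close>

lemma abs_fdiff_double_le:
  assumes "\<And>y. \<bar>fdiff h j f y\<bar> \<le> E"
  shows "\<bar>fdiff (2 *\<^sub>R h) j f x\<bar> \<le> 2 ^ j * E"
  using assms
proof (induction j arbitrary: f E)
  case (Suc j)
  have "\<bar>fdiff (2 *\<^sub>R h) j (\<lambda>x. f (x + 2 *\<^sub>R h) - f x) x\<bar> \<le> 2 ^ j * (2 * E)"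
  proof (rule Suc.IH)
    fix y
    have "(\<lambda>x. f (x + 2 *\<^sub>R h) - f x) = (\<lambda>x. (f (x + h + h) - f (x + h)) + (f (x + h) - f x))"
      by (simp add: scaleR_2 add.assoc)
    then have "fdiff h j (\<lambda>x. f (x + 2 *\<^sub>R h) - f x) y
        = fdiff h j (\<lambda>x. f (x + h + h) - f (x + h)) y + fdiff h j (\<lambda>x. f (x + h) - f x) y"
      by (simp only: fdiff_add)
    also have "\<dots> = fdiff h (Suc j) f (y + h) + fdiff h (Suc j) f y"
      by (simp add: fdiff_shift[where g = "\<lambda>x. f (x + h) - f x"])
    finally show "\<bar>fdiff h j (\<lambda>x. f (x + 2 *\<^sub>R h) - f x) y\<bar> \<le> 2 * E"
      using Suc.prems[of y] Suc.prems[of "y + h"] by linarith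
  qed
  then show ?case by simp
qed simp

text \<open>With T the shift by \<open>h\<close>, T T - 1 = 2 (T - 1) + (T - 1)(T - 1). Hence the
  j-th power of T T - 1 differs from \<open>2 ^ j\<close> times that of T - 1 only by terms with j +
  1 factors T - 1, and their total weight is at most \<open>j * 2 ^ j\<close>.\<close>

lemma fdiff_double_approx:
  assumes "\<And>y. \<bar>fdiff h (Suc j) f y\<bar> \<le> E"
  shows "\<bar>2 ^ j * fdiff h j f x - fdiff (2 *\<^sub>R h) j f x\<bar> \<le> real j * 2 ^ j * E"
  using assms
proof (induction j arbitrary: f)
  case (Suc j)
  let ?f = "\<lambda>x. f (x + h) - f x"
  let ?d = "\<lambda>x. ?f (x + h) - ?f x"
  have 1: "\<bar>2 ^ j * fdiff h j ?f x - fdiff (2 *\<^sub>R h) j ?f x\<bar> \<le> real j * 2 ^ j * E"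
    using Suc.prems by (intro Suc.IH) simp
  have 2: "\<bar>fdiff (2 *\<^sub>R h) j ?d x\<bar> \<le> 2 ^ j * E"
    using Suc.prems by (intro abs_fdiff_double_le) simp
  have "fdiff (2 *\<^sub>R h) (Suc j) f x = fdiff (2 *\<^sub>R h) j (\<lambda>x. 2 * ?f x + ?d x) x"
    by (simp add: scaleR_2 add.assoc)
  also have "\<dots> = 2 * fdiff (2 *\<^sub>R h) j ?f x + fdiff (2 *\<^sub>R h) j ?d x"
    by (simp only: fdiff_add fdiff_scale)
  finally have 3: "fdiff (2 *\<^sub>R h) (Suc j) f x = 2 * fdiff (2 *\<^sub>R h) j ?f x + fdiff (2 *\<^sub>R h) j ?d x" .
  have 4: "2 ^ Suc j * fdiff h (Suc j) f x = 2 * (2 ^ j * fdiff h j ?f x)" by simp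
  have "\<bar>2 ^ Suc j * fdiff h (Suc j) f x - fdiff (2 *\<^sub>R h) (Suc j) f x\<bar>
      \<le> 2 * \<bar>2 ^ j * fdiff h j ?f x - fdiff (2 *\<^sub>R h) j ?f x\<bar> + \<bar>fdiff (2 *\<^sub>R h) j ?d x\<bar>"
  proof -
    have "\<bar>2 * a - (2 * b + c)\<bar> \<le> 2 * \<bar>a - b\<bar> + \<bar>c\<bar>" for a b c :: real by (simp add: abs_if)
    then show ?thesis unfolding 3 4 .
  qed
  also have "\<dots> \<le> 2 * (real j * 2 ^ j * E) + 2 ^ j * E"
    by (intro add_mono mult_left_mono 1 2) simp
  also have "\<dots> \<le> real (Suc j) * 2 ^ Suc j * E"
  proof -
    have "0 \<le> E" using Suc.prems[of x] by linarith
    then show ?thesis by (simp add: algebra_simps)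
  qed
  finally show ?case .
qed simp

text \<open>By the doubling formula the difference of order \<open>j\<close> at step
  \<open>h\<close> is \<open>2 ^ j\<close> times smaller than at step 2 h, up to a term governed by
  the next order. Since \<theta> < j, each halving of the step multiplies the constant of a bound K
  |h|^\<theta> by \<open>2 powr (\<theta> - real j)\<close>, which is less than 1, so the bound
  passes from steps of size about 1 to all smaller ones.\<close>

lemma marchaud_step:
  fixes f :: "'a::euclidean_space \<Rightarrow> real"
  assumes \<theta>: "0 \<le> \<theta>" "\<theta> < real j" "\<theta> \<le> \<sigma>" and A: "\<And>x. \<bar>f x\<bar> \<le> A"
    and M: "\<And>h x. h \<noteq> 0 \<Longrightarrow> norm h \<le> 1 \<Longrightarrow> \<bar>fdiff h (Suc j) f x\<bar> \<le> M * norm h powr \<sigma>"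
    and h: "h \<noteq> 0" "norm h \<le> 1"
  shows "\<bar>fdiff h j f x\<bar> \<le> (2 powr (real j + \<theta>) * A + real j * M / (1 - 2 powr (\<theta> - real j))) * norm h powr \<theta>"
proof -
  define c where "c = 1 - 2 powr (\<theta> - real j)"
  have c: "0 < c" using \<theta>(2) by (simp add: c_def powr_less_one)
  \<comment> \<open>Two demands on \<open>K\<close>: it covers the trivial bound for
    \<open>norm h \<ge> 1/2\<close>, and
    \<open>K * 2 powr (\<theta> - real j) + real j * M \<le> K\<close>.\<close>
  define K where "K = 2 powr (real j + \<theta>) * A + real j * M / c"
  have A0: "0 \<le> A" using A[of 0] by linarith
  have M0: "0 \<le> M"
  proof -
    have "0 \<le> M * norm h powr \<sigma>" using M[OF h, of 0] by linarith
    then show ?thesis using h by (simp add: zero_le_mult_iff)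
  qed
  \<comment> \<open>\<open>m\<close> counts the dyadic scales down to \<open>h\<close>; the base
    case is \<open>norm h \<ge> 1/2\<close>.\<close>
  have "1 \<le> 2 ^ Suc m * norm h \<Longrightarrow> \<bar>fdiff h j f x\<bar> \<le> K * norm h powr \<theta>" 
    if "h \<noteq> 0" "norm h \<le> 1" for m h x
    using that
  proof (induction m arbitrary: h x)
    case 0
    have "1 \<le> (2 * norm h) powr \<theta>" using 0 \<theta>(1) by (simp add: ge_one_powr_ge_zero)
    then have 1: "1 \<le> 2 powr \<theta> * norm h powr \<theta>" by (simp add: powr_mult)
    have "\<bar>fdiff h j f x\<bar> \<le> 2 ^ j * A" by (rule abs_fdiff_le) (rule A)
    also have "\<dots> \<le> 2 ^ j * A * (2 powr \<theta> * norm h powr \<theta>)"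
      using mult_left_mono[OF 1, of "2 ^ j * A"] A0 by simp
    also have "\<dots> = (2 powr (real j + \<theta>) * A) * norm h powr \<theta>"
      by (simp add: powr_add powr_realpow)
    also have "\<dots> \<le> K * norm h powr \<theta>"
      unfolding K_def using c M0 by (intro mult_right_mono) auto
    finally show ?case .
  next
    case (Suc m)
    show ?case
    proof (cases "norm h \<le> 1/2")
      case False
      have "1 \<le> 2 ^ Suc m * norm h"
      proof -
        have "(1::real) \<le> 2 ^ m" by simp
        then have "1 * 1 \<le> 2 ^ m * (2 * norm h)" using False by (intro mult_mono) auto
        then show ?thesis by simp
      qed
      then show ?thesis using Suc by blast
    next
      case True
      have IH: "\<bar>fdiff (2 *\<^sub>R h) j f x\<bar> \<le> K * norm (2 *\<^sub>R h) powr \<theta>"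
        by (rule Suc.IH) (use Suc.prems True in auto)
      have "\<bar>2 ^ j * fdiff h j f x - fdiff (2 *\<^sub>R h) j f x\<bar> \<le> real j * 2 ^ j * (M * norm h powr \<sigma>)"
        using Suc.prems by (intro fdiff_double_approx M)
      \<comment> \<open>As \<open>norm h \<le> 1\<close>, the exponent \<sigma> may be lowered to
        \<theta>.\<close>
      also have "\<dots> \<le> real j * 2 ^ j * (M * norm h powr \<theta>)"
        using M0 \<theta> Suc.prems by (intro mult_left_mono powr_mono') auto
      finally have "2 ^ j * \<bar>fdiff h j f x\<bar> \<le> \<bar>fdiff (2 *\<^sub>R h) j f x\<bar> + real j * 2 ^ j * (M * norm h powr \<theta>)"
        by (simp add: abs_if split: if_splits)
      also have "\<dots> \<le> K * norm (2 *\<^sub>R h) powr \<theta> + real j * 2 ^ j * (M * norm h powr \<theta>)" using IH by simp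
      also have "\<dots> = 2 ^ j * ((K * 2 powr (\<theta> - real j) + real j * M) * norm h powr \<theta>)"
        by (simp add: powr_mult powr_diff powr_realpow field_simps)
      finally have "\<bar>fdiff h j f x\<bar> \<le> (K * 2 powr (\<theta> - real j) + real j * M) * norm h powr \<theta>" by simp
      also have "\<dots> \<le> K * norm h powr \<theta>"
      proof (rule mult_right_mono)
        have "real j * M = c * (real j * M / c)" using c by simp
        also have "\<dots> \<le> c * K" unfolding K_def using c A0 by (intro mult_left_mono) auto
        finally show "K * 2 powr (\<theta> - real j) + real j * M \<le> K" by (simp add: c_def algebra_simps)
      qed simp
      finally show ?thesis .
    qed
  qed
  moreover obtain m where "1 / norm h < 2 ^ m" using real_arch_pow[of 2] by auto
  then have "1 \<le> 2 ^ Suc m * norm h" using h by (simp add: field_simps)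
  ultimately show ?thesis using h unfolding K_def c_def by blast
qed

text \<open>Descending induction from \<open>j = k\<close>. The exponents \<beta> j / k are chosen
  to be additive in \<open>j\<close>, as a Leibniz rule wants, and they lie strictly below
  \<open>j\<close> for j > 0, as the induction step demands.\<close>

lemma marchaud:
  fixes \<beta> :: real
  assumes \<beta>: "0 < \<beta>" "\<beta> < real k" and "j \<le> k"
  shows "\<exists>C\<ge>1. \<forall>(f :: 'a::euclidean_space \<Rightarrow> real) A M.
      (\<forall>x. \<bar>f x\<bar> \<le> A) \<longrightarrow> (\<forall>h x. h \<noteq> 0 \<longrightarrow> \<bar>fdiff h k f x\<bar> \<le> M * norm h powr \<beta>) \<longrightarrow>
      (\<forall>h x. h \<noteq> 0 \<longrightarrow> norm h \<le> 1 \<longrightarrow> \<bar>fdiff h j f x\<bar> \<le> C * (A + M) * norm h powr (\<beta> * real j / real k))"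
  using \<open>j \<le> k\<close>
proof (induction j rule: inc_induct)
  case base
  have "\<bar>fdiff h k f x\<bar> \<le> 1 * (A + M) * norm h powr (\<beta> * real k / real k)"
    if A: "\<forall>x. \<bar>f x\<bar> \<le> A" and M: "\<forall>h x. h \<noteq> 0 \<longrightarrow> \<bar>fdiff h k f x\<bar> \<le> M * norm h powr \<beta>" and "h \<noteq> 0"
    for f :: "'a \<Rightarrow> real" and A M h x
  proof -
    have "0 \<le> A" using A[rule_format, of 0] by linarith
    then have "M * norm h powr \<beta> \<le> (A + M) * norm h powr \<beta>" by (intro mult_right_mono) auto
    moreover have "\<bar>fdiff h k f x\<bar> \<le> M * norm h powr \<beta>" using M \<open>h \<noteq> 0\<close> by blast
    ultimately show ?thesis using \<beta> by simp
  qed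
  then show ?case by blast
next
  case (step j)
  obtain C where C: "C \<ge> 1" "\<And>(f :: 'a \<Rightarrow> real) A M h x.
      (\<forall>x. \<bar>f x\<bar> \<le> A) \<Longrightarrow> (\<forall>h x. h \<noteq> 0 \<longrightarrow> \<bar>fdiff h k f x\<bar> \<le> M * norm h powr \<beta>) \<Longrightarrow> h \<noteq> 0 \<Longrightarrow> norm h \<le> 1 \<Longrightarrow>
      \<bar>fdiff h (Suc j) f x\<bar> \<le> C * (A + M) * norm h powr (\<beta> * real (Suc j) / real k)"
    using step.IH by metis
  define \<theta> where "\<theta> = \<beta> * real j / real k"
  define D where "D = 2 powr (real j + \<theta>) + real j * C / (1 - 2 powr (\<theta> - real j))"
  have b: "\<bar>fdiff h j f x\<bar> \<le> max D 1 * (A + M) * norm h powr \<theta>"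
    if A: "\<forall>x. \<bar>f x\<bar> \<le> A" and M: "\<forall>h x. h \<noteq> 0 \<longrightarrow> \<bar>fdiff h k f x\<bar> \<le> M * norm h powr \<beta>" and h: "h \<noteq> 0" "norm h \<le> 1"
    for f :: "'a \<Rightarrow> real" and A M h x
  proof -
    have A0: "0 \<le> A" using A[rule_format, of 0] by linarith
    have "0 \<le> M * norm h powr \<beta>" using M[rule_format, OF h(1), of 0] by linarith
    then have M0: "0 \<le> M" using h by (simp add: zero_le_mult_iff)
    show ?thesis
    \<comment> \<open>For \<open>j = 0\<close> the strict inequality \<theta> < j fails, but the
      claim is just the bound on \<open>f\<close>.\<close>
    proof (cases "j = 0")
      case True
      have "\<bar>f x\<bar> \<le> A" using A by blast
      also have "\<dots> \<le> max D 1 * (A + M)"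
        using A0 M0 mult_mono[of 1 "max D 1" A "A + M"] by simp
      finally show ?thesis using True h by (simp add: \<theta>_def)
    next
      case False
      have lt: "\<theta> < real j"
      proof -
        have "\<beta> * real j < real k * real j" using \<beta> False by simp
        then show ?thesis using \<beta> unfolding \<theta>_def by (simp add: field_simps)
      qed
      have th: "0 \<le> \<theta>" "\<theta> \<le> \<beta> * real (Suc j) / real k"
        using \<beta> unfolding \<theta>_def by (auto simp: divide_right_mono mult_left_mono)
      have "\<bar>fdiff h j f x\<bar> \<le> (2 powr (real j + \<theta>) * A + real j * (C * (A + M)) / (1 - 2 powr (\<theta> - real j))) * norm h powr \<theta>"
        by (rule marchaud_step[OF th(1) lt th(2)]) (use A M h C(2)[OF A M] in auto)
      also have "\<dots> \<le> max D 1 * (A + M) * norm h powr \<theta>"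
      proof (rule mult_right_mono)
        have "2 powr (real j + \<theta>) * A \<le> 2 powr (real j + \<theta>) * (A + M)" using M0 by simp
        then have "2 powr (real j + \<theta>) * A + real j * (C * (A + M)) / (1 - 2 powr (\<theta> - real j)) \<le> D * (A + M)"
          unfolding D_def by (simp add: algebra_simps add_divide_distrib)
        also have "\<dots> \<le> max D 1 * (A + M)" using A0 M0 by (intro mult_right_mono) auto
        finally show "2 powr (real j + \<theta>) * A + real j * (C * (A + M)) / (1 - 2 powr (\<theta> - real j)) \<le> max D 1 * (A + M)" .
      qed simp
      finally show ?thesis .
    qed
  qed
  show ?case
    by (rule exI[of _ "max D 1"]) (use b in \<open>auto simp: \<theta>_def\<close>)
qed

section \<open>Products\<close>

text \<open>Marchaud's bounds are available for \<open>norm h \<le> 1\<close> only; longer steps are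
  handled by the bound \<open>2 ^ k * (A * B)\<close>. One Marchaud constant per factor produces
  \<open>D\<^sup>2\<close>.\<close>

lemma lipschitz_mult:
  fixes \<beta> :: real
  assumes \<beta>: "0 < \<beta>" "\<beta> < real k"
  shows "\<exists>C>0. \<forall>(f :: 'a::euclidean_space \<Rightarrow> real) g A M B N.
      (\<forall>x. \<bar>f x\<bar> \<le> A) \<longrightarrow> (\<forall>h x. h \<noteq> 0 \<longrightarrow> \<bar>fdiff h k f x\<bar> \<le> M * norm h powr \<beta>) \<longrightarrow>
      (\<forall>x. \<bar>g x\<bar> \<le> B) \<longrightarrow> (\<forall>h x. h \<noteq> 0 \<longrightarrow> \<bar>fdiff h k g x\<bar> \<le> N * norm h powr \<beta>) \<longrightarrow>
      (\<forall>h x. h \<noteq> 0 \<longrightarrow> \<bar>fdiff h k (\<lambda>x. f x * g x) x\<bar> \<le> C * (A + M) * (B + N) * norm h powr \<beta>)"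
proof -
  define good where "good = (\<lambda>j C. C \<ge> 1 \<and> (\<forall>(f :: 'a \<Rightarrow> real) A M.
      (\<forall>x. \<bar>f x\<bar> \<le> A) \<longrightarrow> (\<forall>h x. h \<noteq> 0 \<longrightarrow> \<bar>fdiff h k f x\<bar> \<le> M * norm h powr \<beta>) \<longrightarrow>
      (\<forall>h x. h \<noteq> 0 \<longrightarrow> norm h \<le> 1 \<longrightarrow> \<bar>fdiff h j f x\<bar> \<le> C * (A + M) * norm h powr (\<beta> * real j / real k))))"
  have "\<forall>j\<in>{..k}. \<exists>C. good j C" using marchaud[OF \<beta>] unfolding good_def by blast
  then obtain C where C: "\<And>j. j \<le> k \<Longrightarrow> good j (C j)" by (auto dest!: bchoice)
  \<comment> \<open>One constant for all orders up to \<open>k\<close>; the sum dominates each term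
    because all are at least 1.\<close>
  define D where "D = (\<Sum>j\<le>k. C j)"
  have CD: "C j \<le> D" if "j \<le> k" for j
    unfolding D_def using C that by (intro member_le_sum) (auto simp: good_def intro: order_trans[of 0 1])
  have D1: "1 \<le> D" using CD[of 0] C[of 0] by (simp add: good_def)
  have "\<bar>fdiff h k (\<lambda>x. f x * g x) x\<bar> \<le> (2 ^ k * D\<^sup>2) * (A + M) * (B + N) * norm h powr \<beta>"
    if A: "\<forall>x. \<bar>f x\<bar> \<le> A" and M: "\<forall>h x. h \<noteq> 0 \<longrightarrow> \<bar>fdiff h k f x\<bar> \<le> M * norm h powr \<beta>"
      and B: "\<forall>x. \<bar>g x\<bar> \<le> B" and N: "\<forall>h x. h \<noteq> 0 \<longrightarrow> \<bar>fdiff h k g x\<bar> \<le> N * norm h powr \<beta>"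
      and h: "h \<noteq> 0"
    for f g :: "'a \<Rightarrow> real" and A M B N h x
  proof -
    have pos: "0 \<le> A" "0 \<le> B" using A[rule_format, of 0] B[rule_format, of 0] by auto
    have "0 \<le> M * norm h powr \<beta>" "0 \<le> N * norm h powr \<beta>"
      using M[rule_format, OF h, of 0] N[rule_format, OF h, of 0] by auto
    then have pos': "0 \<le> M" "0 \<le> N" using h by (auto simp: zero_le_mult_iff)
    show ?thesis
    proof (cases "norm h \<le> 1")
      case True
      have "\<bar>fdiff h k (\<lambda>x. f x * g x) x\<bar> \<le> 2 ^ k * (D * (A + M) * (D * (B + N)) * norm h powr \<beta>)"
      proof (rule abs_fdiff_mult_le)
        fix i j y z assume ij: "i + j = k"
        have "\<bar>fdiff h i f y\<bar> \<le> C i * (A + M) * norm h powr (\<beta> * real i / real k)"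
          using C[of i] ij A M h True unfolding good_def by auto
        also have "\<dots> \<le> D * (A + M) * norm h powr (\<beta> * real i / real k)"
          using CD[of i] ij pos pos' by (intro mult_right_mono) auto
        finally have 1: "\<bar>fdiff h i f y\<bar> \<le> D * (A + M) * norm h powr (\<beta> * real i / real k)" .
        have "\<bar>fdiff h j g z\<bar> \<le> C j * (B + N) * norm h powr (\<beta> * real j / real k)"
          using C[of j] ij B N h True unfolding good_def by auto
        also have "\<dots> \<le> D * (B + N) * norm h powr (\<beta> * real j / real k)"
          using CD[of j] ij pos pos' by (intro mult_right_mono) auto
        finally have 2: "\<bar>fdiff h j g z\<bar> \<le> D * (B + N) * norm h powr (\<beta> * real j / real k)" .
        have e: "\<beta> * real i / real k + \<beta> * real j / real k = \<beta>"
        proof -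
          have "\<beta> * real i / real k + \<beta> * real j / real k = \<beta> * real (i + j) / real k"
            by (simp add: algebra_simps add_divide_distrib)
          then show ?thesis using ij \<beta> by simp
        qed
        have "\<bar>fdiff h i f y\<bar> * \<bar>fdiff h j g z\<bar> \<le>
          (D * (A + M) * norm h powr (\<beta> * real i / real k)) * (D * (B + N) * norm h powr (\<beta> * real j / real k))"
          using 1 2 D1 pos pos' by (intro mult_mono) auto
        also have "\<dots> = D * (A + M) * (D * (B + N)) * (norm h powr (\<beta> * real i / real k) * norm h powr (\<beta> * real j / real k))"
          by (simp add: mult_ac)
        also have "\<dots> = D * (A + M) * (D * (B + N)) * norm h powr \<beta>"
          by (simp only: powr_add[symmetric] e)
        finally show "\<bar>fdiff h i f y\<bar> * \<bar>fdiff h j g z\<bar> \<le> D * (A + M) * (D * (B + N)) * norm h powr \<beta>" .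
      qed
      then show ?thesis by (simp add: power2_eq_square mult_ac)
    next
      case False
      have "\<bar>fdiff h k (\<lambda>x. f x * g x) x\<bar> \<le> 2 ^ k * (A * B)"
        using A B pos by (intro abs_fdiff_le) (simp add: abs_mult mult_mono)
      also have "A * B \<le> (A + M) * (B + N)" using pos pos' by (intro mult_mono) auto
      also have "(A + M) * (B + N) \<le> (A + M) * (B + N) * (D\<^sup>2 * norm h powr \<beta>)"
      proof -
        have "1 \<le> norm h powr \<beta>" using False \<beta> by (intro ge_one_powr_ge_zero) auto
        moreover have "1 \<le> D\<^sup>2" using D1 by simp
        ultimately have "1 * 1 \<le> D\<^sup>2 * norm h powr \<beta>" by (intro mult_mono) auto
        then show ?thesis using pos pos' mult_left_mono[of 1 "D\<^sup>2 * norm h powr \<beta>" "(A + M) * (B + N)"] by simp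
      qed
      finally show ?thesis by (simp add: mult_ac)
    qed
  qed
  then show ?thesis using D1 by (intro exI[of _ "2 ^ k * D\<^sup>2"]) (auto simp: zero_less_mult_iff)
qed

section \<open>Projections onto polynomials on balls\<close>

text \<open>The set where the two functions differ is open and null, and nonempty open sets have
  positive measure.\<close>

lemma eq_on_open_of_AE_eq:
  fixes f g :: "'a::euclidean_space \<Rightarrow> real"
  assumes U: "open U" and c: "continuous_on U f" "continuous_on U g"
    and ae: "AE x in lebesgue. x \<in> U \<longrightarrow> f x = g x"
    and x: "x \<in> U"
  shows "f x = g x"
proof (rule ccontr)
  let ?W = "U \<inter> (\<lambda>x. f x - g x) -` (- {0})"
  assume "f x \<noteq> g x"
  then have ne: "?W \<noteq> {}" using x by auto
  have op: "open ?W"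
    using U c by (intro continuous_open_preimage continuous_intros) auto
  have "{x \<in> space lebesgue. \<not> (x \<in> U \<longrightarrow> f x = g x)} = ?W" by auto
  then have "?W \<in> null_sets lebesgue"
    using ae by (subst (asm) completion.AE_iff_null_sets) auto
  then show False using open_not_negligible[OF op ne] by (simp add: negligible_iff_null_sets)
qed

text \<open>Adjoining one function at a time, as in the Gram--Schmidt process.\<close>

lemma finite_riesz_representation:
  fixes \<phi> :: "'i \<Rightarrow> 'b \<Rightarrow> real" and ip :: "('b \<Rightarrow> real) \<Rightarrow> ('b \<Rightarrow> real) \<Rightarrow> real"
  defines "comb \<equiv> \<lambda>I c x. \<Sum>i\<in>I. c i * \<phi> i x"
  assumes fin: "finite I" and \<phi>: "\<And>i. i \<in> I \<Longrightarrow> \<phi> i \<in> T"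
    and T0: "(\<lambda>x. 0) \<in> T" and T: "\<And>a u v. u \<in> T \<Longrightarrow> v \<in> T \<Longrightarrow> (\<lambda>x. a * u x + v x) \<in> T"
    and sym: "\<And>u v. u \<in> T \<Longrightarrow> v \<in> T \<Longrightarrow> ip u v = ip v u"
    and lin: "\<And>a u v w. u \<in> T \<Longrightarrow> v \<in> T \<Longrightarrow> w \<in> T \<Longrightarrow> ip (\<lambda>x. a * u x + v x) w = a * ip u w + ip v w"
    and pos: "\<And>u. u \<in> T \<Longrightarrow> ip u u = 0 \<Longrightarrow> u = (\<lambda>x. 0)"
    and l: "\<And>a u v. u \<in> T \<Longrightarrow> v \<in> T \<Longrightarrow> l (\<lambda>x. a * u x + v x) = a * l u + l v"
  shows "\<exists>c. \<forall>c'. ip (comb I c) (comb I c') = l (comb I c')"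
  using fin \<phi> l
proof (induction I arbitrary: l rule: finite_induct)
  case empty
  have "ip (\<lambda>x. 0) (\<lambda>x. 0) = 0" using lin[OF T0 T0 T0, of 1] by simp
  moreover have "l (\<lambda>x. 0) = 0" using empty(2)[OF T0 T0, of 1] by simp
  ultimately show ?case by (simp add: comb_def)
next
  case (insert i I)
  note l = insert.prems(2)
  have fT: "\<phi> i \<in> T" using insert.prems by simp
  have cT: "comb J c \<in> T" if "J \<subseteq> I" for J c
    using finite_subset[OF that \<open>finite I\<close>] that
  proof (induction J rule: finite_induct)
    case empty then show ?case using T0 by (simp add: comb_def)
  next
    case (insert j J)
    then have "(\<lambda>x. c j * \<phi> j x + comb J c x) \<in> T" by (intro T insert.IH) (use insert.prems \<open>\<And>j. j \<in> insert i I \<Longrightarrow> \<phi> j \<in> T\<close> in auto)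
    then show ?case using insert.hyps by (simp add: comb_def)
  qed
  have lin': "ip w (\<lambda>x. a * u x + v x) = a * ip w u + ip w v" if "u \<in> T" "v \<in> T" "w \<in> T" for a u v w
    using that lin T sym by (metis (no_types, lifting))
  \<comment> \<open>The induction hypothesis is used for two functionals: pairing with \<phi> i,
    which gives the projection of \<phi> i to the old span, and \<open>l\<close> itself.\<close>
  have "\<exists>c. \<forall>c'. ip (comb I c) (comb I c') = ip (\<phi> i) (comb I c')"
    by (rule insert.IH) (use insert.prems fT lin' in auto)
  then obtain cq where cq: "\<And>c'. ip (comb I cq) (comb I c') = ip (\<phi> i) (comb I c')" by blast
  have "\<exists>c. \<forall>c'. ip (comb I c) (comb I c') = l (comb I c')"
    by (rule insert.IH) (use insert.prems l in auto)
  then obtain cw where cw: "\<And>c'. ip (comb I cw) (comb I c') = l (comb I c')" by blast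
  \<comment> \<open>The component of \<phi> i orthogonal to the old span.\<close>
  define e where "e = (\<lambda>x. (-1) * comb I cq x + \<phi> i x)"
  have eT: "e \<in> T" unfolding e_def by (intro T cT fT) simp
  have e_orth: "ip e (comb I c') = 0" for c'
    unfolding e_def by (subst lin) (use cT fT cq in auto)
  have comb_insert: "comb (insert i I) c = (\<lambda>x. c i * e x + comb I (\<lambda>j. c i * cq j + c j) x)" for c
  proof
    fix x
    have "comb I (\<lambda>j. c i * cq j + c j) x = c i * comb I cq x + comb I c x"
      by (simp add: comb_def sum.distrib sum_distrib_left distrib_right mult.assoc)
    moreover have "comb (insert i I) c x = c i * \<phi> i x + comb I c x"
      using insert.hyps by (simp add: comb_def)
    ultimately show "comb (insert i I) c x = c i * e x + comb I (\<lambda>j. c i * cq j + c j) x"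
      by (simp add: e_def algebra_simps)
  qed
  show ?case
  \<comment> \<open>If \<open>e\<close> is null, \<phi> i adds nothing to the span and gets
    coefficient 0. Otherwise \<open>e\<close> gets coefficient \<open>l e / ip e e\<close>, and the
    old coefficients are corrected for the part of \<phi> i in the old span.\<close>
  proof (cases "ip e e = 0")
    case True
    then have e0: "e = (\<lambda>x. 0)" using pos eT by blast
    define c where "c = (\<lambda>j. if j = i then 0 else cw j)"
    have c: "comb I (\<lambda>j. c i * cq j + c j) = comb I cw"
      unfolding comb_def using insert.hyps by (intro ext sum.cong) (auto simp: c_def)
    have "ip (comb (insert i I) c) (comb (insert i I) c') = l (comb (insert i I) c')" for c'
      unfolding comb_insert c by (simp add: e0 cw)
    then show ?thesis by blast
  next
    case False
    define t where "t = l e / ip e e"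
    define c where "c = (\<lambda>j. if j = i then t else cw j - t * cq j)"
    have ci: "c i = t" by (simp add: c_def)
    have c: "comb I (\<lambda>j. t * cq j + c j) = comb I cw"
      unfolding comb_def using insert.hyps by (intro ext sum.cong) (auto simp: c_def)
    have "ip (comb (insert i I) c) (comb (insert i I) c') = l (comb (insert i I) c')" for c'
    proof -
      let ?u = "comb I (\<lambda>j. c' i * cq j + c' j)"
      have uT: "?u \<in> T" "comb I cw \<in> T" using cT by auto
      have orth: "ip (comb I cw) e = 0" using e_orth sym eT uT by metis
      have "ip (comb (insert i I) c) (comb (insert i I) c')
          = t * ip e (\<lambda>x. c' i * e x + ?u x) + ip (comb I cw) (\<lambda>x. c' i * e x + ?u x)"
        unfolding comb_insert ci c by (intro lin T eT uT)
      also have "\<dots> = t * (c' i * ip e e + ip e ?u) + (c' i * ip (comb I cw) e + ip (comb I cw) ?u)"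
        using eT uT by (simp add: lin')
      also have "\<dots> = c' i * l e + l ?u" using False by (simp add: e_orth orth cw t_def)
      also have "\<dots> = l (comb (insert i I) c')"
        unfolding comb_insert by (rule l[symmetric]) (use eT uT in auto)
      finally show ?thesis .
    qed
    then show ?thesis by blast
  qed
qed

lemma set_integrable_mult_continuous:
  fixes g P :: "'a::euclidean_space \<Rightarrow> real"
  assumes g: "set_integrable lebesgue (ball c r) g" and P: "continuous_on UNIV P"
  shows "set_integrable lebesgue (ball c r) (\<lambda>x. g x * P x)"
proof -
  have "bounded (P ` cball c r)"
    using P by (intro compact_imp_bounded compact_continuous_image continuous_on_subset[OF P]) auto
  then obtain K where "\<forall>y\<in>P ` cball c r. norm y \<le> K" unfolding bounded_iff by blast
  then have K: "\<And>x. x \<in> cball c r \<Longrightarrow> \<bar>P x\<bar> \<le> K" by auto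
  have [measurable]: "P \<in> borel_measurable lebesgue"
    using borel_measurable_continuous_onI[OF P] by (intro measurable_completion) simp
  have "integrable lebesgue (\<lambda>x. K * (indicator (ball c r) x *\<^sub>R g x))"
    using g unfolding set_integrable_def by (rule integrable_mult_right)
  then have "integrable lebesgue (\<lambda>x. (indicator (ball c r) x *\<^sub>R g x) * P x)"
  proof (rule Bochner_Integration.integrable_bound)
    show "(\<lambda>x. (indicator (ball c r) x *\<^sub>R g x) * P x) \<in> borel_measurable lebesgue"
      using g unfolding set_integrable_def by (intro borel_measurable_times) auto
    show "AE x in lebesgue. norm (indicator (ball c r) x *\<^sub>R g x * P x) \<le> norm (K * (indicator (ball c r) x *\<^sub>R g x))"
    proof (intro AE_I2)
      fix x
      show "norm (indicator (ball c r) x *\<^sub>R g x * P x) \<le> norm (K * (indicator (ball c r) x *\<^sub>R g x))"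
      proof (cases "x \<in> ball c r")
        case True
        then have "\<bar>P x\<bar> \<le> \<bar>K\<bar>" using K[of x] by auto
        then have "\<bar>P x\<bar> * \<bar>g x\<bar> \<le> \<bar>K\<bar> * \<bar>g x\<bar>" by (rule mult_right_mono) simp
        then show ?thesis using True by (simp add: abs_mult mult.commute)
      qed simp
    qed
  qed
  then show ?thesis unfolding set_integrable_def by (simp add: mult.assoc)
qed

lemma set_integrable_continuous_ball:
  fixes P :: "'a::euclidean_space \<Rightarrow> real"
  assumes P: "continuous_on UNIV P"
  shows "set_integrable lebesgue (ball c r) P"
proof -
  have "set_integrable lebesgue (ball c r) (\<lambda>x. 1::real)"
    unfolding set_integrable_def by (simp add: lmeasurable_iff_integrable[symmetric])
  from set_integrable_mult_continuous[OF this P] show ?thesis by simp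
qed

text \<open>Serves two functionals: integration against \<open>g\<close> yields the projection,
  evaluation at 0 yields a reproducing polynomial. The pairing is definite because a polynomial that
  vanishes a.e. on a ball is zero.\<close>

lemma poly_riesz:
  fixes c :: "'a::euclidean_space"
  assumes r: "r > 0"
    and l: "\<And>a u v. poly_deg_le d u \<Longrightarrow> poly_deg_le d v \<Longrightarrow> l (\<lambda>x. a * u x + v x) = a * l u + l v"
  shows "\<exists>W. poly_deg_le d W \<and> (\<forall>Q. poly_deg_le d Q \<longrightarrow> (LINT x:ball c r|lebesgue. W x * Q x) = l Q)"
proof -
  define m where "m = (\<lambda>\<alpha> x. \<Prod>b\<in>Basis. (x \<bullet> b :: real) ^ \<alpha> (b::'a))"
  define ip where "ip = (\<lambda>u v. LINT x:ball c r|lebesgue. u x * v x :: real)"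
  have int: "set_integrable lebesgue (ball c r) (\<lambda>x. u x * v x)"
    if "poly_deg_le d u" "poly_deg_le d v" for u v :: "'a \<Rightarrow> real"
    using that continuous_on_poly_deg_le by (intro set_integrable_continuous_ball continuous_intros) auto
  have "\<exists>k. \<forall>k'. ip (\<lambda>x. \<Sum>i\<in>multi_indices d. k i * m i x) (\<lambda>x. \<Sum>i\<in>multi_indices d. k' i * m i x) = l (\<lambda>x. \<Sum>i\<in>multi_indices d. k' i * m i x)"
  proof (rule finite_riesz_representation[where T = "{P. poly_deg_le d P}"])
    show "finite (multi_indices d :: ('a \<Rightarrow> nat) set)" by (rule finite_multi_indices)
    show "m i \<in> {P. poly_deg_le d P}" if "i \<in> multi_indices d" for i
      using that poly_deg_le_monomial[of i d] by (simp add: m_def multi_indices_def)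
    show "(\<lambda>x. a * u x + v x) \<in> {P. poly_deg_le d P}" if "u \<in> {P. poly_deg_le d P}" "v \<in> {P. poly_deg_le d P}" for a u v
      using that by (auto intro: poly_deg_le_add poly_deg_le_scale)
    show "ip u v = ip v u" for u v by (simp add: ip_def mult.commute)
    show "ip (\<lambda>x. a * u x + v x) w = a * ip u w + ip v w" 
      if "u \<in> {P. poly_deg_le d P}" "v \<in> {P. poly_deg_le d P}" "w \<in> {P. poly_deg_le d P}" for a u v w
    proof -
      have "ip (\<lambda>x. a * u x + v x) w = (LINT x:ball c r|lebesgue. a * (u x * w x) + v x * w x)"
        unfolding ip_def by (simp add: algebra_simps)
      also have "\<dots> = (LINT x:ball c r|lebesgue. a * (u x * w x)) + (LINT x:ball c r|lebesgue. v x * w x)"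
        using that int by (intro set_integral_add(2) set_integrable_mult_right) auto
      finally show ?thesis by (simp add: ip_def)
    qed
    show "u = (\<lambda>x. 0)" if u: "u \<in> {P. poly_deg_le d P}" and z: "ip u u = 0" for u
    proof (rule poly_deg_le_eq_0_of_ball)
      show "poly_deg_le d u" using u by simp
      show "r > 0" by fact
      fix x assume x: "x \<in> ball c r"
      have "AE x in lebesgue. indicator (ball c r) x *\<^sub>R (u x * u x) = 0"
        using z int[of u u] u unfolding ip_def set_lebesgue_integral_def set_integrable_def
        by (subst (asm) integral_nonneg_eq_0_iff_AE) (auto intro!: AE_I2)
      then have "AE x in lebesgue. x \<in> ball c r \<longrightarrow> u x = 0" by eventually_elim auto
      with x show "u x = 0"
        using u continuous_on_poly_deg_le[of d u] by (intro eq_on_open_of_AE_eq[of "ball c r" u "\<lambda>_. 0"]) auto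
    qed
    show "l (\<lambda>x. a * u x + v x) = a * l u + l v" if "u \<in> {P. poly_deg_le d P}" "v \<in> {P. poly_deg_le d P}" for a u v
      using that l by blast
  qed (simp add: poly_deg_le_const)
  then obtain k where k: "\<And>k'. ip (\<lambda>x. \<Sum>i\<in>multi_indices d. k i * m i x) (\<lambda>x. \<Sum>i\<in>multi_indices d. k' i * m i x) = l (\<lambda>x. \<Sum>i\<in>multi_indices d. k' i * m i x)"
    by blast
  have "poly_deg_le d (\<lambda>x. \<Sum>i\<in>multi_indices d. k i * m i x)"
    unfolding m_def poly_deg_le_def by blast
  moreover have "ip (\<lambda>x. \<Sum>i\<in>multi_indices d. k i * m i x) Q = l Q" if Q: "poly_deg_le d Q" for Q
  proof -
    obtain k' where "Q = (\<lambda>x. \<Sum>\<alpha>\<in>multi_indices d. k' \<alpha> * (\<Prod>b\<in>Basis. (x \<bullet> b) ^ \<alpha> b))"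
      using Q by (rule poly_deg_le_expand)
    then have "Q = (\<lambda>x. \<Sum>i\<in>multi_indices d. k' i * m i x)" unfolding m_def .
    then show ?thesis using k[of k'] by simp
  qed
  ultimately show ?thesis unfolding ip_def by blast
qed

text \<open>The \<open>THE\<close> in the definition needs existence and uniqueness. Existence comes
  from representing the functional that integrates against \<open>g\<close>; two solutions differ by
  a polynomial orthogonal to itself.\<close>

lemma proj_poly:
  fixes g :: "'a::euclidean_space \<Rightarrow> real"
  assumes r: "r > 0" and g: "set_integrable lebesgue (ball c r) g"
  shows "poly_deg_le d (proj_poly d (ball c r) g)"
    and "poly_deg_le d R \<Longrightarrow> (LINT x:ball c r|lebesgue. (g x - proj_poly d (ball c r) g x) * R x) = 0"
proof -
  have gint: "set_integrable lebesgue (ball c r) (\<lambda>x. g x * P x)" if "poly_deg_le d P" for P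
    using that by (intro set_integrable_mult_continuous g continuous_on_poly_deg_le)
  have pint: "set_integrable lebesgue (ball c r) (\<lambda>x. P x * Q x)" if "poly_deg_le d P" "poly_deg_le d Q" for P Q :: "'a \<Rightarrow> real"
    using that continuous_on_poly_deg_le by (intro set_integrable_continuous_ball continuous_intros) auto
  define good where "good P \<longleftrightarrow> poly_deg_le d P \<and> (\<forall>R. poly_deg_le d R \<longrightarrow> (LINT x:ball c r|lebesgue. (g x - P x) * R x) = 0)" for P
  have split: "(LINT x:ball c r|lebesgue. (g x - P x) * R x) = (LINT x:ball c r|lebesgue. g x * R x) - (LINT x:ball c r|lebesgue. P x * R x)"
    if "poly_deg_le d P" "poly_deg_le d R" for P R
    using set_integral_diff(2)[OF gint[OF that(2)] pint[OF that]] by (simp add: algebra_simps)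
  have "\<exists>W. poly_deg_le d W \<and> (\<forall>Q. poly_deg_le d Q \<longrightarrow> (LINT x:ball c r|lebesgue. W x * Q x) = (LINT x:ball c r|lebesgue. g x * Q x))"
  proof (rule poly_riesz[OF r])
    fix a :: real and u v :: "'a \<Rightarrow> real" assume uv: "poly_deg_le d u" "poly_deg_le d v"
    have "(LINT x:ball c r|lebesgue. g x * (a * u x + v x)) = (LINT x:ball c r|lebesgue. a * (g x * u x) + g x * v x)"
      by (simp add: algebra_simps)
    also have "\<dots> = (LINT x:ball c r|lebesgue. a * (g x * u x)) + (LINT x:ball c r|lebesgue. g x * v x)"
      by (intro set_integral_add(2) set_integrable_mult_right gint uv)
    finally show "(LINT x:ball c r|lebesgue. g x * (a * u x + v x)) = a * (LINT x:ball c r|lebesgue. g x * u x) + (LINT x:ball c r|lebesgue. g x * v x)"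
      by simp
  qed
  then obtain W where W: "good W" unfolding good_def using split by fastforce
  have "P = W" if P: "good P" for P
  proof -
    define D where "D = (\<lambda>x. P x - W x)"
    have D: "poly_deg_le d D" using P W unfolding good_def D_def by (blast intro: poly_deg_le_diff)
    have "(LINT x:ball c r|lebesgue. D x * D x) = (LINT x:ball c r|lebesgue. (g x - W x) * D x - (g x - P x) * D x)"
      unfolding D_def by (simp add: algebra_simps)
    also have "\<dots> = (LINT x:ball c r|lebesgue. (g x - W x) * D x) - (LINT x:ball c r|lebesgue. (g x - P x) * D x)"
    proof (rule set_integral_diff(2))
      show "set_integrable lebesgue (ball c r) (\<lambda>x. (g x - W x) * D x)"
        using set_integral_diff(1)[OF gint[OF D] pint[of W D]] W D by (simp add: good_def algebra_simps)
      show "set_integrable lebesgue (ball c r) (\<lambda>x. (g x - P x) * D x)"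
        using set_integral_diff(1)[OF gint[OF D] pint[of P D]] P D by (simp add: good_def algebra_simps)
    qed
    also have "\<dots> = 0" using P W D unfolding good_def by simp
    finally have z: "(LINT x:ball c r|lebesgue. D x * D x) = 0" .
    have "D = (\<lambda>x. 0)"
    proof (rule poly_deg_le_eq_0_of_ball[OF D r])
      fix x assume x: "x \<in> ball c r"
      have "AE x in lebesgue. indicator (ball c r) x *\<^sub>R (D x * D x) = 0"
        using z pint[OF D D] unfolding set_lebesgue_integral_def set_integrable_def
        by (subst (asm) integral_nonneg_eq_0_iff_AE) (auto intro!: AE_I2)
      then have "AE x in lebesgue. x \<in> ball c r \<longrightarrow> D x = 0" by eventually_elim auto
      with x show "D x = 0"
        using continuous_on_poly_deg_le[OF D] by (intro eq_on_open_of_AE_eq[of "ball c r" D "\<lambda>_. 0"]) auto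
    qed
    then have "P x - W x = 0" for x unfolding D_def by (rule fun_cong)
    then show "P = W" by auto
  qed
  with W have "proj_poly d (ball c r) g = W"
    unfolding proj_poly_def good_def by (intro the_equality) blast+
  with W show "poly_deg_le d (proj_poly d (ball c r) g)"
    and "poly_deg_le d R \<Longrightarrow> (LINT x:ball c r|lebesgue. (g x - proj_poly d (ball c r) g x) * R x) = 0"
    unfolding good_def by auto
qed

lemma measure_lebesgue_ball:
  "0 \<le> r \<Longrightarrow> measure lebesgue (ball (c::'a::euclidean_space) r) = unit_ball_vol (real DIM('a)) * r ^ DIM('a)"
  by (simp add: content_ball)

lemma emeasure_lebesgue_ball:
  "0 \<le> r \<Longrightarrow> emeasure lebesgue (ball (c::'a::euclidean_space) r) = ennreal (unit_ball_vol (real DIM('a)) * r ^ DIM('a))"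
  by (simp add: emeasure_ball)

text \<open>Since the projection is the least squares approximation, \<open>(g - P)\<^sup>2\<close> has integral at most
  \<open>A\<^sup>2 |B|\<close>, and \<open>2 |v| \<le> v\<^sup>2 / A + A\<close> turns this into an \<open>L\<^sup>1\<close> bound.\<close>

lemma proj_poly_near_best:
  fixes g :: "'a::euclidean_space \<Rightarrow> real"
  assumes r: "r > 0" and g: "set_integrable lebesgue (ball c r) g"
    and Q: "poly_deg_le d Q" and A: "A > 0"
    and le: "AE x in lebesgue. x \<in> ball c r \<longrightarrow> \<bar>g x - Q x\<bar> \<le> A"
  shows "(\<integral>\<^sup>+x\<in>ball c r. ennreal \<bar>g x - proj_poly d (ball c r) g x\<bar> \<partial>lebesgue) \<le> ennreal (A * measure lebesgue (ball c r))"
proof -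
  define P where "P = proj_poly d (ball c r) g"
  define u where "u = (\<lambda>x. g x - Q x)"
  define v where "v = (\<lambda>x. g x - P x)"
  define D where "D = (\<lambda>x. P x - Q x)"
  let ?B = "ball c r" and ?m = "measure lebesgue (ball c r)"
  have P: "poly_deg_le d P" unfolding P_def by (rule proj_poly[OF r g])
  have D: "poly_deg_le d D" unfolding D_def by (rule poly_deg_le_diff[OF P Q])
  note cP = continuous_on_poly_deg_le[OF P, of UNIV] and cQ = continuous_on_poly_deg_le[OF Q, of UNIV]
    and cD = continuous_on_poly_deg_le[OF D, of UNIV]
  have ui: "set_integrable lebesgue ?B u" unfolding u_def
    by (intro set_integral_diff g set_integrable_continuous_ball cQ)
  have vi: "set_integrable lebesgue ?B v" unfolding v_def
    by (intro set_integral_diff g set_integrable_continuous_ball cP)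
  have ci: "set_integrable lebesgue ?B (\<lambda>x. a)" for a :: real
    by (intro set_integrable_continuous_ball continuous_intros)
  \<comment> \<open>\<open>g\<close> is only known to be integrable, so squares need an argument:
    \<open>u\<close> is essentially bounded by \<open>A\<close> on the ball, and \<open>v\<close>
    differs from it by a polynomial.\<close>
  have uui: "set_integrable lebesgue ?B (\<lambda>x. u x * u x)"
  proof (rule set_integrable_bound[OF ci[of "A * A"]])
    have "(\<lambda>x. (indicator ?B x *\<^sub>R u x) * (indicator ?B x *\<^sub>R u x)) \<in> borel_measurable lebesgue"
      using ui unfolding set_integrable_def by (intro borel_measurable_times) auto
    moreover have "(\<lambda>x. (indicator ?B x *\<^sub>R u x) * (indicator ?B x *\<^sub>R u x)) = (\<lambda>x. indicator ?B x *\<^sub>R (u x * u x))"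
      by (auto simp: indicator_def)
    ultimately show "set_borel_measurable lebesgue ?B (\<lambda>x. u x * u x)" by (simp add: set_borel_measurable_def)
    show "AE x in lebesgue. x \<in> ?B \<longrightarrow> norm (u x * u x) \<le> norm (A * A)"
      using le
    proof eventually_elim
      case (elim x)
      show ?case
      proof
        assume "x \<in> ball c r"
        then have "\<bar>u x\<bar> \<le> A" unfolding u_def using elim by blast
        then show "norm (u x * u x) \<le> norm (A * A)"
          using A mult_mono[of "\<bar>u x\<bar>" A "\<bar>u x\<bar>" A] by (simp add: abs_mult)
      qed
    qed
  qed
  have uDi: "set_integrable lebesgue ?B (\<lambda>x. u x * D x)" by (rule set_integrable_mult_continuous[OF ui cD])
  have vDi: "set_integrable lebesgue ?B (\<lambda>x. v x * D x)" by (rule set_integrable_mult_continuous[OF vi cD])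
  have DDi: "set_integrable lebesgue ?B (\<lambda>x. D x * D x)"
    by (intro set_integrable_continuous_ball continuous_intros cD)
  have uv: "u x = v x + D x" for x by (simp add: u_def v_def D_def)
  have vveq: "v x * v x = u x * u x - (2 * (v x * D x) + D x * D x)" for x by (simp add: uv algebra_simps)
  have vvi: "set_integrable lebesgue ?B (\<lambda>x. v x * v x)"
    unfolding vveq by (intro set_integral_diff set_integral_add uui DDi set_integrable_mult_right vDi)
  have "(LINT x:?B|lebesgue. v x * v x) = (LINT x:?B|lebesgue. u x * u x) - (2 * (LINT x:?B|lebesgue. v x * D x) + (LINT x:?B|lebesgue. D x * D x))"
    unfolding vveq by (simp add: set_integral_diff set_integral_add uui DDi set_integrable_mult_right vDi)
  \<comment> \<open>The residual is orthogonal to the polynomial \<open>D\<close>, so the mixed term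
    disappears.\<close>
  also have "(LINT x:?B|lebesgue. v x * D x) = 0"
    unfolding v_def P_def by (rule proj_poly(2)[OF r g D])
  finally have "(LINT x:?B|lebesgue. v x * v x) \<le> (LINT x:?B|lebesgue. u x * u x)"
  proof -
    assume "(LINT x:?B|lebesgue. v x * v x) = (LINT x:?B|lebesgue. u x * u x) - (2 * 0 + (LINT x:?B|lebesgue. D x * D x))"
    moreover have "0 \<le> (LINT x:?B|lebesgue. D x * D x)"
      unfolding set_lebesgue_integral_def by (intro integral_nonneg_AE AE_I2) simp
    ultimately show ?thesis by linarith
  qed
  also have "\<dots> \<le> (LINT x:?B|lebesgue. A * A)"
  proof (intro set_integral_mono_AE uui ci)
    show "AE x in lebesgue. x \<in> ball c r \<longrightarrow> u x * u x \<le> A * A"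
      using le
    proof eventually_elim
      case (elim x)
      show ?case
      proof
        assume "x \<in> ball c r"
        then have "\<bar>u x\<bar> \<le> A" unfolding u_def using elim by blast
        then have "\<bar>u x\<bar> * \<bar>u x\<bar> \<le> A * A" using A by (intro mult_mono) auto
        then show "u x * u x \<le> A * A" by simp
      qed
    qed
  qed
  also have "\<dots> = A * A * ?m" by (simp add: set_lebesgue_integral_def)
  finally have vv: "(LINT x:?B|lebesgue. v x * v x) \<le> A * A * ?m" .
  have "(LINT x:?B|lebesgue. \<bar>v x\<bar>) \<le> (LINT x:?B|lebesgue. (1 / (2 * A)) * (v x * v x) + A / 2)"
  proof (intro set_integral_mono set_integral_add ci set_integrable_mult_right vvi set_integrable_abs vi)
    fix x
    have "0 \<le> (\<bar>v x\<bar> - A) * (\<bar>v x\<bar> - A)" by simp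
    then have "2 * A * \<bar>v x\<bar> \<le> v x * v x + A * A" by (simp add: algebra_simps)
    then show "\<bar>v x\<bar> \<le> (1 / (2 * A)) * (v x * v x) + A / 2" using A by (simp add: field_simps)
  qed
  also have "\<dots> = (1 / (2 * A)) * (LINT x:?B|lebesgue. v x * v x) + A / 2 * ?m"
    by (subst set_integral_add(2)) (auto intro!: ci set_integrable_mult_right vvi simp: set_lebesgue_integral_def)
  also have "\<dots> \<le> (1 / (2 * A)) * (A * A * ?m) + A / 2 * ?m"
    using A vv by (intro add_mono mult_left_mono) auto
  also have "\<dots> = A * ?m" using A by (simp add: field_simps)
  finally have L: "(LINT x:?B|lebesgue. \<bar>v x\<bar>) \<le> A * ?m" .
  have "(\<integral>\<^sup>+x\<in>?B. ennreal \<bar>v x\<bar> \<partial>lebesgue) = (\<integral>\<^sup>+x. ennreal (indicator ?B x *\<^sub>R \<bar>v x\<bar>) \<partial>lebesgue)"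
    by (intro nn_integral_cong) (auto simp: indicator_def)
  also have "\<dots> = ennreal (LINT x:?B|lebesgue. \<bar>v x\<bar>)"
    unfolding set_lebesgue_integral_def
    using set_integrable_abs[OF vi] by (intro nn_integral_eq_integral) (auto simp: set_integrable_def)
  finally show ?thesis using L unfolding v_def P_def by (simp add: ennreal_leI)
qed

section \<open>Scaling and point evaluation of polynomials\<close>

lemma nn_integral_lborel_affine:
  fixes t :: "'a::euclidean_space"
  assumes [measurable]: "f \<in> borel_measurable borel" and "c \<noteq> 0"
  shows "(\<integral>\<^sup>+x. f x \<partial>lborel) = ennreal (\<bar>c\<bar> ^ DIM('a)) * (\<integral>\<^sup>+x. f (t + c *\<^sub>R x) \<partial>lborel)"
  by (subst lborel_affine[OF \<open>c \<noteq> 0\<close>, of t])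
    (simp add: nn_integral_density nn_integral_distr nn_integral_cmult ennreal_power)

text \<open>On the unit ball the value at 0 is the integral against a fixed polynomial
  \<open>W\<close>, hence at most sup |W| times the L1 norm. An affine substitution moves this to
  \<open>ball y s\<close> and produces the power of \<open>s\<close>.\<close>

lemma poly_deg_le_eval_bound:
  "\<exists>C>0. \<forall>(Q :: 'a::euclidean_space \<Rightarrow> real) y s. poly_deg_le d Q \<longrightarrow> s > 0 \<longrightarrow>
     ennreal (\<bar>Q y\<bar> * s ^ DIM('a)) \<le> ennreal C * (\<integral>\<^sup>+x\<in>ball y s. ennreal \<bar>Q x\<bar> \<partial>lebesgue)"
proof -
  obtain W :: "'a \<Rightarrow> real" where W: "poly_deg_le d W" 
    "\<And>Q. poly_deg_le d Q \<Longrightarrow> (LINT x:ball 0 1|lebesgue. W x * Q x) = Q 0"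
    using poly_riesz[of 1 d "\<lambda>Q. Q 0" "0::'a"] by auto
  have "bounded (W ` cball 0 1)"
    using continuous_on_poly_deg_le[OF W(1)] by (intro compact_imp_bounded compact_continuous_image) auto
  then obtain K where "\<forall>y\<in>W ` cball 0 1. norm y \<le> K" unfolding bounded_iff by blast
  then have K: "\<And>x. x \<in> cball 0 1 \<Longrightarrow> \<bar>W x\<bar> \<le> K" by auto
  have K0: "K \<ge> 0" using K[of 0] by auto
  \<comment> \<open>The 1 makes the constant positive even if \<open>K\<close> is 0.\<close>
  define C where "C = K + 1"
  have C0: "C \<ge> 0" using K0 by (simp add: C_def)
  have unit: "ennreal \<bar>Q 0\<bar> \<le> ennreal C * (\<integral>\<^sup>+x\<in>ball 0 1. ennreal \<bar>Q x\<bar> \<partial>lborel)"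
    if Q: "poly_deg_le d Q" for Q :: "'a \<Rightarrow> real"
  proof -
    have i: "set_integrable lebesgue (ball 0 1) (\<lambda>x. \<bar>Q x\<bar>)" "set_integrable lebesgue (ball 0 1) (\<lambda>x. W x * Q x)"
      using continuous_on_poly_deg_le[OF Q] continuous_on_poly_deg_le[OF W(1)]
      by (intro set_integrable_continuous_ball continuous_intros; simp)+
    have "\<bar>Q 0\<bar> \<le> (LINT x:ball 0 1|lebesgue. \<bar>W x * Q x\<bar>)"
      unfolding W(2)[OF Q, symmetric] set_lebesgue_integral_def
      by (rule order_trans[OF integral_abs_bound]) (simp add: abs_mult)
    also have "\<dots> \<le> (LINT x:ball 0 1|lebesgue. C * \<bar>Q x\<bar>)"
    proof (intro set_integral_mono set_integrable_abs[OF i(2)] i(1) set_integrable_mult_right)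
      fix x :: 'a assume "x \<in> ball 0 1"
      then have "\<bar>W x\<bar> \<le> C" using K[of x] by (auto simp: C_def)
      then show "\<bar>W x * Q x\<bar> \<le> C * \<bar>Q x\<bar>" by (simp add: abs_mult mult_right_mono)
    qed
    finally have "\<bar>Q 0\<bar> \<le> C * (LINT x:ball 0 1|lebesgue. \<bar>Q x\<bar>)" by simp
    then have "ennreal \<bar>Q 0\<bar> \<le> ennreal C * ennreal (LINT x:ball 0 1|lebesgue. \<bar>Q x\<bar>)"
      using C0 by (simp add: ennreal_mult'[symmetric] ennreal_leI)
    also have "ennreal (LINT x:ball 0 1|lebesgue. \<bar>Q x\<bar>) = (\<integral>\<^sup>+x. ennreal (indicator (ball 0 1) x *\<^sub>R \<bar>Q x\<bar>) \<partial>lebesgue)"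
      unfolding set_lebesgue_integral_def
      using i(1) by (intro nn_integral_eq_integral[symmetric]) (auto simp: set_integrable_def)
    also have "\<dots> = (\<integral>\<^sup>+x\<in>ball 0 1. ennreal \<bar>Q x\<bar> \<partial>lborel)"
      unfolding nn_integral_completion by (intro nn_integral_cong) (auto simp: indicator_def)
    finally show ?thesis .
  qed
  have "ennreal (\<bar>Q y\<bar> * s ^ DIM('a)) \<le> ennreal C * (\<integral>\<^sup>+x\<in>ball y s. ennreal \<bar>Q x\<bar> \<partial>lebesgue)"
    if Q: "poly_deg_le d Q" and s: "s > 0" for Q :: "'a \<Rightarrow> real" and y s
  proof -
    note [measurable] = borel_measurable_poly_deg_le[OF Q]
    have "ennreal (\<bar>Q y\<bar> * s ^ DIM('a)) = ennreal (s ^ DIM('a)) * ennreal \<bar>Q (y + s *\<^sub>R 0)\<bar>"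
      using s by (simp add: ennreal_mult'' mult.commute)
    also have "\<dots> \<le> ennreal (s ^ DIM('a)) * (ennreal C * (\<integral>\<^sup>+x\<in>ball 0 1. ennreal \<bar>Q (y + s *\<^sub>R x)\<bar> \<partial>lborel))"
      by (intro mult_left_mono unit poly_deg_le_affine Q) simp
    also have "(\<integral>\<^sup>+x\<in>ball 0 1. ennreal \<bar>Q (y + s *\<^sub>R x)\<bar> \<partial>lborel) = (\<integral>\<^sup>+x. ennreal \<bar>Q (y + s *\<^sub>R x)\<bar> * indicator (ball y s) (y + s *\<^sub>R x) \<partial>lborel)"
      using s by (intro nn_integral_cong) (auto simp: indicator_def dist_norm)
    also have "ennreal (s ^ DIM('a)) * (ennreal C * \<dots>) = ennreal C * (ennreal (\<bar>s\<bar> ^ DIM('a)) * \<dots>)"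
      using s by (simp add: mult_ac)
    also have "\<dots> = ennreal C * (\<integral>\<^sup>+x\<in>ball y s. ennreal \<bar>Q x\<bar> \<partial>lborel)"
    proof -
      have "(\<lambda>x. ennreal \<bar>Q x\<bar> * indicator (ball y s) x) \<in> borel_measurable borel"
        by (intro borel_measurable_times_ennreal borel_measurable_indicator measurable_compose[OF _ measurable_ennreal] borel_measurable_abs borel_measurable_poly_deg_le[OF Q]) simp
      then show ?thesis using s by (subst nn_integral_lborel_affine[symmetric, of "\<lambda>x. ennreal \<bar>Q x\<bar> * indicator (ball y s) x"]) auto
    qed
    finally show ?thesis by (simp add: nn_integral_completion)
  qed
  then show ?thesis using K0 by (intro exI[of _ C]) (auto simp: C_def)
qed

section \<open>From Campanato estimates to differences\<close>

lemma ball_in_sets_borel [measurable]: "ball (c::'a::metric_space) r \<in> sets borel"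
  by simp

lemma geometric_increments_limit:
  fixes a :: "nat \<Rightarrow> real"
  assumes q: "0 \<le> q" "q < 1" and a: "\<And>m. \<bar>a (Suc m) - a m\<bar> \<le> K * q ^ m"
  shows "\<exists>L. \<forall>m. \<bar>L - a m\<bar> \<le> K * q ^ m / (1 - q)"
proof -
  have K: "0 \<le> K" using a[of 0] by simp
  \<comment> \<open>Keeping the exact partial sum of the geometric series, with its factor
    \<open>1 - q ^ j\<close>, lets the induction close; \<open>tele'\<close> drops the
    factor.\<close>
  have tele: "\<bar>a (m + j) - a m\<bar> \<le> K * q ^ m * (1 - q ^ j) / (1 - q)" for m j
  proof (induction j)
    case (Suc j)
    have "\<bar>a (m + Suc j) - a m\<bar> \<le> \<bar>a (Suc (m + j)) - a (m + j)\<bar> + \<bar>a (m + j) - a m\<bar>" by simp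
    also have "\<dots> \<le> K * q ^ (m + j) + K * q ^ m * (1 - q ^ j) / (1 - q)"
      using a[of "m + j"] Suc by (intro add_mono)
    also have "\<dots> = K * q ^ m * (1 - q ^ Suc j) / (1 - q)"
      using q by (simp add: field_simps power_add)
    finally show ?case .
  qed simp
  have tele': "\<bar>a (m + j) - a m\<bar> \<le> K * q ^ m / (1 - q)" for m j
  proof -
    have "K * q ^ m * (1 - q ^ j) \<le> K * q ^ m * 1" using K q by (intro mult_left_mono) auto
    then have "K * q ^ m * (1 - q ^ j) / (1 - q) \<le> K * q ^ m * 1 / (1 - q)"
      using q by (intro divide_right_mono) auto
    then show ?thesis using tele[of m j] by simp
  qed
  have "(\<lambda>m. K * q ^ m / (1 - q)) \<longlonglongrightarrow> K * 0 / (1 - q)"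
    using q by (intro tendsto_intros LIMSEQ_realpow_zero) auto
  then have lim0: "(\<lambda>m. K * q ^ m / (1 - q)) \<longlonglongrightarrow> 0" by simp
  have "Cauchy a"
  proof (rule metric_CauchyI)
    fix e :: real assume "0 < e"
    then have "eventually (\<lambda>m. K * q ^ m / (1 - q) < e / 2) sequentially"
      using lim0 by (auto dest!: order_tendstoD(2)[where a = "e / 2"])
    then obtain N where N: "K * q ^ N / (1 - q) < e / 2" by (auto simp: eventually_sequentially)
    have "dist (a m) (a N) < e / 2" if "m \<ge> N" for m
    proof -
      have "dist (a m) (a N) \<le> K * q ^ N / (1 - q)" using tele'[of N "m - N"] that by (simp add: dist_real_def)
      then show ?thesis using N by linarith
    qed
    then have "dist (a m) (a n) < e" if "m \<ge> N" "n \<ge> N" for m n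
      using that by (blast intro: dist_triangle_half_l)
    then show "\<exists>M. \<forall>m\<ge>M. \<forall>n\<ge>M. dist (a m) (a n) < e" by blast
  qed
  then obtain L where L: "a \<longlonglongrightarrow> L" by (auto simp: Cauchy_convergent_iff convergent_def)
  have "\<bar>L - a m\<bar> \<le> K * q ^ m / (1 - q)" for m
  proof (rule LIMSEQ_le_const2)
    show "(\<lambda>j. \<bar>a (m + j) - a m\<bar>) \<longlonglongrightarrow> \<bar>L - a m\<bar>"
      using LIMSEQ_ignore_initial_segment[OF L, of m] by (intro tendsto_intros) (simp add: add.commute)
    show "\<exists>N. \<forall>n\<ge>N. \<bar>a (m + n) - a m\<bar> \<le> K * q ^ m / (1 - q)" using tele' by blast
  qed
  then show ?thesis by blast
qed

text \<open>Averaging the ball estimate over all centres avoids the Lebesgue differentiation theorem.\<close>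

lemma AE_zero_of_small_ball_integrals:
  fixes u :: "'a::euclidean_space \<Rightarrow> ennreal"
  assumes u: "u \<in> borel_measurable lebesgue" and \<beta>: "0 < \<beta>" and \<rho>: "0 < \<rho>"
    and small: "\<And>c r. 0 < r \<Longrightarrow> r \<le> \<rho> \<Longrightarrow> (\<integral>\<^sup>+x\<in>ball c r. u x \<partial>lebesgue) \<le> ennreal (K * r ^ DIM('a) * r powr \<beta>)"
  shows "AE x in lebesgue. u x = 0"
proof -
  \<comment> \<open>Fubini on \<open>lborel\<close> wants a Borel function, so \<open>u\<close> is
    replaced by a Borel version.\<close>
  obtain v where v[measurable]: "v \<in> borel_measurable lborel" and ae: "AE x in lborel. u x = v x"
    using completion_ex_borel_measurable[OF u] by blast
  have small_v: "(\<integral>\<^sup>+y\<in>ball c r. v y \<partial>lborel) \<le> ennreal (\<bar>K\<bar> * r ^ DIM('a) * r powr \<beta>)" if "0 < r" "r \<le> \<rho>" for c r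
  proof -
    have "(\<integral>\<^sup>+y\<in>ball c r. v y \<partial>lborel) = (\<integral>\<^sup>+y\<in>ball c r. u y \<partial>lborel)"
    proof (rule nn_integral_cong_AE)
      show "AE y in lborel. v y * indicator (ball c r) y = u y * indicator (ball c r) y"
        using ae by eventually_elim simp
    qed
    also have "\<dots> \<le> ennreal (K * r ^ DIM('a) * r powr \<beta>)" using small[OF that] by (simp add: nn_integral_completion)
    also have "\<dots> \<le> ennreal (\<bar>K\<bar> * r ^ DIM('a) * r powr \<beta>)"
      using that by (intro ennreal_leI mult_right_mono) auto
    finally show ?thesis .
  qed
  define \<omega> where "\<omega> = unit_ball_vol (real DIM('a))"
  have \<omega>: "\<omega> > 0" by (simp add: \<omega>_def)
  \<comment> \<open>Integrate the small-ball estimate over all centres in the ball of radius N + 1.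
    After exchanging the integrals every y in \<open>ball 0 N\<close> carries the weight |ball y r|,
    and the powers \<open>r ^ DIM('a)\<close> cancel, leaving a multiple of
    \<open>r powr \<beta>\<close>. The condition \<open>r \<le> 1\<close> keeps
    \<open>ball y r\<close> inside the larger ball.\<close>
  have bound: "(\<integral>\<^sup>+y\<in>ball 0 (real N). v y \<partial>lborel) \<le> ennreal ((real N + 1) ^ DIM('a) * \<bar>K\<bar> * r powr \<beta>)"
    if r: "0 < r" "r \<le> \<rho>" "r \<le> 1" for N :: nat and r
  proof -
    let ?I = "\<lambda>y. \<integral>\<^sup>+x. indicator (ball 0 (real N + 1)) x * indicator (ball y r) x \<partial>lborel"
    have [measurable]: "(\<lambda>z. indicator (ball (fst z) r) (snd z) :: ennreal) \<in> borel_measurable (lborel \<Otimes>\<^sub>M lborel :: ('a \<times> 'a) measure)"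
    proof -
      have "(\<lambda>z. indicator (ball (fst z) r) (snd z) :: ennreal) = indicator {z :: 'a \<times> 'a. dist (fst z) (snd z) < r}"
        by (auto simp: indicator_def)
      moreover have "open {z :: 'a \<times> 'a. dist (fst z) (snd z) < r}"
        by (intro open_Collect_less continuous_intros)
      then have "{z :: 'a \<times> 'a. dist (fst z) (snd z) < r} \<in> sets (lborel \<Otimes>\<^sub>M lborel)"
        unfolding sets_pair_measure_cong[OF sets_lborel sets_lborel] borel_prod by (rule borel_open)
      ultimately show ?thesis by simp
    qed
    have m: "(\<lambda>(x, y). indicator (ball 0 (real N + 1)) x * (v y * indicator (ball x r) y)) \<in> borel_measurable (lborel \<Otimes>\<^sub>M lborel)"
      unfolding split_beta'
    proof (intro borel_measurable_times_ennreal)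
      have "(indicator (ball 0 (real N + 1)) :: 'a \<Rightarrow> ennreal) \<in> borel_measurable lborel" by (simp add: borel_measurable_indicator)
      then show "(\<lambda>z. indicator (ball 0 (real N + 1)) (fst z) :: ennreal) \<in> borel_measurable (lborel \<Otimes>\<^sub>M lborel :: ('a \<times> 'a) measure)"
        by (rule measurable_compose[OF measurable_fst])
      show "(\<lambda>z. v (snd z)) \<in> borel_measurable (lborel \<Otimes>\<^sub>M lborel :: ('a \<times> 'a) measure)"
        by (rule measurable_compose[OF measurable_snd v])
    qed fact
    have "ennreal (\<omega> * r ^ DIM('a)) * (\<integral>\<^sup>+y\<in>ball 0 (real N). v y \<partial>lborel)
        = (\<integral>\<^sup>+y. v y * indicator (ball 0 (real N)) y * ennreal (\<omega> * r ^ DIM('a)) \<partial>lborel)"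
      by (subst nn_integral_multc) (simp_all add: mult.commute)
    also have "\<dots> \<le> (\<integral>\<^sup>+y. v y * ?I y \<partial>lborel)"
    proof (rule nn_integral_mono)
      fix y :: 'a
      show "v y * indicator (ball 0 (real N)) y * ennreal (\<omega> * r ^ DIM('a)) \<le> v y * ?I y"
      proof (cases "y \<in> ball 0 (real N)")
        case True
        have "indicator (ball 0 (real N + 1)) x * indicator (ball y r) x = (indicator (ball y r) x :: ennreal)" for x
        proof (cases "x \<in> ball y r")
          case xy: True
          have "norm x \<le> norm y + norm (x - y)" using norm_triangle_ineq[of y "x - y"] by simp
          then have "x \<in> ball 0 (real N + 1)"
            using xy True r by (simp add: dist_norm norm_minus_commute)
          then show ?thesis by simp
        qed simp
        then have "?I y = emeasure lborel (ball y r)" by simp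
        also have "\<dots> = ennreal (\<omega> * r ^ DIM('a))" using r by (simp add: emeasure_ball \<omega>_def)
        finally have "?I y = ennreal (\<omega> * r ^ DIM('a))" .
        then show ?thesis using True by simp
      qed simp
    qed
    also have "\<dots> = (\<integral>\<^sup>+y. \<integral>\<^sup>+x. indicator (ball 0 (real N + 1)) x * (v y * indicator (ball x r) y) \<partial>lborel \<partial>lborel)"
    proof (rule nn_integral_cong)
      fix y :: 'a
      have "v y * ?I y = (\<integral>\<^sup>+x. v y * (indicator (ball 0 (real N + 1)) x * indicator (ball y r) x) \<partial>lborel)"
        by (rule nn_integral_cmult[symmetric]) simp
      also have "\<dots> = (\<integral>\<^sup>+x. indicator (ball 0 (real N + 1)) x * (v y * indicator (ball x r) y) \<partial>lborel)"
        by (intro nn_integral_cong) (auto simp: indicator_def dist_commute)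
      finally show "v y * ?I y = \<dots>" .
    qed
    also have "\<dots> = (\<integral>\<^sup>+x. \<integral>\<^sup>+y. indicator (ball 0 (real N + 1)) x * (v y * indicator (ball x r) y) \<partial>lborel \<partial>lborel)"
      by (rule lborel_pair.Fubini'[OF m])
    also have "\<dots> = (\<integral>\<^sup>+x. indicator (ball 0 (real N + 1)) x * (\<integral>\<^sup>+y\<in>ball x r. v y \<partial>lborel) \<partial>lborel)"
      by (intro nn_integral_cong nn_integral_cmult) simp
    also have "\<dots> \<le> (\<integral>\<^sup>+x. indicator (ball (0::'a) (real N + 1)) x * ennreal (\<bar>K\<bar> * r ^ DIM('a) * r powr \<beta>) \<partial>lborel)"
      by (rule nn_integral_mono, rule mult_left_mono, rule small_v) (use r in auto)
    also have "\<dots> = ennreal (\<omega> * (real N + 1) ^ DIM('a)) * ennreal (\<bar>K\<bar> * r ^ DIM('a) * r powr \<beta>)"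
      by (simp add: nn_integral_multc emeasure_ball \<omega>_def)
    also have "\<dots> = ennreal (\<omega> * r ^ DIM('a)) * ennreal ((real N + 1) ^ DIM('a) * \<bar>K\<bar> * r powr \<beta>)"
      using r \<omega> by (simp add: ennreal_mult'[symmetric] mult_ac)
    finally have "ennreal (\<omega> * r ^ DIM('a)) * (\<integral>\<^sup>+y\<in>ball 0 (real N). v y \<partial>lborel) \<le> \<dots>" .
    moreover have "0 < ennreal (\<omega> * r ^ DIM('a))" "ennreal (\<omega> * r ^ DIM('a)) < top" using r \<omega> by simp_all
    ultimately show ?thesis by (simp add: ennreal_mult_le_mult_iff)
  qed
  have zero: "(\<integral>\<^sup>+y\<in>ball 0 (real N). v y \<partial>lborel) = 0" for N :: nat
  proof -
    define s where "s = (\<lambda>m::nat. min \<rho> 1 / real (Suc m))"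
    have s: "0 < s m" "s m \<le> \<rho>" "s m \<le> 1" for m
    proof -
      have "s m \<le> min \<rho> 1 / 1" unfolding s_def using \<rho> by (intro divide_left_mono) auto
      then show "0 < s m" "s m \<le> \<rho>" "s m \<le> 1" using \<rho> by (auto simp: s_def)
    qed
    have "s \<longlonglongrightarrow> 0" unfolding s_def by (rule LIMSEQ_Suc[OF lim_const_over_n])
    then have "(\<lambda>m. s m powr \<beta>) \<longlonglongrightarrow> 0"
      using \<beta> by (intro tendsto_zero_powrI[where b = \<beta>]) (auto intro!: always_eventually less_imp_le[OF s(1)])
    then have "(\<lambda>m. ennreal ((real N + 1) ^ DIM('a) * \<bar>K\<bar> * s m powr \<beta>)) \<longlonglongrightarrow> ennreal ((real N + 1) ^ DIM('a) * \<bar>K\<bar> * 0)"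
      by (intro tendsto_intros)
    then have "(\<integral>\<^sup>+y\<in>ball 0 (real N). v y \<partial>lborel) \<le> ennreal ((real N + 1) ^ DIM('a) * \<bar>K\<bar> * 0)"
      using bound s by (intro LIMSEQ_le_const) blast+
    then show ?thesis by simp
  qed
  have "AE y in lborel. v y * indicator (ball 0 (real N)) y = 0" for N :: nat
    using zero[of N] by (subst (asm) nn_integral_0_iff_AE) auto
  then have "AE y in lborel. \<forall>N. v y * indicator (ball 0 (real N)) y = 0"
    unfolding AE_all_countable by blast
  then have "AE y in lborel. u y = 0"
    using ae
  proof eventually_elim
    case (elim y)
    obtain N :: nat where "norm y < real N" using reals_Archimedean2 by blast
    then show ?case using elim(1)[rule_format, of N] elim(2) by simp
  qed
  then show ?thesis by (rule AE_completion)
qed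

text \<open>The approximating polynomials are given ball by ball, without compatibility. On nested
  balls two of them are close in L1 since both are close to \<open>g\<close>, and the evaluation
  bound makes them close at the centre of the smaller ball; nothing else ties them together.\<close>

lemma campanato_imp_lipschitz:
  fixes \<beta> \<rho>0 :: real
  assumes \<beta>: "0 < \<beta>" and \<rho>0: "0 < \<rho>0"
  shows "\<exists>C>0. \<exists>\<rho>>0. \<forall>(g :: 'a::euclidean_space \<Rightarrow> real) M. 
    g \<in> borel_measurable lebesgue \<longrightarrow> 0 \<le> M \<longrightarrow>
    (\<forall>c r. 0 < r \<longrightarrow> r < \<rho>0 \<longrightarrow> (\<exists>P. poly_deg_le d P \<and>
       (\<integral>\<^sup>+x\<in>ball c r. ennreal \<bar>g x - P x\<bar> \<partial>lebesgue) \<le> ennreal (M * r ^ DIM('a) * r powr \<beta>))) \<longrightarrow>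
    (\<exists>G. continuous_on UNIV G \<and> (AE x in lebesgue. g x = G x) \<and>
       (\<forall>x h. h \<noteq> 0 \<longrightarrow> norm h \<le> \<rho> \<longrightarrow> \<bar>fdiff h (Suc d) G x\<bar> \<le> C * M * norm h powr \<beta>))"
proof -
  let ?n = "DIM('a)"
  obtain C0 where C0: "C0 > 0" "\<And>(Q :: 'a \<Rightarrow> real) y s. poly_deg_le d Q \<Longrightarrow> s > 0 \<Longrightarrow>
     ennreal (\<bar>Q y\<bar> * s ^ ?n) \<le> ennreal C0 * (\<integral>\<^sup>+x\<in>ball y s. ennreal \<bar>Q x\<bar> \<partial>lebesgue)"
    using poly_deg_le_eval_bound[of d] by metis
  \<comment> \<open>Halved so that radii up to and including \<rho> are admissible.\<close>
  define \<rho> where "\<rho> = \<rho>0 / 2"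
  have \<rho>: "0 < \<rho>" "\<rho> < \<rho>0" using \<rho>0 by (auto simp: \<rho>_def)
  define q where "q = 2 powr (- \<beta>)"
  have q: "0 < q" "q < 1" using \<beta> powr_less_one[of 2 "-\<beta>"] by (auto simp: q_def)
  \<comment> \<open>The geometric series of increments with ratio \<open>q\<close>;
    \<open>2 ^ ?n\<close> is the volume ratio of consecutive dyadic balls.\<close>
  define K' where "K' = 2 * C0 * 2 ^ ?n / (1 - q)"
  have K': "0 < K'" using C0 q by (simp add: K'_def)
  \<comment> \<open>A general radius \<open>r\<close> is compared with a dyadic one above
    \<open>r / 4\<close>, whence \<open>4 ^ ?n\<close>.\<close>
  define K3 where "K3 = 2 * C0 * 4 ^ ?n + K'"
  have K3: "0 < K3" using C0 K' by (simp add: K3_def add_pos_pos)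
  \<comment> \<open>For a step \<open>h\<close> the radius \<open>2 * (real d + 2) * norm h\<close>
    is used: then all nodes x + j h with j \<le> d + 1 lie in the half ball around \<open>x\<close>.
    \<open>2 ^ Suc d\<close> is the total weight of the coefficients of the difference.\<close>
  define C where "C = 2 ^ Suc d * (K3 * (2 * (real d + 2)) powr \<beta>)"
  have Cpos: "0 < C" using K3 by (simp add: C_def)
  define \<rho>1 where "\<rho>1 = \<rho> / (2 * (real d + 2))"
  have \<rho>1: "0 < \<rho>1" using \<rho> by (simp add: \<rho>1_def)
  have "\<exists>G. continuous_on UNIV G \<and> (AE x in lebesgue. g x = G x) \<and>
       (\<forall>x h. h \<noteq> 0 \<longrightarrow> norm h \<le> \<rho>1 \<longrightarrow> \<bar>fdiff h (Suc d) G x\<bar> \<le> C * M * norm h powr \<beta>)"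
    if g[measurable]: "g \<in> borel_measurable lebesgue" and M: "0 \<le> M" and
      ex: "\<forall>c r. 0 < r \<longrightarrow> r < \<rho>0 \<longrightarrow> (\<exists>P. poly_deg_le d P \<and>
       (\<integral>\<^sup>+x\<in>ball c r. ennreal \<bar>g x - P x\<bar> \<partial>lebesgue) \<le> ennreal (M * r ^ ?n * r powr \<beta>))"
    for g :: "'a \<Rightarrow> real" and M
  proof -
    define pp where "pp c r = (SOME P. poly_deg_le d P \<and>
       (\<integral>\<^sup>+x\<in>ball c r. ennreal \<bar>g x - P x\<bar> \<partial>lebesgue) \<le> ennreal (M * r ^ ?n * r powr \<beta>))" for c r
    have pp_ex: "poly_deg_le d (pp c r) \<and>
       (\<integral>\<^sup>+x\<in>ball c r. ennreal \<bar>g x - pp c r x\<bar> \<partial>lebesgue) \<le> ennreal (M * r ^ ?n * r powr \<beta>)"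
      if "0 < r" "r < \<rho>0" for c r
      unfolding pp_def by (rule someI_ex[OF ex[rule_format, OF that]])
    have pp: "\<And>c r. 0 < r \<Longrightarrow> r < \<rho>0 \<Longrightarrow> poly_deg_le d (pp c r)"
      "\<And>c r. 0 < r \<Longrightarrow> r < \<rho>0 \<Longrightarrow> (\<integral>\<^sup>+x\<in>ball c r. ennreal \<bar>g x - pp c r x\<bar> \<partial>lebesgue) \<le> ennreal (M * r ^ ?n * r powr \<beta>)"
      using pp_ex by auto
    have meas: "pp c r \<in> borel_measurable lebesgue" if "0 < r" "r < \<rho>0" for c r
      using borel_measurable_poly_deg_le[OF pp(1)[OF that]] by (intro measurable_completion) simp
    \<comment> \<open>Evaluation on the ball of radius \<open>s\<close> divides the L1 errors, of
      order \<open>r ^ ?n\<close>, by \<open>s ^ ?n\<close>.\<close>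
    have compare: "\<bar>pp y s y - pp c r y\<bar> \<le> 2 * C0 * (r / s) ^ ?n * (M * r powr \<beta>)"
      if s: "0 < s" "s \<le> r" "r < \<rho>0" and sub: "ball y s \<subseteq> ball c r" for y s c r
    proof -
      have s0: "s < \<rho>0" and r: "0 < r" using s by auto
      note [measurable] = meas[OF s(1) s0, of y] meas[OF r s(3), of c]
      have "poly_deg_le d (\<lambda>x. pp y s x - pp c r x)"
        by (intro poly_deg_le_diff pp(1) s(1) s0 r s(3))
      then have "ennreal (\<bar>pp y s y - pp c r y\<bar> * s ^ ?n) \<le> ennreal C0 * (\<integral>\<^sup>+x\<in>ball y s. ennreal \<bar>pp y s x - pp c r x\<bar> \<partial>lebesgue)"
        using C0(2) s(1) by blast
      also have "(\<integral>\<^sup>+x\<in>ball y s. ennreal \<bar>pp y s x - pp c r x\<bar> \<partial>lebesgue)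
          \<le> (\<integral>\<^sup>+x. (ennreal \<bar>g x - pp y s x\<bar> * indicator (ball y s) x) + (ennreal \<bar>g x - pp c r x\<bar> * indicator (ball c r) x) \<partial>lebesgue)"
      proof (intro nn_integral_mono)
        fix x
        have "ennreal \<bar>pp y s x - pp c r x\<bar> \<le> ennreal \<bar>g x - pp y s x\<bar> + ennreal \<bar>g x - pp c r x\<bar>"
        proof -
          have "ennreal \<bar>pp y s x - pp c r x\<bar> \<le> ennreal (\<bar>g x - pp y s x\<bar> + \<bar>g x - pp c r x\<bar>)"
            by (intro ennreal_leI) linarith
          then show ?thesis by simp
        qed
        then show "ennreal \<bar>pp y s x - pp c r x\<bar> * indicator (ball y s) x
          \<le> (ennreal \<bar>g x - pp y s x\<bar> * indicator (ball y s) x) + (ennreal \<bar>g x - pp c r x\<bar> * indicator (ball c r) x)"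
          using sub by (cases "x \<in> ball y s") (auto simp: subset_iff)
      qed
      also have "\<dots> = (\<integral>\<^sup>+x\<in>ball y s. ennreal \<bar>g x - pp y s x\<bar> \<partial>lebesgue) + (\<integral>\<^sup>+x\<in>ball c r. ennreal \<bar>g x - pp c r x\<bar> \<partial>lebesgue)"
        by (intro nn_integral_add borel_measurable_times_ennreal borel_measurable_indicator measurable_compose[OF _ measurable_ennreal]
            borel_measurable_abs borel_measurable_diff g meas s(1) s0 r s(3)) auto
      also have "\<dots> \<le> ennreal (M * s ^ ?n * s powr \<beta>) + ennreal (M * r ^ ?n * r powr \<beta>)"
        by (intro add_mono pp(2) s(1) s0 r s(3))
      also have "\<dots> \<le> ennreal (M * r ^ ?n * r powr \<beta>) + ennreal (M * r ^ ?n * r powr \<beta>)"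
        using s M \<beta> by (intro add_mono ennreal_leI mult_mono power_mono powr_mono2) auto
      also have "\<dots> = ennreal (2 * (M * r ^ ?n * r powr \<beta>))"
        using M r by (subst ennreal_plus[symmetric]) auto
      finally have "ennreal (\<bar>pp y s y - pp c r y\<bar> * s ^ ?n) \<le> ennreal (C0 * (2 * (M * r ^ ?n * r powr \<beta>)))"
        using C0(1) by (simp add: ennreal_mult' mult_left_mono)
      then have "\<bar>pp y s y - pp c r y\<bar> * s ^ ?n \<le> C0 * (2 * (M * r ^ ?n * r powr \<beta>))"
        using C0(1) M r by (simp add: ennreal_le_iff)
      then show ?thesis using s(1) by (simp add: power_divide field_simps)
    qed
    define rr where "rr m = \<rho> / 2 ^ m" for m :: nat
    have rr: "0 < rr m" "rr m \<le> \<rho>" "rr m < \<rho>0" for m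
    proof -
      have "\<rho> / 2 ^ m \<le> \<rho> / 1" using \<rho> by (intro divide_left_mono) auto
      then show "0 < rr m" "rr m \<le> \<rho>" "rr m < \<rho>0" using \<rho> by (auto simp: rr_def)
    qed
    have rrp: "rr m powr \<beta> = \<rho> powr \<beta> * q ^ m" for m
    proof -
      have "q ^ m = (2 powr real m) powr (-\<beta>)" unfolding q_def by (simp add: powr_power powr_powr mult.commute)
      also have "\<dots> = 1 / (2 ^ m) powr \<beta>" by (simp add: powr_realpow powr_minus_divide)
      finally show ?thesis using \<rho> by (simp add: rr_def powr_divide)
    qed
    have "\<exists>L. \<forall>m. \<bar>L - pp x (rr m) x\<bar> \<le> (2 * C0 * 2 ^ ?n * M * \<rho> powr \<beta>) * q ^ m / (1 - q)" for x
    proof (rule geometric_increments_limit)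
      fix m
      have "\<bar>pp x (rr (Suc m)) x - pp x (rr m) x\<bar> \<le> 2 * C0 * (rr m / rr (Suc m)) ^ ?n * (M * rr m powr \<beta>)"
        using rr[of "Suc m"] rr[of m] \<rho> by (intro compare) (auto simp: rr_def divide_simps)
      also have "rr m / rr (Suc m) = 2" using \<rho> by (simp add: rr_def)
      finally show "\<bar>pp x (rr (Suc m)) x - pp x (rr m) x\<bar> \<le> (2 * C0 * 2 ^ ?n * M * \<rho> powr \<beta>) * q ^ m"
        by (simp add: rrp mult_ac)
    qed (use q in auto)
    then obtain G where "\<And>x m. \<bar>G x - pp x (rr m) x\<bar> \<le> (2 * C0 * 2 ^ ?n * M * \<rho> powr \<beta>) * q ^ m / (1 - q)" by metis
    then have G: "\<bar>G x - pp x (rr m) x\<bar> \<le> K' * (M * rr m powr \<beta>)" for x m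
      by (simp add: K'_def rrp mult_ac)
    \<comment> \<open>\<open>G\<close> was built from dyadic radii and values at centres; this
      extends the estimate to all radii and to the points of the half ball, which leaves room for a
      dyadic ball around \<open>y\<close> inside \<open>ball c r\<close>.\<close>
    have close: "\<bar>G y - pp c r y\<bar> \<le> K3 * (M * r powr \<beta>)" if r: "0 < r" "r \<le> \<rho>" and y: "dist c y \<le> r / 2" for c r y
    proof -
      have "\<exists>m. rr m \<le> r / 2"
      proof -
        obtain m where "2 * \<rho> / r < 2 ^ m" using real_arch_pow[of 2] by auto
        then have "rr m \<le> r / 2" using r by (simp add: rr_def field_simps)
        then show ?thesis ..
      qed
      \<comment> \<open>The largest dyadic radius that is at most \<open>r / 2\<close>; by
        minimality of \<open>m\<close> it exceeds \<open>r / 4\<close>.\<close>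
      define m where "m = (LEAST m. rr m \<le> r / 2)"
      have m: "rr m \<le> r / 2" unfolding m_def by (rule LeastI_ex) fact
      have "m \<noteq> 0"
      proof
        assume "m = 0"
        then have "\<rho> \<le> r / 2" using m by (simp add: rr_def)
        then show False using r by linarith
      qed
      then obtain m' where m': "m = Suc m'" by (cases m) auto
      have "\<not> rr m' \<le> r / 2" using not_less_Least[of m' "\<lambda>m. rr m \<le> r / 2"] m' unfolding m_def by auto
      moreover have "rr m = rr m' / 2" using m' by (simp add: rr_def)
      ultimately have lo: "r / 4 < rr m" by linarith
      have "\<bar>pp y (rr m) y - pp c r y\<bar> \<le> 2 * C0 * (r / rr m) ^ ?n * (M * r powr \<beta>)"
      proof (rule compare)
        show "ball y (rr m) \<subseteq> ball c r"
        proof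
          fix z assume "z \<in> ball y (rr m)"
          then show "z \<in> ball c r" using y m dist_triangle[of c z y] by simp
        qed
      qed (use rr m r \<rho> in auto)
      also have "\<dots> \<le> 2 * C0 * 4 ^ ?n * (M * r powr \<beta>)"
        using lo r rr[of m] C0 M by (intro mult_right_mono mult_left_mono power_mono) (auto simp: field_simps)
      finally have 1: "\<bar>pp y (rr m) y - pp c r y\<bar> \<le> 2 * C0 * 4 ^ ?n * (M * r powr \<beta>)" .
      have "\<bar>G y - pp y (rr m) y\<bar> \<le> K' * (M * rr m powr \<beta>)" by (rule G)
      also have "\<dots> \<le> K' * (M * r powr \<beta>)"
        using K' M m r rr[of m] \<beta> by (intro mult_left_mono powr_mono2) auto
      finally have "\<bar>G y - pp y (rr m) y\<bar> \<le> K' * (M * r powr \<beta>)" .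
      with 1 show ?thesis by (simp add: K3_def distrib_right)
    qed
    have cont: "continuous_on UNIV G"
    proof (rule continuous_at_imp_continuous_on, intro ballI)
      fix x
      show "isCont G x"
        unfolding continuous_at_eps_delta
      proof (intro allI impI)
        fix e :: real assume e: "0 < e"
        have "((\<lambda>r. K3 * (M * r powr \<beta>)) \<longlongrightarrow> K3 * (M * 0)) (at_right 0)"
          using \<beta> by (intro tendsto_intros tendsto_zero_powrI[where b = \<beta>])
            (auto simp: eventually_at_filter intro: tendsto_ident_at)
        then have "eventually (\<lambda>r. K3 * (M * r powr \<beta>) < e / 3) (at_right 0)"
          using e by (intro order_tendstoD(2)) auto
        then obtain b where b: "b > 0" "\<And>r. 0 < r \<Longrightarrow> r < b \<Longrightarrow> K3 * (M * r powr \<beta>) < e / 3"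
          by (auto simp: eventually_at_right_field)
        \<comment> \<open>At this radius \<open>G\<close> is within e / 3 of the continuous function
          \<open>pp x r\<close> on the half ball around \<open>x\<close>.\<close>
        define r where "r = min \<rho> (b / 2)"
        have r: "0 < r" "r \<le> \<rho>" "r < b" using b \<rho> by (auto simp: r_def)
        have "isCont (pp x r) x"
          using continuous_on_poly_deg_le[OF pp(1)[of r x], of UNIV] r \<rho> by (auto simp: continuous_on_eq_continuous_at)
        then obtain \<delta> where \<delta>: "\<delta> > 0" "\<And>y. dist y x < \<delta> \<Longrightarrow> dist (pp x r y) (pp x r x) < e / 3"
          unfolding continuous_at_eps_delta using e by (metis divide_pos_pos zero_less_numeral)
        have "dist (G y) (G x) < e" if "dist y x < min \<delta> (r / 2)" for y
        proof -
          have "\<bar>G y - pp x r y\<bar> < e / 3" using close[OF r(1,2), of x y] that b(2)[OF r(1,3)] by (simp add: dist_commute)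
          moreover have "\<bar>G x - pp x r x\<bar> < e / 3" using close[OF r(1,2), of x x] r b(2)[OF r(1,3)] by simp
          moreover have "\<bar>pp x r y - pp x r x\<bar> < e / 3" using \<delta>(2)[of y] that by (simp add: dist_real_def)
          ultimately show ?thesis unfolding dist_real_def by linarith
        qed
        then show "\<exists>d>0. \<forall>x'. dist x' x < d \<longrightarrow> dist (G x') (G x) < e"
          using \<delta> r by (intro exI[of _ "min \<delta> (r / 2)"]) auto
      qed
    qed
    have mG[measurable]: "G \<in> borel_measurable lebesgue"
      using borel_measurable_continuous_onI[OF cont] by (intro measurable_completion) simp
    \<comment> \<open>Since \<open>close\<close> covers only the half ball, \<open>ball c r\<close>
      is treated with radius \<open>2 * r\<close>, which causes the powers of 2. The two summands
      are the L1 error of the polynomial and the uniform error of \<open>G\<close> times the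
      volume.\<close>
    define K4 where "K4 = (M + K3 * M * unit_ball_vol (real ?n)) * 2 ^ ?n * 2 powr \<beta>"
    have "AE x in lebesgue. ennreal \<bar>g x - G x\<bar> = 0"
    proof (rule AE_zero_of_small_ball_integrals[where \<beta> = \<beta> and \<rho> = "\<rho> / 2" and K = K4])
      show "(\<lambda>x. ennreal \<bar>g x - G x\<bar>) \<in> borel_measurable lebesgue" by measurable
      fix c :: 'a and r :: real assume r: "0 < r" "r \<le> \<rho> / 2"
      have r2: "0 < 2 * r" "2 * r \<le> \<rho>" "2 * r < \<rho>0" using r \<rho> by auto
      note [measurable] = meas[OF r2(1,3), of c]
      have "(\<integral>\<^sup>+x\<in>ball c r. ennreal \<bar>g x - G x\<bar> \<partial>lebesgue)
         \<le> (\<integral>\<^sup>+x. (ennreal \<bar>g x - pp c (2 * r) x\<bar> * indicator (ball c (2 * r)) x) + ennreal (K3 * (M * (2 * r) powr \<beta>)) * indicator (ball c r) x \<partial>lebesgue)"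
      proof (intro nn_integral_mono)
        fix x
        show "ennreal \<bar>g x - G x\<bar> * indicator (ball c r) x \<le> (ennreal \<bar>g x - pp c (2 * r) x\<bar> * indicator (ball c (2 * r)) x) + ennreal (K3 * (M * (2 * r) powr \<beta>)) * indicator (ball c r) x"
        proof (cases "x \<in> ball c r")
          case True
          have "\<bar>G x - pp c (2 * r) x\<bar> \<le> K3 * (M * (2 * r) powr \<beta>)"
            using close[OF r2(1,2), of c x] True by simp
          then have "ennreal \<bar>g x - G x\<bar> \<le> ennreal (\<bar>g x - pp c (2 * r) x\<bar> + K3 * (M * (2 * r) powr \<beta>))"
            by (intro ennreal_leI) linarith
          also have "\<dots> = ennreal \<bar>g x - pp c (2 * r) x\<bar> + ennreal (K3 * (M * (2 * r) powr \<beta>))"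
            using K3 M by (intro ennreal_plus) auto
          finally show ?thesis using True r by simp
        qed simp
      qed
      also have "\<dots> = (\<integral>\<^sup>+x\<in>ball c (2 * r). ennreal \<bar>g x - pp c (2 * r) x\<bar> \<partial>lebesgue) + (\<integral>\<^sup>+x. ennreal (K3 * (M * (2 * r) powr \<beta>)) * indicator (ball c r) x \<partial>lebesgue)"
        by (intro nn_integral_add borel_measurable_times_ennreal borel_measurable_indicator measurable_compose[OF _ measurable_ennreal]
            borel_measurable_abs borel_measurable_diff g meas r2(1,3)) auto
      also have "\<dots> \<le> ennreal (M * (2 * r) ^ ?n * (2 * r) powr \<beta>) + ennreal (K3 * (M * (2 * r) powr \<beta>)) * ennreal (unit_ball_vol (real ?n) * r ^ ?n)"
      proof (rule add_mono)
        show "(\<integral>\<^sup>+x. ennreal (K3 * (M * (2 * r) powr \<beta>)) * indicator (ball c r) x \<partial>lebesgue) \<le> ennreal (K3 * (M * (2 * r) powr \<beta>)) * ennreal (unit_ball_vol (real ?n) * r ^ ?n)"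
          using r by (subst nn_integral_cmult_indicator) (auto simp: emeasure_ball)
      qed (rule pp(2)[OF r2(1,3)])
      also have "\<dots> = ennreal (M * (2 * r) ^ ?n * (2 * r) powr \<beta> + K3 * (M * (2 * r) powr \<beta>) * (unit_ball_vol (real ?n) * r ^ ?n))"
        using r M K3 by (simp add: ennreal_mult'[symmetric] ennreal_plus[symmetric] del: ennreal_plus)
      also have "\<dots> \<le> ennreal (K4 * r ^ ?n * r powr \<beta>)"
      proof (rule ennreal_leI)
        have "K3 * (M * (2 * r) powr \<beta>) * (unit_ball_vol (real ?n) * r ^ ?n) \<le> K3 * (M * (2 * r) powr \<beta>) * (unit_ball_vol (real ?n) * (2 * r) ^ ?n)"
          using r K3 M by (intro mult_left_mono power_mono) auto
        then have "M * (2 * r) ^ ?n * (2 * r) powr \<beta> + K3 * (M * (2 * r) powr \<beta>) * (unit_ball_vol (real ?n) * r ^ ?n)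
           \<le> (M + K3 * M * unit_ball_vol (real ?n)) * ((2 * r) ^ ?n * (2 * r) powr \<beta>)"
          by (simp add: algebra_simps)
        also have "\<dots> = K4 * r ^ ?n * r powr \<beta>"
          using r by (simp add: K4_def powr_mult power_mult_distrib mult_ac)
        finally show "M * (2 * r) ^ ?n * (2 * r) powr \<beta> + K3 * (M * (2 * r) powr \<beta>) * (unit_ball_vol (real ?n) * r ^ ?n) \<le> K4 * r ^ ?n * r powr \<beta>" .
      qed
      finally show "(\<integral>\<^sup>+x\<in>ball c r. ennreal \<bar>g x - G x\<bar> \<partial>lebesgue) \<le> ennreal (K4 * r ^ ?n * r powr \<beta>)" .
    qed (use \<beta> \<rho> in auto)
    then have ae: "AE x in lebesgue. g x = G x" by eventually_elim simp
    have "\<bar>fdiff h (Suc d) G x\<bar> \<le> C * M * norm h powr \<beta>" if h: "h \<noteq> 0" "norm h \<le> \<rho>1" for x h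
    proof -
      define r where "r = 2 * (real d + 2) * norm h"
      have "0 < r" using h unfolding r_def by (intro mult_pos_pos add_nonneg_pos) auto
      moreover have "r \<le> \<rho>"
      proof -
        have "r \<le> 2 * (real d + 2) * \<rho>1" unfolding r_def using h by (intro mult_left_mono) auto
        also have "\<dots> = \<rho>" unfolding \<rho>1_def by simp
        finally show ?thesis .
      qed
      ultimately have r: "0 < r" "r \<le> \<rho>" by auto
      have P: "poly_deg_le d (pp x r)" using r \<rho> by (intro pp(1)) auto
      \<comment> \<open>Subtracting the polynomial is free: its differences of order d + 1
        vanish.\<close>
      have "fdiff h (Suc d) G x = fdiff h (Suc d) (\<lambda>z. G z - pp x r z) x"
        unfolding fdiff_diff using fdiff_poly_deg_le[OF P] by simp
      also have "\<bar>\<dots>\<bar> \<le> 2 ^ Suc d * (K3 * (M * r powr \<beta>))"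
      proof (rule abs_fdiff_le)
        fix j :: nat assume "j \<le> Suc d"
        then have "real j * norm h \<le> (real d + 2) * norm h" by (intro mult_right_mono) auto
        then show "\<bar>G (x + real j *\<^sub>R h) - pp x r (x + real j *\<^sub>R h)\<bar> \<le> K3 * (M * r powr \<beta>)"
          using r by (intro close) (auto simp: r_def dist_norm algebra_simps)
      qed
      also have "\<dots> = C * M * norm h powr \<beta>"
        using h by (simp add: C_def r_def powr_mult mult_ac)
      finally show ?thesis .
    qed
    with cont ae show ?thesis by blast
  qed
  with Cpos \<rho>1 show ?thesis by blast
qed

section \<open>From differences to polynomial approximation\<close>

text \<open>Taylor expansion of the truncated power at \<open>s\<close>, up to order k - 1. Across
  the kink the error is still O(|t|^k): if \<open>s\<close> and \<open>s + t\<close> have opposite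
  signs, both are at most |t| in absolute value.\<close>

lemma truncated_power_taylor:
  fixes s t :: real
  shows "\<bar>max 0 (s + t) ^ k - (\<Sum>i<k. real (k choose i) * max 0 s ^ (k - i) * t ^ i)\<bar> \<le> 2 * \<bar>t\<bar> ^ k"
proof (cases "0 \<le> s")
  case True
  have "(t + s) ^ k = (\<Sum>i\<le>k. real (k choose i) * t ^ i * s ^ (k - i))" by (rule binomial_ring)
  also have "\<dots> = (\<Sum>i<k. real (k choose i) * t ^ i * s ^ (k - i)) + t ^ k"
    by (simp add: lessThan_Suc_atMost[symmetric])
  finally have e: "(\<Sum>i<k. real (k choose i) * max 0 s ^ (k - i) * t ^ i) = (s + t) ^ k - t ^ k"
    using True by (simp add: add.commute mult_ac max_def)
  show ?thesis
  proof (cases "0 \<le> s + t")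
    case True
    then show ?thesis unfolding e by (simp add: max_def power_abs)
  next
    case False
    have 1: "\<bar>s + t\<bar> ^ k \<le> \<bar>t\<bar> ^ k" using True False by (intro power_mono) auto
    have 2: "\<bar>(s + t) ^ k - t ^ k\<bar> \<le> \<bar>s + t\<bar> ^ k + \<bar>t\<bar> ^ k"
      using abs_triangle_ineq4[of "(s + t) ^ k" "t ^ k"] by (simp add: power_abs)
    show ?thesis
    \<comment> \<open>For \<open>k = 0\<close> the truncated power of a negative number is 1, not
      0.\<close>
    proof (cases "k = 0")
      case k: False
      then have 3: "max 0 (s + t) ^ k = 0" using False by simp
      show ?thesis unfolding e 3 using 1 2 by linarith
    qed simp
  qed
next
  case False
  then have "(\<Sum>i<k. real (k choose i) * max 0 s ^ (k - i) * t ^ i) = 0"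
    by (intro sum.neutral) (auto simp: max_def)
  moreover have "max 0 (s + t) ^ k \<le> \<bar>t\<bar> ^ k" using False by (intro power_mono) auto
  moreover have "\<bar>max 0 (s + t) ^ k\<bar> = max 0 (s + t) ^ k" by simp
  ultimately show ?thesis by linarith
qed

section \<open>Kernels whose convolutions are nearly polynomial at the origin\<close>

lemma abs_set_integral_ball_le:
  fixes f :: "'a::euclidean_space \<Rightarrow> real"
  assumes f: "continuous_on UNIV f" and K: "\<And>z. z \<in> ball c r \<Longrightarrow> \<bar>f z\<bar> \<le> K"
  shows "\<bar>LINT z:ball c r|lebesgue. f z\<bar> \<le> K * measure lebesgue (ball c r)"
proof -
  have "\<bar>LINT z:ball c r|lebesgue. f z\<bar> \<le> (LINT z:ball c r|lebesgue. \<bar>f z\<bar>)"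
    unfolding set_lebesgue_integral_def by (rule order_trans[OF integral_abs_bound]) (simp add: abs_mult)
  also have "\<dots> \<le> (LINT z:ball c r|lebesgue. K)"
    by (intro set_integral_mono set_integrable_continuous_ball continuous_intros f K) auto
  also have "\<dots> = K * measure lebesgue (ball c r)" by (simp add: set_lebesgue_integral_def)
  finally show ?thesis .
qed

lemma set_integral_sum_continuous:
  fixes f :: "'i \<Rightarrow> 'a::euclidean_space \<Rightarrow> real"
  assumes "\<And>i. i \<in> I \<Longrightarrow> continuous_on UNIV (f i)"
  shows "(LINT z:ball c r|lebesgue. (\<Sum>i\<in>I. f i z)) = (\<Sum>i\<in>I. LINT z:ball c r|lebesgue. f i z)"
  unfolding set_lebesgue_integral_def scaleR_sum_right
  using set_integrable_continuous_ball[OF assms]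
  by (intro Bochner_Integration.integral_sum) (auto simp: set_integrable_def)

text \<open>One factor \<open>x \<bullet> z\<close> is expanded in coordinates and
  \<open>z \<bullet> b\<close> is absorbed into the weight, which is why the weight varies in the
  induction.\<close>

lemma poly_deg_le_integral_inner_power:
  fixes v :: "'a::euclidean_space \<Rightarrow> real"
  assumes "continuous_on UNIV v"
  shows "poly_deg_le m (\<lambda>x. LINT z:ball c r|lebesgue. v z * (x \<bullet> z) ^ m)"
  using assms
proof (induction m arbitrary: v)
  case 0
  show ?case by (simp add: poly_deg_le_const)
next
  case (Suc m)
  have "(\<lambda>x. LINT z:ball c r|lebesgue. v z * (x \<bullet> z) ^ Suc m) =
     (\<lambda>x. \<Sum>b\<in>Basis. (x \<bullet> b) * (LINT z:ball c r|lebesgue. (v z * (z \<bullet> b)) * (x \<bullet> z) ^ m))"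
  proof
    fix x
    have "v z * (x \<bullet> z) ^ Suc m = (\<Sum>b\<in>Basis. (x \<bullet> b) * ((v z * (z \<bullet> b)) * (x \<bullet> z) ^ m))" for z
      by (simp add: euclidean_inner[of x z] sum_distrib_left sum_distrib_right mult_ac)
    then have "(LINT z:ball c r|lebesgue. v z * (x \<bullet> z) ^ Suc m) = (LINT z:ball c r|lebesgue. (\<Sum>b\<in>Basis. (x \<bullet> b) * ((v z * (z \<bullet> b)) * (x \<bullet> z) ^ m)))"
      by (simp only:)
    also have "\<dots> = (\<Sum>b\<in>Basis. LINT z:ball c r|lebesgue. (x \<bullet> b) * ((v z * (z \<bullet> b)) * (x \<bullet> z) ^ m))"
      by (rule set_integral_sum_continuous) (intro continuous_intros Suc.prems)
    finally show "(LINT z:ball c r|lebesgue. v z * (x \<bullet> z) ^ Suc m) = (\<Sum>b\<in>Basis. (x \<bullet> b) * (LINT z:ball c r|lebesgue. (v z * (z \<bullet> b)) * (x \<bullet> z) ^ m))"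
      by simp
  qed
  moreover have "poly_deg_le (Suc m) (\<lambda>x. (x \<bullet> b) * (LINT z:ball c r|lebesgue. (v z * (z \<bullet> b)) * (x \<bullet> z) ^ m))" if "b \<in> Basis" for b
  proof -
    have "continuous_on UNIV (\<lambda>z. v z * (z \<bullet> b))" by (intro continuous_intros Suc.prems)
    from poly_deg_le_mult[OF poly_deg_le_coord[OF that] Suc.IH[OF this]] show ?thesis by simp
  qed
  ultimately show ?case by (simp only:) (rule poly_deg_le_sum)
qed

text \<open>Convolution with \<open>F\<close> turns bounded functions into functions that agree with a polynomial of degree
  less than \<open>k\<close> up to an error \<open>O(|x|\<^sup>k)\<close> at the origin, with a uniform constant.\<close>

definition kernel_flat_bound :: "nat \<Rightarrow> real \<Rightarrow> ('a::euclidean_space \<Rightarrow> 'a \<Rightarrow> real) \<Rightarrow> bool" where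
  "kernel_flat_bound k C F \<longleftrightarrow> C \<ge> 0 \<and> (\<forall>v A.
     continuous_on UNIV v \<longrightarrow> (\<forall>z\<in>ball 0 1. \<bar>v z\<bar> \<le> A) \<longrightarrow>
     (\<exists>P. poly_deg_le (k - 1) P \<and>
       (\<forall>x. norm x \<le> 1 \<longrightarrow> \<bar>(LINT z:ball 0 1|lebesgue. v z * F z x) - P x\<bar> \<le> C * A * norm x ^ k)))"

text \<open>Continuity in the integration variable is carried along so that integrals of sums
  against a continuous \<open>v\<close> can be split.\<close>

definition kernel_flat :: "nat \<Rightarrow> ('a::euclidean_space \<Rightarrow> 'a \<Rightarrow> real) \<Rightarrow> bool" where
  "kernel_flat k F \<longleftrightarrow> (\<forall>x. continuous_on UNIV (\<lambda>z. F z x)) \<and> (\<exists>C. kernel_flat_bound k C F)"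

lemma kernel_flat_sum:
  fixes F :: "'i \<Rightarrow> 'a::euclidean_space \<Rightarrow> 'a \<Rightarrow> real"
  assumes "\<And>i. i \<in> I \<Longrightarrow> kernel_flat k (F i)"
  shows "kernel_flat k (\<lambda>z x. \<Sum>i\<in>I. F i z x)"
proof -
  have cont: "continuous_on UNIV (\<lambda>z. F i z x)" if "i \<in> I" for i x
    using assms[OF that] by (simp add: kernel_flat_def)
  have "\<forall>i\<in>I. \<exists>C. kernel_flat_bound k C (F i)"
    using assms by (simp add: kernel_flat_def)
  then obtain C where "\<forall>i\<in>I. kernel_flat_bound k (C i) (F i)"
    by (rule bchoice[elim_format]) blast
  then have C: "\<And>i. i \<in> I \<Longrightarrow> C i \<ge> 0" 
    "\<And>i v A. i \<in> I \<Longrightarrow> continuous_on UNIV v \<Longrightarrow> (\<forall>z\<in>ball 0 1. \<bar>v z\<bar> \<le> A) \<Longrightarrow>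
     \<exists>P. poly_deg_le (k - 1) P \<and>
       (\<forall>x. norm x \<le> 1 \<longrightarrow> \<bar>(LINT z:ball 0 1|lebesgue. v z * F i z x) - P x\<bar> \<le> C i * A * norm x ^ k)"
    unfolding kernel_flat_bound_def by blast+
  have "\<exists>P. poly_deg_le (k - 1) P \<and>
       (\<forall>x. norm x \<le> 1 \<longrightarrow> \<bar>(LINT z:ball 0 1|lebesgue. v z * (\<Sum>i\<in>I. F i z x)) - P x\<bar> \<le> sum C I * A * norm x ^ k)"
    if v: "continuous_on UNIV v" and A: "\<forall>z\<in>ball 0 1. \<bar>v z\<bar> \<le> A" for v :: "'a \<Rightarrow> real" and A
  proof -
    have "\<forall>i\<in>I. \<exists>P. poly_deg_le (k - 1) P \<and>
       (\<forall>x. norm x \<le> 1 \<longrightarrow> \<bar>(LINT z:ball 0 1|lebesgue. v z * F i z x) - P x\<bar> \<le> C i * A * norm x ^ k)"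
      using C(2)[OF _ v A] by blast
    from bchoice[OF this] obtain P where "\<forall>i\<in>I. poly_deg_le (k - 1) (P i) \<and>
       (\<forall>x. norm x \<le> 1 \<longrightarrow> \<bar>(LINT z:ball 0 1|lebesgue. v z * F i z x) - P i x\<bar> \<le> C i * A * norm x ^ k)"
      by blast
    then have P: "\<And>i. i \<in> I \<Longrightarrow> poly_deg_le (k - 1) (P i)"
      "\<And>i x. i \<in> I \<Longrightarrow> norm x \<le> 1 \<Longrightarrow> \<bar>(LINT z:ball 0 1|lebesgue. v z * F i z x) - P i x\<bar> \<le> C i * A * norm x ^ k"
      by auto
    have "\<bar>(LINT z:ball 0 1|lebesgue. v z * (\<Sum>i\<in>I. F i z x)) - (\<Sum>i\<in>I. P i x)\<bar> \<le> sum C I * A * norm x ^ k" if "norm x \<le> 1" for x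
    proof -
      have "(LINT z:ball 0 1|lebesgue. v z * (\<Sum>i\<in>I. F i z x)) = (\<Sum>i\<in>I. LINT z:ball 0 1|lebesgue. v z * F i z x)"
        unfolding sum_distrib_left by (rule set_integral_sum_continuous) (intro continuous_intros v cont)
      then have "\<bar>(LINT z:ball 0 1|lebesgue. v z * (\<Sum>i\<in>I. F i z x)) - (\<Sum>i\<in>I. P i x)\<bar>
         = \<bar>\<Sum>i\<in>I. (LINT z:ball 0 1|lebesgue. v z * F i z x) - P i x\<bar>"
        by (simp add: sum_subtractf)
      also have "\<dots> \<le> (\<Sum>i\<in>I. C i * A * norm x ^ k)"
        by (intro order_trans[OF sum_abs] sum_mono P that)
      finally show ?thesis by (simp add: sum_distrib_right)
    qed
    then show ?thesis using poly_deg_le_sum[of I "k - 1" P] P(1) by blast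
  qed
  moreover have "sum C I \<ge> 0" using C(1) by (simp add: sum_nonneg)
  ultimately have "kernel_flat_bound k (sum C I) (\<lambda>z x. \<Sum>i\<in>I. F i z x)"
    unfolding kernel_flat_bound_def by blast
  then show ?thesis unfolding kernel_flat_def using cont by (auto intro: continuous_on_sum)
qed

text \<open>Takes the polynomial 0; meant for remainder terms.\<close>

lemma kernel_flat_small:
  fixes F :: "'a::euclidean_space \<Rightarrow> 'a \<Rightarrow> real"
  assumes cont: "\<And>x. continuous_on UNIV (\<lambda>z. F z x)" and D: "D \<ge> 0"
    and le: "\<And>z x. norm z \<le> 1 \<Longrightarrow> norm x \<le> 1 \<Longrightarrow> \<bar>F z x\<bar> \<le> D * norm x ^ k"
  shows "kernel_flat k F"
proof -
  let ?C = "D * measure lebesgue (ball (0::'a) 1)"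
  have "\<exists>P. poly_deg_le (k - 1) P \<and>
       (\<forall>x. norm x \<le> 1 \<longrightarrow> \<bar>(LINT z:ball 0 1|lebesgue. v z * F z x) - P x\<bar> \<le> ?C * A * norm x ^ k)"
    if v: "continuous_on UNIV v" and A: "\<forall>z\<in>ball 0 1. \<bar>v z\<bar> \<le> A" for v :: "'a \<Rightarrow> real" and A
  proof (intro exI[of _ "\<lambda>_. 0"] conjI allI impI poly_deg_le_const)
    fix x :: 'a assume x: "norm x \<le> 1"
    have "\<bar>LINT z:ball 0 1|lebesgue. v z * F z x\<bar> \<le> (A * (D * norm x ^ k)) * measure lebesgue (ball (0::'a) 1)"
    proof (rule abs_set_integral_ball_le)
      fix z :: 'a assume z: "z \<in> ball 0 1"
      then have "\<bar>v z\<bar> \<le> A" "\<bar>F z x\<bar> \<le> D * norm x ^ k" using A le[of z x] x by auto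
      then show "\<bar>v z * F z x\<bar> \<le> A * (D * norm x ^ k)"
        unfolding abs_mult by (intro mult_mono) auto
    qed (intro continuous_intros v cont)
    then show "\<bar>(LINT z:ball 0 1|lebesgue. v z * F z x) - 0\<bar> \<le> ?C * A * norm x ^ k"
      by (simp add: mult_ac)
  qed
  moreover have "0 \<le> ?C" using D by simp
  ultimately have "kernel_flat_bound k ?C F" unfolding kernel_flat_bound_def by blast
  then show ?thesis unfolding kernel_flat_def using cont by blast
qed

text \<open>The degree in \<open>x\<close> is \<open>m + 2 * l\<close>. Below \<open>k\<close> the
  integral is exactly a polynomial, with constant 0; otherwise the kernel is O(|x|^k), since
  \<open>norm x \<le> 1\<close>.\<close>

lemma kernel_flat_monomial:
  fixes w :: "'a::euclidean_space \<Rightarrow> real"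
  assumes w: "continuous_on UNIV w" and k: "0 < k"
  shows "kernel_flat k (\<lambda>z x. w z * (x \<bullet> z) ^ m * (x \<bullet> x) ^ l)"
proof (cases "m + 2 * l < k")
  case True
  have "\<exists>P. poly_deg_le (k - 1) P \<and>
       (\<forall>x. norm x \<le> 1 \<longrightarrow> \<bar>(LINT z:ball 0 1|lebesgue. v z * (w z * (x \<bullet> z) ^ m * (x \<bullet> x) ^ l)) - P x\<bar> \<le> 0 * A * norm x ^ k)"
    if v: "continuous_on UNIV v" for v :: "'a \<Rightarrow> real" and A :: real
  proof -
    define P where "P = (\<lambda>x. (LINT z:ball 0 1|lebesgue. (v z * w z) * (x \<bullet> z) ^ m) * (x \<bullet> x) ^ l)"
    have "poly_deg_le 2 (\<lambda>x::'a. x \<bullet> x)"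
    proof -
      have "poly_deg_le 2 (\<lambda>x::'a. (x \<bullet> b) * (x \<bullet> b))" if "b \<in> Basis" for b
        using poly_deg_le_mult[OF poly_deg_le_coord[OF that] poly_deg_le_coord[OF that]] by (simp add: numeral_2_eq_2)
      then have "poly_deg_le 2 (\<lambda>x::'a. \<Sum>b\<in>Basis. (x \<bullet> b) * (x \<bullet> b))" by (rule poly_deg_le_sum)
      then show ?thesis by (simp add: euclidean_inner[symmetric])
    qed
    then have "poly_deg_le (l * 2) (\<lambda>x::'a. (x \<bullet> x) ^ l)" by (rule poly_deg_le_power)
    with poly_deg_le_integral_inner_power[of "\<lambda>z. v z * w z" m 0 1] v w
    have "poly_deg_le (m + l * 2) P" unfolding P_def by (intro poly_deg_le_mult) (auto intro!: continuous_intros)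
    then have "poly_deg_le (k - 1) P" by (rule poly_deg_le_mono) (use True in simp)
    moreover have "(LINT z:ball 0 1|lebesgue. v z * (w z * (x \<bullet> z) ^ m * (x \<bullet> x) ^ l)) = P x" for x
      unfolding P_def set_integral_mult_left[symmetric] by (simp add: mult_ac)
    ultimately show ?thesis by (intro exI[of _ P]) simp
  qed
  then have "kernel_flat_bound k 0 (\<lambda>z x. w z * (x \<bullet> z) ^ m * (x \<bullet> x) ^ l)"
    unfolding kernel_flat_bound_def by blast
  then show ?thesis unfolding kernel_flat_def by (auto intro!: continuous_intros w)
next
  case False
  have "bounded (w ` cball 0 1)"
    using w by (intro compact_imp_bounded compact_continuous_image continuous_on_subset[OF w]) auto
  then obtain W where "\<forall>y\<in>w ` cball 0 1. norm y \<le> W" unfolding bounded_iff by blast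
  then have W: "\<And>z. norm z \<le> 1 \<Longrightarrow> \<bar>w z\<bar> \<le> W" by auto
  show ?thesis
  proof (rule kernel_flat_small)
    show "0 \<le> W" using W[of 0] by simp
    fix z x :: 'a assume zx: "norm z \<le> 1" "norm x \<le> 1"
    have "\<bar>x \<bullet> z\<bar> \<le> norm x * norm z" by (rule Cauchy_Schwarz_ineq2)
    also have "\<dots> \<le> norm x * 1" using zx by (intro mult_left_mono) auto
    finally have 1: "\<bar>x \<bullet> z\<bar> ^ m \<le> norm x ^ m" by (intro power_mono) auto
    have "\<bar>w z * (x \<bullet> z) ^ m * (x \<bullet> x) ^ l\<bar> \<le> W * norm x ^ m * norm x ^ (2 * l)"
      using 1 W[OF zx(1)] unfolding abs_mult power_abs
      by (intro mult_mono) (auto simp: dot_square_norm power_mult)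
    also have "\<dots> = W * norm x ^ (m + 2 * l)" by (simp add: power_add)
    also have "\<dots> \<le> W * norm x ^ k"
      using False zx W[of 0] by (intro mult_left_mono power_decreasing) auto
    finally show "\<bar>w z * (x \<bullet> z) ^ m * (x \<bullet> x) ^ l\<bar> \<le> W * norm x ^ k" .
  qed (intro continuous_intros w)
qed

text \<open>Write B - |z - x|^2 = s + t, with \<open>s\<close> free of \<open>x\<close> and |t|
  \<le> 3 |x| on the unit ball. Expansion in \<open>t\<close> gives monomials in
  \<open>x \<bullet> z\<close> and \<open>x \<bullet> x\<close> with continuous weights, plus a
  remainder O(|x|^k).\<close>

lemma kernel_flat_truncated_power:
  assumes k: "0 < k"
  shows "kernel_flat k (\<lambda>z x :: 'a::euclidean_space. max 0 (B - (z - x) \<bullet> (z - x)) ^ k)"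
proof -
  define s where "s = (\<lambda>z::'a. B - z \<bullet> z)"
  define t where "t = (\<lambda>z x::'a. 2 * (x \<bullet> z) - x \<bullet> x)"
  have st: "s z + t z x = B - (z - x) \<bullet> (z - x)" for z x
    by (simp add: s_def t_def inner_diff_left inner_diff_right inner_commute)
  define main where "main = (\<lambda>z x. \<Sum>i<k. real (k choose i) * max 0 (s z) ^ (k - i) * t z x ^ i)"
  have cs: "continuous_on UNIV s" unfolding s_def by (intro continuous_intros)
  have ct: "continuous_on UNIV (\<lambda>z. t z x)" for x unfolding t_def by (intro continuous_intros)
  have main: "kernel_flat k main"
  proof -
    have "main = (\<lambda>z x. \<Sum>i<k. \<Sum>l\<le>i. (real (k choose i) * max 0 (s z) ^ (k - i) * (real (i choose l) * 2 ^ l * (-1) ^ (i - l))) * (x \<bullet> z) ^ l * (x \<bullet> x) ^ (i - l))"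
    proof (intro ext)
      fix z x
      have "t z x ^ i = (\<Sum>l\<le>i. real (i choose l) * (2 * (x \<bullet> z)) ^ l * (- (x \<bullet> x)) ^ (i - l))" for i
        unfolding t_def using binomial_ring[of "2 * (x \<bullet> z)" "- (x \<bullet> x)" i] by simp
      then have t: "t z x ^ i = (\<Sum>l\<le>i. (real (i choose l) * 2 ^ l * (-1) ^ (i - l)) * (x \<bullet> z) ^ l * (x \<bullet> x) ^ (i - l))" for i
        by (simp add: power_mult_distrib power_minus[of "x \<bullet> x"] mult_ac)
      show "main z x = (\<Sum>i<k. \<Sum>l\<le>i. (real (k choose i) * max 0 (s z) ^ (k - i) * (real (i choose l) * 2 ^ l * (-1) ^ (i - l))) * (x \<bullet> z) ^ l * (x \<bullet> x) ^ (i - l))"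
        unfolding main_def t sum_distrib_left by (intro sum.cong) (auto simp: mult_ac)
    qed
    moreover have "kernel_flat k (\<lambda>z x. \<Sum>i<k. \<Sum>l\<le>i. (real (k choose i) * max 0 (s z) ^ (k - i) * (real (i choose l) * 2 ^ l * (-1) ^ (i - l))) * (x \<bullet> z) ^ l * (x \<bullet> x) ^ (i - l))"
      by (intro kernel_flat_sum kernel_flat_monomial k continuous_intros cs)
    ultimately show ?thesis by simp
  qed
  define R where "R = (\<lambda>z x. max 0 (s z + t z x) ^ k - main z x)"
  have R: "kernel_flat k R"
  proof (rule kernel_flat_small)
    show "continuous_on UNIV (\<lambda>z. R z x)" for x
      unfolding R_def main_def by (intro continuous_intros cs ct)
    show "(0::real) \<le> 2 * 3 ^ k" by simp
    fix z x :: 'a assume zx: "norm z \<le> 1" "norm x \<le> 1"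
    have "\<bar>x \<bullet> z\<bar> \<le> norm x * norm z" by (rule Cauchy_Schwarz_ineq2)
    also have "\<dots> \<le> norm x * 1" using zx by (intro mult_left_mono) auto
    finally have 1: "\<bar>x \<bullet> z\<bar> \<le> norm x" by simp
    have "x \<bullet> x = norm x * norm x" by (simp add: dot_square_norm power2_eq_square)
    also have "\<dots> \<le> norm x * 1" using zx by (intro mult_left_mono) auto
    finally have "x \<bullet> x \<le> norm x" by simp
    with 1 have "\<bar>t z x\<bar> \<le> 3 * norm x" unfolding t_def using inner_ge_zero[of x] by linarith
    then have "\<bar>t z x\<bar> ^ k \<le> (3 * norm x) ^ k" by (intro power_mono) auto
    moreover have "\<bar>R z x\<bar> \<le> 2 * \<bar>t z x\<bar> ^ k" unfolding R_def main_def by (rule truncated_power_taylor)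
    ultimately show "\<bar>R z x\<bar> \<le> 2 * 3 ^ k * norm x ^ k" by (simp add: power_mult_distrib)
  qed
  have "kernel_flat k (\<lambda>z x. \<Sum>b\<in>UNIV. (if b then main else R) z x)"
    by (rule kernel_flat_sum) (use main R in auto)
  then show ?thesis by (simp add: UNIV_bool R_def st)
qed

section \<open>The Whitney-type estimate\<close>

lemma integral_lebesgue_affine:
  fixes f :: "'a::euclidean_space \<Rightarrow> real"
  assumes f: "continuous_on UNIV f" and c: "c \<noteq> 0"
  shows "integral\<^sup>L lebesgue f = \<bar>c\<bar> ^ DIM('a) * integral\<^sup>L lebesgue (\<lambda>x. f (t + c *\<^sub>R x))"
proof -
  have [measurable]: "f \<in> borel_measurable borel" by (rule borel_measurable_continuous_onI[OF f])
  have "integral\<^sup>L lborel f = integral\<^sup>L (density (distr lborel borel (\<lambda>x. t + c *\<^sub>R x)) (\<lambda>_. \<bar>c\<bar> ^ DIM('a))) f"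
    using lborel_affine[OF c, of t] by simp
  also have "\<dots> = \<bar>c\<bar> ^ DIM('a) * integral\<^sup>L lborel (\<lambda>x. f (t + c *\<^sub>R x))"
    by (subst integral_density) (auto simp: integral_distr)
  finally show ?thesis by (simp add: integral_completion)
qed

lemma integrable_continuous_bounded_support:
  fixes f :: "'a::euclidean_space \<Rightarrow> real"
  assumes f: "continuous_on UNIV f" and 0: "\<And>x. x \<notin> ball c r \<Longrightarrow> f x = 0"
  shows "integrable lebesgue f" and "integral\<^sup>L lebesgue f = (LINT x:ball c r|lebesgue. f x)"
proof -
  have "indicator (ball c r) x *\<^sub>R f x = f x" for x
    using 0[of x] by (cases "x \<in> ball c r") (simp_all del: mem_ball)
  then have "(\<lambda>x. indicator (ball c r) x *\<^sub>R f x) = f" by (rule ext)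
  then show "integrable lebesgue f" "integral\<^sup>L lebesgue f = (LINT x:ball c r|lebesgue. f x)"
    using set_integrable_continuous_ball[OF f, of c r]
    unfolding set_integrable_def set_lebesgue_integral_def by (simp_all only:)
qed

text \<open>Averaging the identity \<open>fdiff_binomial\<close> in \<open>h\<close> against a kernel writes \<open>v\<close>, up to \<open>M\<close>, as a
  sum of convolutions of \<open>v\<close> with kernels that are flat to order \<open>k\<close>.\<close>

lemma unit_ball_poly_approx:
  fixes \<beta> :: real
  assumes k: "0 < k" and \<beta>: "0 < \<beta>"
  shows "\<exists>C>0. \<forall>(v :: 'a::euclidean_space \<Rightarrow> real) A M. continuous_on UNIV v \<longrightarrow> (\<forall>z\<in>ball 0 1. \<bar>v z\<bar> \<le> A) \<longrightarrow>
    (\<forall>x h. h \<noteq> 0 \<longrightarrow> \<bar>fdiff h k v x\<bar> \<le> M * norm h powr \<beta>) \<longrightarrow>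
    (\<exists>P. poly_deg_le (k - 1) P \<and> (\<forall>x. norm x < 1 / 2 \<longrightarrow> \<bar>v x - P x\<bar> \<le> C * (M + norm x ^ k * A)))"
proof -
  let ?n = "DIM('a)"
  \<comment> \<open>For \<open>norm y < a\<close> and \<open>j \<le> k\<close> the point x + j y is
    less than 1/2 away from \<open>x\<close>; with \<open>norm x < 1 / 2\<close> it stays in the
    unit ball, where alone the bound \<open>A\<close> is available.\<close>
  define a where "a = 1 / (2 * real k)"
  have a: "0 < a" "a \<le> 1" using k by (auto simp: a_def field_simps)
  \<comment> \<open>A bump supported in the ball of radius \<open>a\<close>, of truncated power type
    so that its rescalings are flat kernels.\<close>
  define \<kappa> where "\<kappa> = (\<lambda>y::'a. max 0 (a\<^sup>2 - y \<bullet> y) ^ k)"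
  have c\<kappa>: "continuous_on S \<kappa>" for S unfolding \<kappa>_def by (intro continuous_intros)
  have \<kappa>0: "\<kappa> y = 0" if "y \<notin> ball 0 a" for y
  proof -
    have "a\<^sup>2 \<le> norm y ^ 2" using that a by (intro power_mono) auto
    then show ?thesis using k by (simp add: \<kappa>_def dot_square_norm max_def)
  qed
  have \<kappa>pos: "0 \<le> \<kappa> y" for y by (simp add: \<kappa>_def)
  define N where "N = integral\<^sup>L lebesgue \<kappa>"
  have \<kappa>i: "integrable lebesgue \<kappa>" by (rule integrable_continuous_bounded_support[OF c\<kappa> \<kappa>0])
  have N: "0 < N"
  proof (rule ccontr)
    assume "\<not> 0 < N"
    moreover have "0 \<le> N" unfolding N_def by (intro integral_nonneg_AE AE_I2 \<kappa>pos)
    ultimately have "integral\<^sup>L lebesgue \<kappa> = 0" by (simp add: N_def)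
    then have "AE y in lebesgue. \<kappa> y = 0"
      by (subst (asm) integral_nonneg_eq_0_iff_AE[OF \<kappa>i]) (auto simp: \<kappa>pos)
    then have "\<kappa> 0 = 0"
      by (intro eq_on_open_of_AE_eq[of UNIV \<kappa> "\<lambda>_. 0" 0]) (auto simp: c\<kappa>)
    then show False using a by (simp add: \<kappa>_def)
  qed
  \<comment> \<open>The bump dilated by \<open>j\<close> and centred at \<open>x\<close>, scaled so
    that F j (x + j y) x equals j^(2k) \<kappa>(y).\<close>
  define F where "F = (\<lambda>j (z::'a) (x::'a). max 0 ((real j * a)\<^sup>2 - (z - x) \<bullet> (z - x)) ^ k)"
  have flat: "kernel_flat k (F j)" for j unfolding F_def by (rule kernel_flat_truncated_power[OF k])
  then have "\<forall>j. \<exists>C. kernel_flat_bound k C (F j)" by (simp add: kernel_flat_def)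
  from choice[OF this] obtain CF where "\<forall>j. kernel_flat_bound k (CF j) (F j)" by blast
  then have CF: "\<And>j. CF j \<ge> 0"
    "\<And>j v A. continuous_on UNIV v \<Longrightarrow> (\<forall>z\<in>ball 0 1. \<bar>v z\<bar> \<le> A) \<Longrightarrow>
     \<exists>P. poly_deg_le (k - 1) P \<and>
       (\<forall>x. norm x \<le> 1 \<longrightarrow> \<bar>(LINT z:ball 0 1|lebesgue. v z * F j z x) - P x\<bar> \<le> CF j * A * norm x ^ k)"
    unfolding kernel_flat_bound_def by blast+
  define e where "e = (\<lambda>j. (-1) ^ (k - j) * real (k choose j))"
  \<comment> \<open>Undoes the Jacobian \<open>real j ^ ?n\<close> and the factor
    \<open>(real j)\<^sup>2 ^ k\<close> of the substitution z = x + j y.\<close>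
  define w where "w = (\<lambda>j. 1 / (real j ^ ?n * (real j)\<^sup>2 ^ k))"
  define S where "S = (\<Sum>j\<in>{1..k}. \<bar>e j\<bar> * (w j * CF j))"
  have S0: "0 \<le> S" unfolding S_def using CF(1) by (intro sum_nonneg mult_nonneg_nonneg) (auto simp: w_def)
  have "\<exists>P. poly_deg_le (k - 1) P \<and> (\<forall>x. norm x < 1 / 2 \<longrightarrow> \<bar>v x - P x\<bar> \<le> (1 + S / N) * (M + norm x ^ k * A))"
    if v: "continuous_on UNIV v" and A: "\<forall>z\<in>ball 0 1. \<bar>v z\<bar> \<le> A"
      and M: "\<forall>x h. h \<noteq> 0 \<longrightarrow> \<bar>fdiff h k v x\<bar> \<le> M * norm h powr \<beta>" for v :: "'a \<Rightarrow> real" and A M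
  proof -
    have A0: "0 \<le> A" using A[rule_format, of 0] by simp
    have M0: "0 \<le> M"
    proof -
      obtain b :: 'a where b: "b \<in> Basis" using nonempty_Basis by blast
      then have "b \<noteq> 0" "norm b = 1" by auto
      then show ?thesis using M[rule_format, of b 0] by simp
    qed
    have "\<forall>j. \<exists>P. poly_deg_le (k - 1) P \<and>
       (\<forall>x. norm x \<le> 1 \<longrightarrow> \<bar>(LINT z:ball 0 1|lebesgue. v z * F j z x) - P x\<bar> \<le> CF j * A * norm x ^ k)"
      using CF(2)[OF v A] by blast
    from choice[OF this] obtain P where "\<forall>j. poly_deg_le (k - 1) (P j) \<and>
       (\<forall>x. norm x \<le> 1 \<longrightarrow> \<bar>(LINT z:ball 0 1|lebesgue. v z * F j z x) - P j x\<bar> \<le> CF j * A * norm x ^ k)"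
      by blast
    then have P: "\<And>j. poly_deg_le (k - 1) (P j)"
      "\<And>j x. norm x \<le> 1 \<Longrightarrow> \<bar>(LINT z:ball 0 1|lebesgue. v z * F j z x) - P j x\<bar> \<le> CF j * A * norm x ^ k" by auto
    \<comment> \<open>The averaged binomial identity solved for its term \<open>j = 0\<close>, with
      every convolution replaced by its polynomial.\<close>
    define Q where "Q = (\<lambda>x. (- ((-1) ^ k) / N) * (\<Sum>j\<in>{1..k}. (e j * w j) * P j x))"
    have Q: "poly_deg_le (k - 1) Q" unfolding Q_def by (intro poly_deg_le_scale poly_deg_le_sum_scaled P)
    have "\<bar>v x - Q x\<bar> \<le> (1 + S / N) * (M + norm x ^ k * A)" if x: "norm x < 1 / 2" for x
    proof -
      have cv: "continuous_on UNIV (\<lambda>y. v (x + real j *\<^sub>R y))" for j :: nat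
        by (rule continuous_on_compose2[OF v]) (intro continuous_intros | simp)+
      have ci: "integrable lebesgue (\<lambda>y. v (x + real j *\<^sub>R y) * \<kappa> y)" for j :: nat
        by (rule integrable_continuous_bounded_support(1)[of _ 0 a]) (auto intro!: continuous_intros cv c\<kappa> simp: \<kappa>0)
      have conv: "integral\<^sup>L lebesgue (\<lambda>y. v (x + real j *\<^sub>R y) * \<kappa> y) = w j * (LINT z:ball 0 1|lebesgue. v z * F j z x)"
        if j: "j \<in> {1..k}" for j
      proof -
        have j0: "real j \<noteq> 0" using j by simp
        have F: "F j z x = 0" if "z \<notin> ball 0 1" for z
        proof -
          have "1 \<le> norm z" using that by simp
          also have "norm z \<le> norm (z - x) + norm x" using norm_triangle_ineq[of "z - x" x] by simp
          finally have "1 / 2 \<le> norm (z - x)" using x by linarith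
          moreover have "real j * a \<le> 1 / 2" using j k by (simp add: a_def field_simps)
          ultimately have "(real j * a)\<^sup>2 \<le> norm (z - x) ^ 2" using a by (intro power_mono) auto
          then show ?thesis using k by (simp add: F_def dot_square_norm max_def)
        qed
        have \<kappa>F: "F j (x + real j *\<^sub>R y) x = (real j)\<^sup>2 ^ k * \<kappa> y" for y
        proof -
          have "(real j * a)\<^sup>2 - (real j *\<^sub>R y) \<bullet> (real j *\<^sub>R y) = (real j)\<^sup>2 * (a\<^sup>2 - y \<bullet> y)"
            by (simp add: power2_eq_square algebra_simps)
          moreover have "max 0 ((real j)\<^sup>2 * u) = (real j)\<^sup>2 * max 0 u" for u
            by (simp add: max_def zero_le_mult_iff)
          ultimately show ?thesis by (simp add: F_def \<kappa>_def power_mult_distrib)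
        qed
        have cF: "continuous_on UNIV (\<lambda>z. v z * F j z x)"
          unfolding F_def by (intro continuous_intros v)
        have "(LINT z:ball 0 1|lebesgue. v z * F j z x) = integral\<^sup>L lebesgue (\<lambda>z. v z * F j z x)"
          using F by (intro integrable_continuous_bounded_support(2)[symmetric] cF) simp
        also have "\<dots> = real j ^ ?n * integral\<^sup>L lebesgue (\<lambda>y. v (x + real j *\<^sub>R y) * F j (x + real j *\<^sub>R y) x)"
          using integral_lebesgue_affine[OF cF j0, of x] by simp
        also have "\<dots> = real j ^ ?n * (real j)\<^sup>2 ^ k * integral\<^sup>L lebesgue (\<lambda>y. v (x + real j *\<^sub>R y) * \<kappa> y)"
          unfolding \<kappa>F by (simp add: mult.left_commute[of "v _"] mult.assoc)
        finally show ?thesis using j0 by (simp add: w_def)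
      qed
      have "integral\<^sup>L lebesgue (\<lambda>y. fdiff y k v x * \<kappa> y) = integral\<^sup>L lebesgue (\<lambda>y. \<Sum>j\<le>k. e j * (v (x + real j *\<^sub>R y) * \<kappa> y))"
        unfolding fdiff_binomial e_def by (simp add: sum_distrib_left sum_distrib_right mult_ac)
      also have "\<dots> = (\<Sum>j\<le>k. e j * integral\<^sup>L lebesgue (\<lambda>y. v (x + real j *\<^sub>R y) * \<kappa> y))"
        by (subst Bochner_Integration.integral_sum) (auto intro!: ci)
      also have "\<dots> = e 0 * integral\<^sup>L lebesgue (\<lambda>y. v x * \<kappa> y) + (\<Sum>j\<in>{1..k}. e j * integral\<^sup>L lebesgue (\<lambda>y. v (x + real j *\<^sub>R y) * \<kappa> y))"
      proof -
        have "{..k} = insert 0 {1..k}" by auto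
        then show ?thesis by simp
      qed
      also have "\<dots> = (-1) ^ k * N * v x + (\<Sum>j\<in>{1..k}. e j * (w j * (LINT z:ball 0 1|lebesgue. v z * F j z x)))"
        using conv by (simp add: e_def N_def mult_ac)
      finally have main: "integral\<^sup>L lebesgue (\<lambda>y. fdiff y k v x * \<kappa> y) =
         (-1) ^ k * N * v x + (\<Sum>j\<in>{1..k}. e j * (w j * (LINT z:ball 0 1|lebesgue. v z * F j z x)))" .
      have fi: "integrable lebesgue (\<lambda>y. fdiff y k v x * \<kappa> y)"
        unfolding fdiff_binomial sum_distrib_right using ci
        by (intro Bochner_Integration.integrable_sum) (simp add: mult.assoc)
      have "\<bar>integral\<^sup>L lebesgue (\<lambda>y. fdiff y k v x * \<kappa> y)\<bar> \<le> integral\<^sup>L lebesgue (\<lambda>y. \<bar>fdiff y k v x * \<kappa> y\<bar>)"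
        by (rule integral_abs_bound)
      also have "\<dots> \<le> integral\<^sup>L lebesgue (\<lambda>y. M * \<kappa> y)"
      proof (intro integral_mono integrable_abs fi integrable_mult_right \<kappa>i)
        fix y
        show "\<bar>fdiff y k v x * \<kappa> y\<bar> \<le> M * \<kappa> y"
        \<comment> \<open>The hypothesis on differences excludes step 0, where the difference
          vanishes because k > 0.\<close>
        proof (cases "y = 0 \<or> y \<notin> ball 0 a")
          case True
          then show ?thesis using \<kappa>0 M0 \<kappa>pos k by (auto simp: fdiff_zero)
        next
          case False
          have "\<bar>fdiff y k v x\<bar> \<le> M * norm y powr \<beta>" using M False by blast
          \<comment> \<open>The step is shorter than \<open>a \<le> 1\<close>, so its positive power
            is at most 1.\<close>
          also have "\<dots> \<le> M * 1"
            using M0 False a \<beta> by (intro mult_left_mono powr_le1) auto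
          finally show ?thesis using \<kappa>pos[of y] by (simp add: abs_mult mult_right_mono)
        qed
      qed
      finally have I: "\<bar>integral\<^sup>L lebesgue (\<lambda>y. fdiff y k v x * \<kappa> y)\<bar> \<le> M * N" by (simp add: N_def)
      have "\<bar>(\<Sum>j\<in>{1..k}. e j * (w j * (LINT z:ball 0 1|lebesgue. v z * F j z x))) - (\<Sum>j\<in>{1..k}. (e j * w j) * P j x)\<bar>
         = \<bar>\<Sum>j\<in>{1..k}. e j * (w j * ((LINT z:ball 0 1|lebesgue. v z * F j z x) - P j x))\<bar>"
        by (simp add: sum_subtractf[symmetric] algebra_simps)
      also have "\<dots> \<le> (\<Sum>j\<in>{1..k}. \<bar>e j\<bar> * (w j * (CF j * A * norm x ^ k)))"
      proof (rule order_trans[OF sum_abs sum_mono])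
        fix j assume "j \<in> {1..k}"
        have w0: "0 \<le> w j" by (simp add: w_def)
        have "\<bar>e j * (w j * ((LINT z:ball 0 1|lebesgue. v z * F j z x) - P j x))\<bar> = \<bar>e j\<bar> * (w j * \<bar>(LINT z:ball 0 1|lebesgue. v z * F j z x) - P j x\<bar>)"
          using w0 by (simp add: abs_mult)
        also have "\<dots> \<le> \<bar>e j\<bar> * (w j * (CF j * A * norm x ^ k))"
          using w0 x by (intro mult_left_mono P(2)) auto
        finally show "\<bar>e j * (w j * ((LINT z:ball 0 1|lebesgue. v z * F j z x) - P j x))\<bar> \<le> \<bar>e j\<bar> * (w j * (CF j * A * norm x ^ k))" .
      qed
      also have "\<dots> = S * (A * norm x ^ k)" by (simp add: S_def sum_distrib_left sum_distrib_right mult_ac)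
      finally have E: "\<bar>(\<Sum>j\<in>{1..k}. e j * (w j * (LINT z:ball 0 1|lebesgue. v z * F j z x))) - (\<Sum>j\<in>{1..k}. (e j * w j) * P j x)\<bar> \<le> S * (A * norm x ^ k)" .
      \<comment> \<open>The sign of the term \<open>j = 0\<close>; its square is 1.\<close>
      define s where "s = (-1::real) ^ k"
      have s: "s * s = 1" "\<bar>s\<bar> = 1" by (simp_all add: s_def power_mult_distrib[symmetric])
      have "s * N * (v x - Q x) = s * N * v x + (s * s) * (\<Sum>j\<in>{1..k}. (e j * w j) * P j x)"
        using N by (simp add: Q_def s_def[symmetric] field_simps)
      also have "\<dots> = integral\<^sup>L lebesgue (\<lambda>y. fdiff y k v x * \<kappa> y) - ((\<Sum>j\<in>{1..k}. e j * (w j * (LINT z:ball 0 1|lebesgue. v z * F j z x))) - (\<Sum>j\<in>{1..k}. (e j * w j) * P j x))"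
        using main by (simp add: s s_def[symmetric])
      finally have "\<bar>s * N * (v x - Q x)\<bar> \<le> M * N + S * (A * norm x ^ k)"
        using I E by linarith
      then have "N * \<bar>v x - Q x\<bar> \<le> M * N + S * (A * norm x ^ k)" using N s by (simp add: abs_mult)
      then have "\<bar>v x - Q x\<bar> \<le> M + S / N * (A * norm x ^ k)" using N by (simp add: field_simps)
      also have "\<dots> \<le> (1 + S / N) * (M + norm x ^ k * A)"
      proof -
        have "0 \<le> S / N * M" "0 \<le> norm x ^ k * A" using S0 N M0 A0 by simp_all
        then show ?thesis by (simp add: algebra_simps)
      qed
      finally show ?thesis .
    qed
    with Q show ?thesis by blast
  qed
  moreover have "0 < 1 + S / N" using S0 N by (simp add: add_pos_nonneg)
  ultimately show ?thesis by blast
qed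

text \<open>The error of the best polynomial approximation on balls of radius \<open>\<delta> ^ m\<close>, divided by
  \<open>\<delta> powr (m \<beta>)\<close>, obeys \<open>E (m + 1) \<le> C + E m / 2\<close>; boundedness of \<open>g\<close> starts the recursion.\<close>

lemma lipschitz_imp_poly_approx:
  fixes g :: "'a::euclidean_space \<Rightarrow> real"
  assumes \<beta>: "0 < \<beta>" "\<beta> < real k" and g: "continuous_on UNIV g" and A: "\<And>x. \<bar>g x\<bar> \<le> A"
    and M: "\<And>x h. h \<noteq> 0 \<Longrightarrow> \<bar>fdiff h k g x\<bar> \<le> M * norm h powr \<beta>"
  shows "\<exists>K>0. \<forall>c r. 0 < r \<longrightarrow> (\<exists>P. poly_deg_le (k - 1) P \<and> (\<forall>x\<in>ball c r. \<bar>g x - P x\<bar> \<le> K * r powr \<beta>))"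
proof -
  have k: "0 < k" using \<beta> by (cases k) auto
  obtain C where C: "C > 0" "\<And>(v :: 'a \<Rightarrow> real) A M. continuous_on UNIV v \<Longrightarrow> (\<forall>z\<in>ball 0 1. \<bar>v z\<bar> \<le> A) \<Longrightarrow>
    (\<forall>x h. h \<noteq> 0 \<longrightarrow> \<bar>fdiff h k v x\<bar> \<le> M * norm h powr \<beta>) \<Longrightarrow>
    (\<exists>P. poly_deg_le (k - 1) P \<and> (\<forall>x. norm x < 1 / 2 \<longrightarrow> \<bar>v x - P x\<bar> \<le> C * (M + norm x ^ k * A)))"
    using unit_ball_poly_approx[OF k \<beta>(1)] by metis
  have A0: "0 \<le> A" using A[of 0] by linarith
  have M0: "0 \<le> M"
  proof -
    obtain b :: 'a where b: "b \<in> Basis" using nonempty_Basis by blast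
    then have "b \<noteq> 0" "norm b = 1" by auto
    then show ?thesis using M[of b 0] by simp
  qed
  \<comment> \<open>The second entry solves C \<delta>^(k - \<beta>) = 1 / 2, which uses \<beta> <
    k. The first keeps the rescaled points in the region \<open>norm x < 1 / 2\<close> of the
    unit-ball estimate.\<close>
  define \<delta> where "\<delta> = min (1 / 2) ((1 / (2 * C)) powr (1 / (real k - \<beta>)))"
  have \<delta>: "0 < \<delta>" "\<delta> \<le> 1 / 2" using C by (auto simp: \<delta>_def)
  have \<delta>C: "C * \<delta> powr (real k - \<beta>) \<le> 1 / 2"
  proof -
    have "\<delta> powr (real k - \<beta>) \<le> ((1 / (2 * C)) powr (1 / (real k - \<beta>))) powr (real k - \<beta>)"
      using \<beta> \<delta> by (intro powr_mono2) (auto simp: \<delta>_def)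
    also have "\<dots> = 1 / (2 * C)" using \<beta> C by (simp add: powr_powr)
    finally have "C * \<delta> powr (real k - \<beta>) \<le> C * (1 / (2 * C))" using C by (intro mult_left_mono) auto
    then show ?thesis using C by simp
  qed
  \<comment> \<open>The three summands start the recursion, keep the inhomogeneous term below
    \<open>K0 / 2\<close>, and make \<open>K0\<close> positive.\<close>
  define K0 where "K0 = A + 2 * C * M * \<delta> powr (- \<beta>) + 1"
  have K0: "1 \<le> K0" "A \<le> K0" "2 * C * M * \<delta> powr (- \<beta>) \<le> K0" using A0 C M0 by (auto simp: K0_def)
  have scale: "\<exists>P. poly_deg_le (k - 1) P \<and> (\<forall>x\<in>ball c (\<delta> ^ m). \<bar>g x - P x\<bar> \<le> K0 * (\<delta> ^ m) powr \<beta>)" for c m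
  proof (induction m)
    case 0
    show ?case using A K0 by (intro exI[of _ "\<lambda>_. 0"]) (auto simp: poly_deg_le_const intro: order_trans)
  next
    case (Suc m)
    define r where "r = \<delta> ^ m"
    have r: "0 < r" using \<delta> by (simp add: r_def)
    obtain P where P: "poly_deg_le (k - 1) P" "\<And>x. x \<in> ball c r \<Longrightarrow> \<bar>g x - P x\<bar> \<le> K0 * r powr \<beta>"
      using Suc unfolding r_def by blast
    \<comment> \<open>After subtracting \<open>P\<close> and rescaling to the unit ball the
      hypotheses keep their form: \<open>k\<close>-th differences ignore \<open>P\<close>, and both
      constants acquire the factor \<open>r powr \<beta>\<close>.\<close>
    define u where "u = (\<lambda>x. g x - P x)"
    define v where "v = (\<lambda>z. u (c + r *\<^sub>R z))"
    have cu: "continuous_on UNIV u" unfolding u_def by (intro continuous_intros g continuous_on_poly_deg_le[OF P(1)])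
    have "continuous_on UNIV v" unfolding v_def by (rule continuous_on_compose2[OF cu]) (intro continuous_intros | simp)+
    moreover have "\<forall>z\<in>ball 0 1. \<bar>v z\<bar> \<le> K0 * r powr \<beta>"
      using r P(2) by (auto simp: v_def u_def dist_norm)
    moreover have "\<forall>x h. h \<noteq> 0 \<longrightarrow> \<bar>fdiff h k v x\<bar> \<le> (M * r powr \<beta>) * norm h powr \<beta>"
    proof (intro allI impI)
      fix x h :: 'a assume h: "h \<noteq> 0"
      have "fdiff (r *\<^sub>R h) k P y = 0" for y using fdiff_poly_deg_le[OF P(1)] k by simp
      then have "fdiff h k v x = fdiff (r *\<^sub>R h) k g (c + r *\<^sub>R x)"
        unfolding v_def fdiff_affine unfolding u_def fdiff_diff by simp
      then have "\<bar>fdiff h k v x\<bar> \<le> M * norm (r *\<^sub>R h) powr \<beta>" using M[of "r *\<^sub>R h"] h r by simp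
      then show "\<bar>fdiff h k v x\<bar> \<le> (M * r powr \<beta>) * norm h powr \<beta>" using r by (simp add: powr_mult)
    qed
    ultimately obtain P' where P': "poly_deg_le (k - 1) P'"
      "\<And>x. norm x < 1 / 2 \<Longrightarrow> \<bar>v x - P' x\<bar> \<le> C * (M * r powr \<beta> + norm x ^ k * (K0 * r powr \<beta>))"
      using C(2) by blast
    \<comment> \<open>\<open>P\<close> corrected by \<open>P'\<close>, transported back to
      \<open>ball c r\<close>.\<close>
    define R where "R = (\<lambda>x. P x + P' ((- 1 / r) *\<^sub>R c + (1 / r) *\<^sub>R x))"
    have R: "poly_deg_le (k - 1) R" unfolding R_def by (intro poly_deg_le_add P(1) poly_deg_le_affine P'(1))
    have "\<bar>g x - R x\<bar> \<le> K0 * (\<delta> ^ Suc m) powr \<beta>" if x: "x \<in> ball c (\<delta> ^ Suc m)" for x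
    proof -
      define z where "z = (- 1 / r) *\<^sub>R c + (1 / r) *\<^sub>R x"
      have "z = (1 / r) *\<^sub>R (x - c)" by (simp add: z_def scaleR_diff_right)
      then have z: "norm z < \<delta>" using x r by (simp add: dist_norm norm_minus_commute r_def divide_less_eq)
      have "c + r *\<^sub>R z = x" using r by (simp add: z_def scaleR_diff_right)
      then have "g x - R x = v z - P' z" by (simp add: v_def u_def R_def z_def)
      also have "\<bar>\<dots>\<bar> \<le> C * (M * r powr \<beta> + norm z ^ k * (K0 * r powr \<beta>))"
        using z \<delta> by (intro P'(2)) auto
      also have "\<dots> \<le> C * (M * r powr \<beta> + \<delta> ^ k * (K0 * r powr \<beta>))"
        using z K0 C by (intro mult_left_mono add_mono mult_right_mono power_mono) auto
      \<comment> \<open>The target size \<delta>^\<beta> r^\<beta> is factored out; each of the two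
        remaining summands is at most \<open>K0 / 2\<close>.\<close>
      also have "\<dots> = ((C * M * \<delta> powr (-\<beta>)) + (C * \<delta> powr (real k - \<beta>)) * K0) * (\<delta> powr \<beta> * r powr \<beta>)"
      proof -
        have "\<delta> powr (-\<beta>) * \<delta> powr \<beta> = 1" "\<delta> powr (real k - \<beta>) * \<delta> powr \<beta> = \<delta> ^ k"
          using \<delta> by (simp_all add: powr_add[symmetric] powr_realpow)
        moreover have "((C * M * \<delta> powr (-\<beta>)) + (C * \<delta> powr (real k - \<beta>)) * K0) * (\<delta> powr \<beta> * r powr \<beta>)
            = C * M * r powr \<beta> * (\<delta> powr (-\<beta>) * \<delta> powr \<beta>) + C * K0 * r powr \<beta> * (\<delta> powr (real k - \<beta>) * \<delta> powr \<beta>)"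
          by (simp only: algebra_simps)
        ultimately have "((C * M * \<delta> powr (-\<beta>)) + (C * \<delta> powr (real k - \<beta>)) * K0) * (\<delta> powr \<beta> * r powr \<beta>)
            = C * M * r powr \<beta> * 1 + C * K0 * r powr \<beta> * \<delta> ^ k"
          by (simp only:)
        then show ?thesis by (simp add: algebra_simps)
      qed
      also have "\<dots> \<le> (K0 / 2 + 1 / 2 * K0) * (\<delta> powr \<beta> * r powr \<beta>)"
        using \<delta>C K0 by (intro mult_right_mono add_mono) auto
      also have "\<dots> = K0 * (\<delta> ^ Suc m) powr \<beta>" using \<delta> r by (simp add: r_def powr_mult)
      finally show ?thesis .
    qed
    with R show ?case by blast
  qed
  \<comment> \<open>Interpolating between the radii \<open>\<delta> ^ Suc m\<close> and
    \<open>\<delta> ^ m\<close> costs one factor \<open>\<delta> powr (- \<beta>)\<close>.\<close>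
  define K where "K = K0 * \<delta> powr (- \<beta>)"
  have Kge: "K0 \<le> K"
  proof -
    have "1 \<le> \<delta> powr (-\<beta>)" using \<delta> \<beta> by (simp add: powr_minus powr_le1 one_le_inverse)
    then have "K0 * 1 \<le> K0 * \<delta> powr (-\<beta>)" using K0 by (intro mult_left_mono) auto
    then show ?thesis by (simp add: K_def)
  qed
  have "\<exists>P. poly_deg_le (k - 1) P \<and> (\<forall>x\<in>ball c r. \<bar>g x - P x\<bar> \<le> K * r powr \<beta>)" if r: "0 < r" for c r
  \<comment> \<open>For r > 1 the zero polynomial suffices because \<open>g\<close> is
    bounded.\<close>
  proof (cases "r \<le> 1")
    case False
    have "1 \<le> r powr \<beta>" using False \<beta> by (intro ge_one_powr_ge_zero) auto
    then have "A * 1 \<le> K * r powr \<beta>" using K0 Kge A0 by (intro mult_mono) auto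
    then show ?thesis using A by (intro exI[of _ "\<lambda>_. 0"]) (auto simp: poly_deg_le_const intro: order_trans)
  next
    case True
    have "\<exists>m. \<delta> ^ Suc m < r"
    proof -
      obtain m where "\<delta> ^ m < r" using real_arch_pow_inv[OF r, of \<delta>] \<delta> by auto
      moreover have "\<delta> ^ Suc m \<le> \<delta> ^ m" using \<delta> by (intro power_decreasing) auto
      ultimately show ?thesis by (meson le_less_trans)
    qed
    then obtain m where m: "\<delta> ^ Suc m < r" "\<And>i. i < m \<Longrightarrow> \<not> \<delta> ^ Suc i < r"
      using exists_least_iff[of "\<lambda>m. \<delta> ^ Suc m < r"] by auto
    have rm: "r \<le> \<delta> ^ m" using True m(2)[of "m - 1"] by (cases m) auto
    obtain P where P: "poly_deg_le (k - 1) P" "\<And>x. x \<in> ball c (\<delta> ^ m) \<Longrightarrow> \<bar>g x - P x\<bar> \<le> K0 * (\<delta> ^ m) powr \<beta>"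
      using scale by blast
    have "(\<delta> ^ m) powr \<beta> = \<delta> powr (-\<beta>) * (\<delta> ^ Suc m) powr \<beta>"
    proof -
      have "\<delta> powr (-\<beta>) * \<delta> powr \<beta> = 1" using \<delta> by (simp add: powr_add[symmetric])
      then show ?thesis using \<delta> by (simp add: powr_mult mult.assoc[symmetric])
    qed
    also have "\<dots> \<le> \<delta> powr (-\<beta>) * r powr \<beta>"
      using m(1) \<delta> \<beta> by (intro mult_left_mono powr_mono2) auto
    finally have "K0 * (\<delta> ^ m) powr \<beta> \<le> K * r powr \<beta>"
      using K0 by (simp add: K_def mult.assoc mult_left_mono)
    then have "\<forall>x\<in>ball c r. \<bar>g x - P x\<bar> \<le> K * r powr \<beta>" using P(2) subset_ball[OF rm] by (blast intro: order_trans)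
    with P(1) show ?thesis by blast
  qed
  moreover have "0 < K" using K0 Kge by linarith
  ultimately show ?thesis by blast
qed

section \<open>Function spaces and the multiplier theorem\<close>

lemma inverse_div_inverse_powr:
  fixes t :: real
  assumes "0 < t" shows "(1 / t) / ((1 / t) powr (1 - p)) = t powr (- p)"
proof -
  have "(1 / t) / ((1 / t) powr (1 - p)) = (1 / t) powr 1 / (1 / t) powr (1 - p)" using assms by simp
  also have "\<dots> = (1 / t) powr p" by (simp only: powr_diff[symmetric]) simp
  also have "\<dots> = t powr (- p)" using assms by (simp add: powr_divide powr_minus_divide)
  finally show ?thesis .
qed

text \<open>With \<tau> = 1 / t: \<open>Phi p \<tau>\<close> is at most \<tau>^p always, and up to a
  factor 2 it equals \<tau>^p for \<tau> \<ge> 1 and \<tau> for \<tau> \<le> 1, according to which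
  summand of the denominator dominates. The next two lemmas are the lower bounds.\<close>

lemma Phi_le_powr:
  assumes "0 < t" shows "Phi p (1 / t) \<le> t powr (- p)"
proof -
  have "Phi p (1 / t) \<le> (1 / t) / ((1 / t) powr (1 - p))"
    unfolding Phi_def using assms by (intro divide_left_mono) (auto intro!: mult_pos_pos add_pos_pos)
  then show ?thesis by (simp only: inverse_div_inverse_powr[OF assms])
qed

lemma Phi_ge_powr:
  assumes "0 < t" "t \<le> 1" "p < 1" shows "t powr (- p) / 2 \<le> Phi p (1 / t)"
proof -
  have "1 \<le> (1 / t) powr (1 - p)" using assms by (intro ge_one_powr_ge_zero) auto
  then have "(1 / t) / (2 * (1 / t) powr (1 - p)) \<le> Phi p (1 / t)"
    unfolding Phi_def using assms by (intro divide_left_mono) (auto intro!: mult_pos_pos add_pos_pos)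
  moreover have "(1 / t) / (2 * (1 / t) powr (1 - p)) = (1 / t) / ((1 / t) powr (1 - p)) / 2"
    by (simp only: divide_divide_eq_left mult.commute)
  ultimately show ?thesis by (simp only: inverse_div_inverse_powr[OF assms(1)])
qed

lemma Phi_ge_linear:
  assumes "1 \<le> t" "p < 1" shows "1 / (2 * t) \<le> Phi p (1 / t)"
proof -
  have "(1 / t) powr (1 - p) \<le> 1" using assms by (intro powr_le1) auto
  then have "(1 / t) / 2 \<le> Phi p (1 / t)"
    unfolding Phi_def using assms by (intro divide_left_mono) (auto intro!: mult_pos_pos add_pos_pos)
  then show ?thesis by simp
qed

text \<open>The integrand takes one value on the ball and 0 outside, as
  \<open>Phi p 0 = 0\<close>.\<close>

lemma orlicz_norm_ball:
  fixes c :: "'a::euclidean_space"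
  assumes "0 \<le> r"
  shows "orlicz_norm p (indicator (ball c r)) = Inf {t. t > 0 \<and> Phi p (1 / t) * measure lebesgue (ball c r) \<le> 1}"
proof -
  have "(\<integral>\<^sup>+ x. ennreal (Phi p (\<bar>indicator (ball c r) x\<bar> / t)) \<partial>lebesgue) \<le> 1 \<longleftrightarrow> Phi p (1 / t) * measure lebesgue (ball c r) \<le> 1"
    if "t > 0" for t
  proof -
    have P: "0 \<le> Phi p (1 / t)" using that by (simp add: Phi_def)
    have "(\<integral>\<^sup>+ x. ennreal (Phi p (\<bar>indicator (ball c r) x\<bar> / t)) \<partial>lebesgue) = (\<integral>\<^sup>+ x. ennreal (Phi p (1 / t)) * indicator (ball c r) x \<partial>lebesgue)"
      by (intro nn_integral_cong) (auto simp: indicator_def Phi_def)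
    also have "\<dots> = ennreal (Phi p (1 / t)) * emeasure lebesgue (ball c r)" by (rule nn_integral_cmult_indicator) simp
    also have "\<dots> = ennreal (Phi p (1 / t) * measure lebesgue (ball c r))"
      unfolding emeasure_lebesgue_ball[OF assms] measure_lebesgue_ball[OF assms] using P by (rule ennreal_mult'[symmetric])
    finally show ?thesis by simp
  qed
  then show ?thesis unfolding orlicz_norm_def by (intro arg_cong[where f = Inf]) auto
qed

text \<open>The two regimes of \<open>Phi\<close> appear as |B|^(1/p) for small balls and |B| for
  large ones. The upper bound converts a finite Campanato norm into a rate of approximation; the
  lower bounds serve to estimate the Campanato norm from above.\<close>

lemma orlicz_norm_ball_bounds:
  fixes c :: "'a::euclidean_space"
  assumes p: "0 < p" "p < 1" and r: "0 < r"
  defines "m \<equiv> measure lebesgue (ball c r)"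
  shows "orlicz_norm p (indicator (ball c r)) \<le> m powr (1 / p)"
    and "m < 1 \<Longrightarrow> (m / 2) powr (1 / p) \<le> orlicz_norm p (indicator (ball c r))"
    and "m \<ge> 1 \<Longrightarrow> (1 / 2) powr (1 / p) / 2 * m \<le> orlicz_norm p (indicator (ball c r))"
proof -
  let ?T = "{t. t > 0 \<and> Phi p (1 / t) * m \<le> 1}"
  have m: "0 < m" unfolding m_def using r by (simp add: measure_lebesgue_ball del: measure_completion)
  have eq: "orlicz_norm p (indicator (ball c r)) = Inf ?T" unfolding m_def using r by (intro orlicz_norm_ball) simp
  have mT: "m powr (1 / p) \<in> ?T"
  proof -
    have "Phi p (1 / m powr (1 / p)) * m \<le> (m powr (1 / p)) powr (- p) * m"
      using m by (intro mult_right_mono Phi_le_powr) auto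
    also have "(m powr (1 / p)) powr (- p) = m powr (-1)" using p by (simp add: powr_powr)
    also have "m powr (-1) * m = 1" using m by (simp add: powr_minus_divide)
    finally show ?thesis using m by simp
  qed
  show "orlicz_norm p (indicator (ball c r)) \<le> m powr (1 / p)"
    unfolding eq by (rule cInf_lower[OF mT]) (auto intro!: bdd_belowI[of _ 0])
  have small: "(m / 2) powr (1 / p) \<le> t" if t: "t \<in> ?T" "t \<le> 1" for t
  proof -
    have "t powr (- p) / 2 * m \<le> Phi p (1 / t) * m"
      using t p m by (intro mult_right_mono Phi_ge_powr) auto
    also have "\<dots> \<le> 1" using t by simp
    finally have "m / 2 \<le> t powr p" using t by (simp add: powr_minus_divide field_simps)
    then have "(m / 2) powr (1 / p) \<le> (t powr p) powr (1 / p)" using m p by (intro powr_mono2) auto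
    then show ?thesis using t p by (simp add: powr_powr)
  qed
  have large: "m / 2 \<le> t" if t: "t \<in> ?T" "1 \<le> t" for t
  proof -
    have "1 / (2 * t) * m \<le> Phi p (1 / t) * m" using t p m by (intro mult_right_mono Phi_ge_linear) auto
    also have "\<dots> \<le> 1" using t by simp
    finally show ?thesis using t by (simp add: field_simps)
  qed
  show "(m / 2) powr (1 / p) \<le> orlicz_norm p (indicator (ball c r))" if "m < 1"
    unfolding eq
  proof (rule cInf_greatest)
    show "?T \<noteq> {}" using mT by blast
    fix t assume t: "t \<in> ?T"
    show "(m / 2) powr (1 / p) \<le> t"
    proof (cases "t \<le> 1")
      case False
      have "(m / 2) powr (1 / p) \<le> 1" using m that p by (intro powr_le1) auto
      then show ?thesis using False by simp
    qed (use small t in blast)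
  qed
  show "(1 / 2) powr (1 / p) / 2 * m \<le> orlicz_norm p (indicator (ball c r))" if m1: "m \<ge> 1"
    unfolding eq
  proof (rule cInf_greatest)
    show "?T \<noteq> {}" using mT by blast
    fix t assume t: "t \<in> ?T"
    show "(1 / 2) powr (1 / p) / 2 * m \<le> t"
    proof (cases "t \<le> 1")
      case True
      have s: "(m / 2) powr (1 / p) \<le> t" using small t True by blast
      \<comment> \<open>If some \<open>t \<le> 1\<close> is admissible although
        \<open>m \<ge> 1\<close>, then \<open>small\<close> confines \<open>m\<close> to [1, 2],
        where m^(1/p) and m agree up to constants.\<close>
      have "m \<le> 2"
      proof (rule ccontr)
        assume "\<not> m \<le> 2"
        then have "1 powr (1 / p) < (m / 2) powr (1 / p)" using p by (intro powr_less_mono2) auto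
        then show False using s True by simp
      qed
      then have "(1 / 2) powr (1 / p) / 2 * m \<le> (1 / 2) powr (1 / p) / 2 * 2" by (intro mult_left_mono) auto
      also have "\<dots> \<le> (m / 2) powr (1 / p)" using m1 p by (simp, intro powr_mono2) auto
      finally show ?thesis using s by simp
    next
      case False
      have "(1 / 2) powr (1 / p) \<le> (1::real)" using p by (intro powr_le1) auto
      then have "(1 / 2) powr (1 / p) / 2 * m \<le> 1 / 2 * m" using m by (intro mult_right_mono) auto
      then show ?thesis using large[OF t] False by simp
    qed
  qed
qed

text \<open>The Campanato norm divides by this number; for the value 0 the quotient would be 0 and
  carry no information.\<close>

lemma orlicz_norm_ball_pos:
  fixes c :: "'a::euclidean_space"
  assumes p: "0 < p" "p < 1" and r: "0 < r"
  shows "0 < orlicz_norm p (indicator (ball c r))"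
proof -
  let ?m = "measure lebesgue (ball c r)"
  have m: "0 < ?m" using r by (simp add: measure_lebesgue_ball del: measure_completion)
  show ?thesis
  proof (cases "?m < 1")
    case True
    have "0 < (?m / 2) powr (1 / p)" using m by (simp del: measure_completion)
    also have "\<dots> \<le> orlicz_norm p (indicator (ball c r))" by (rule orlicz_norm_ball_bounds(2)[OF p r True])
    finally show ?thesis .
  next
    case False
    then have m1: "1 \<le> ?m" by (rule leI)
    have "0 < (1 / 2) powr (1 / p) / 2 * ?m" using m by (intro mult_pos_pos) auto
    also have "\<dots> \<le> orlicz_norm p (indicator (ball c r))" by (rule orlicz_norm_ball_bounds(3)[OF p r m1])
    finally show ?thesis .
  qed
qed

section \<open>Essential bounds and continuous representatives\<close>

lemma not_AE_lebesgue_False: "\<not> (AE x in (lebesgue :: 'a::euclidean_space measure). False)"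
proof
  assume "AE x in (lebesgue :: 'a measure). False"
  then have "(0::real) = 1"
    by (intro eq_on_open_of_AE_eq[of UNIV "\<lambda>_::'a. 0" "\<lambda>_. 1" 0]) auto
  then show False by simp
qed

text \<open>The essential supremum lives in the extended reals. A negative value would make an
  absolute value negative a.e., while Lebesgue measure is nonzero.\<close>

lemma Linf_norm_nonneg: "0 \<le> Linf_norm (f :: 'a::euclidean_space \<Rightarrow> real)"
proof (rule ccontr)
  assume "\<not> 0 \<le> Linf_norm f"
  then have neg: "Linf_norm f < 0" by simp
  have "AE x in lebesgue. ereal \<bar>f x\<bar> \<le> Linf_norm f" unfolding Linf_norm_def by (rule esssup_AE)
  then have "AE x in (lebesgue :: 'a measure). False"
  proof eventually_elim
    case (elim x)
    then have "ereal \<bar>f x\<bar> < 0" using neg by (rule le_less_trans)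
    then show ?case by simp
  qed
  then show False by (simp add: not_AE_lebesgue_False)
qed

lemma Linf_norm_realE:
  fixes f :: "'a::euclidean_space \<Rightarrow> real"
  assumes "Linf_norm f < \<infinity>"
  obtains A where "0 \<le> A" "Linf_norm f = ereal A" "AE x in lebesgue. \<bar>f x\<bar> \<le> A"
proof -
  obtain A where A: "Linf_norm f = ereal A" using assms Linf_norm_nonneg[of f] by (cases "Linf_norm f") auto
  have "AE x in lebesgue. ereal \<bar>f x\<bar> \<le> Linf_norm f" unfolding Linf_norm_def by (rule esssup_AE)
  then have "AE x in lebesgue. \<bar>f x\<bar> \<le> A" by (simp add: A)
  then show ?thesis using that[of A] A Linf_norm_nonneg[of f] by simp
qed

lemma Linf_norm_le:
  assumes [measurable]: "f \<in> borel_measurable lebesgue" and "AE x in lebesgue. \<bar>f x\<bar> \<le> A"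
  shows "Linf_norm f \<le> ereal A"
  unfolding Linf_norm_def by (rule esssup_I) (use assms in auto)

lemma cont_reps_unique:
  assumes "G \<in> cont_reps f" shows "cont_reps f = {G}"
proof -
  have "H = G" if "H \<in> cont_reps f" for H
  proof
    fix x
    have "AE x in lebesgue. f x = H x" "AE x in lebesgue. f x = G x" using that assms by (auto simp: cont_reps_def)
    then have "AE x in lebesgue. x \<in> UNIV \<longrightarrow> H x = G x" by eventually_elim simp
    then show "H x = G x"
      using that assms by (intro eq_on_open_of_AE_eq[of UNIV H G]) (auto simp: cont_reps_def)
  qed
  then show ?thesis using assms by blast
qed

lemma Lambda_norm_eq: "G \<in> cont_reps f \<Longrightarrow> Lambda_norm \<beta> f = Linf_norm f + lip_semi \<beta> G"
  by (simp add: Lambda_norm_def cont_reps_unique)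

lemma abs_cont_rep_le:
  fixes G :: "'a::euclidean_space \<Rightarrow> real"
  assumes "G \<in> cont_reps f" "AE x in lebesgue. \<bar>f x\<bar> \<le> A"
  shows "\<bar>G x\<bar> \<le> A"
proof -
  have "AE x in lebesgue. f x = G x" and G: "continuous_on UNIV G" using assms by (auto simp: cont_reps_def)
  \<comment> \<open>The inequality is phrased as an equation between continuous functions, so that
    a.e. equality upgrades to equality everywhere.\<close>
  then have "AE x in lebesgue. x \<in> UNIV \<longrightarrow> max \<bar>G x\<bar> A = A"
    using assms(2) by eventually_elim auto
  then have "max \<bar>G x\<bar> A = A"
    using G by (intro eq_on_open_of_AE_eq[of UNIV "\<lambda>x. max \<bar>G x\<bar> A" "\<lambda>_. A"]) (auto intro!: continuous_intros)
  then show ?thesis by linarith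
qed

lemma lip_semi_le_iff:
  fixes g :: "'a::euclidean_space \<Rightarrow> real"
  shows "lip_semi \<beta> g \<le> ereal M \<longleftrightarrow>
    (\<forall>x h. h \<noteq> 0 \<longrightarrow> \<bar>fdiff h (nat \<lfloor>\<beta>\<rfloor> + 1) g x\<bar> \<le> M * norm h powr \<beta>)"
  unfolding lip_semi_def SUP_le_iff by (auto simp: divide_le_eq simp del: fdiff.simps)

lemma lip_semi_nonneg: "0 \<le> lip_semi \<beta> (g :: 'a::euclidean_space \<Rightarrow> real)"
proof -
  obtain b :: 'a where b: "b \<in> Basis" using nonempty_Basis by blast
  then have "b \<noteq> 0" by auto
  have "0 \<le> ereal (\<bar>fdiff b (nat \<lfloor>\<beta>\<rfloor> + 1) g 0\<bar> / (norm b powr \<beta>))" by simp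
  also have "\<dots> \<le> lip_semi \<beta> g"
    unfolding lip_semi_def by (rule SUP_upper2[of 0], simp, rule SUP_upper2[of b]) (use \<open>b \<noteq> 0\<close> in auto)
  finally show ?thesis .
qed

lemma in_LambdaE:
  fixes f :: "'a::euclidean_space \<Rightarrow> real"
  assumes "in_Lambda \<beta> f"
  obtains G A M where "0 \<le> A" "0 \<le> M" "G \<in> cont_reps f" "f \<in> borel_measurable lebesgue"
    "Linf_norm f = ereal A" "lip_semi \<beta> G = ereal M" "Lambda_norm \<beta> f = ereal (A + M)"
    "AE x in lebesgue. \<bar>f x\<bar> \<le> A" "\<And>x. \<bar>G x\<bar> \<le> A"
    "\<And>x h. h \<noteq> 0 \<Longrightarrow> \<bar>fdiff h (nat \<lfloor>\<beta>\<rfloor> + 1) G x\<bar> \<le> M * norm h powr \<beta>"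
proof -
  obtain G where G: "G \<in> cont_reps f" and fin: "Linf_norm f + lip_semi \<beta> G < \<infinity>"
    and f: "f \<in> borel_measurable lebesgue" using assms by (auto simp: in_Lambda_def)
  have "Linf_norm f < \<infinity>" using fin lip_semi_nonneg[of \<beta> G] by auto
  then obtain A where A: "0 \<le> A" "Linf_norm f = ereal A" "AE x in lebesgue. \<bar>f x\<bar> \<le> A" by (rule Linf_norm_realE)
  obtain M where M: "lip_semi \<beta> G = ereal M" "0 \<le> M"
    using fin A lip_semi_nonneg[of \<beta> G] by (cases "lip_semi \<beta> G") auto
  have "Lambda_norm \<beta> f = ereal (A + M)" by (simp add: Lambda_norm_eq[OF G] A M)
  moreover have "\<bar>G x\<bar> \<le> A" for x by (rule abs_cont_rep_le[OF G A(3)])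
  moreover have "\<And>x h. h \<noteq> 0 \<Longrightarrow> \<bar>fdiff h (nat \<lfloor>\<beta>\<rfloor> + 1) G x\<bar> \<le> M * norm h powr \<beta>"
    using lip_semi_le_iff[of \<beta> G M] M(1) by simp
  ultimately show ?thesis using that A M G f by blast
qed

lemma in_LambdaI:
  fixes f :: "'a::euclidean_space \<Rightarrow> real"
  assumes "f \<in> borel_measurable lebesgue" and G: "G \<in> cont_reps f" and "AE x in lebesgue. \<bar>f x\<bar> \<le> A"
    and "\<And>x h. h \<noteq> 0 \<Longrightarrow> \<bar>fdiff h (nat \<lfloor>\<beta>\<rfloor> + 1) G x\<bar> \<le> M * norm h powr \<beta>"
  shows "in_Lambda \<beta> f" and "Lambda_norm \<beta> f \<le> ereal (A + M)"
proof -
  have "lip_semi \<beta> G \<le> ereal M" unfolding lip_semi_le_iff using assms(4) by blast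
  with Linf_norm_le[OF assms(1,3)] have le: "Linf_norm f + lip_semi \<beta> G \<le> ereal A + ereal M" by (rule add_mono)
  then show "Lambda_norm \<beta> f \<le> ereal (A + M)" by (simp add: Lambda_norm_eq[OF G])
  have "Linf_norm f + lip_semi \<beta> G < \<infinity>" using le by (rule le_less_trans) simp
  then show "in_Lambda \<beta> f" unfolding in_Lambda_def using assms(1) G by blast
qed

section \<open>Campanato norm and smoothness\<close>

text \<open>Origin of \<beta>: since n / p = n + n (1 / p - 1), the indicator of a small ball has
  norm comparable to its volume times r^\<beta>, and dividing by it turns the Campanato condition
  into mean oscillation of size r^\<beta>.\<close>

lemma ball_volume_powr:
  fixes p r :: real
  assumes "0 < p" "0 < r"
  shows "(a * r ^ n) powr (1 / p) = a powr (1 / p) * (r ^ n * r powr (real n * (1 / p - 1)))"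
proof -
  have "(r ^ n) powr (1 / p) = r powr (real n + real n * (1 / p - 1))"
    using assms by (simp add: powr_realpow[symmetric] powr_powr algebra_simps)
  also have "\<dots> = r ^ n * r powr (real n * (1 / p - 1))" using assms by (simp add: powr_add powr_realpow)
  finally show ?thesis using assms by (simp add: powr_mult)
qed

lemma L1_loc_set_integrable_ball:
  assumes "L1_loc g" shows "set_integrable lebesgue (ball c r) g"
proof -
  have "set_integrable lebesgue (cball c r) g" using assms by (simp add: L1_loc_def)
  then show ?thesis by (rule set_integrable_subset) auto
qed

text \<open>Extends the difference estimate from small steps to all steps, and names the two
  extended real norms by real numbers so that later arithmetic is real.\<close>

lemma campanato_lipschitz_representative:
  fixes p :: real
  assumes p: "0 < p" "p < 1"
  defines "\<beta> \<equiv> real DIM('a::euclidean_space) * (1 / p - 1)"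
  shows "\<exists>C>0. \<forall>g :: 'a \<Rightarrow> real. in_Linf g \<and> in_campanato p g \<longrightarrow>
    (\<exists>G A N. 0 \<le> A \<and> 0 \<le> N \<and> Linf_norm g = ereal A \<and> campanato_norm p g = ereal N \<and> G \<in> cont_reps g \<and>
      (AE x in lebesgue. \<bar>g x\<bar> \<le> A) \<and> (\<forall>x. \<bar>G x\<bar> \<le> A) \<and>
      (\<forall>x h. h \<noteq> 0 \<longrightarrow> \<bar>fdiff h (nat \<lfloor>\<beta>\<rfloor> + 1) G x\<bar> \<le> C * (A + N) * norm h powr \<beta>))"
proof -
  let ?n = "DIM('a)" and ?d = "camp_d TYPE('a) p"
  define \<omega> where "\<omega> = unit_ball_vol (real ?n)"
  have \<omega>: "0 < \<omega>" by (simp add: \<omega>_def)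
  have \<beta>: "0 < \<beta>" unfolding \<beta>_def using p by (intro mult_pos_pos) auto
  have d: "?d = nat \<lfloor>\<beta>\<rfloor>" by (simp add: camp_d_def \<beta>_def)
  \<comment> \<open>For r < 1 the volume is at most \<omega> r, which the second entry keeps below
    1; balls below this radius enter the first supremum.\<close>
  define \<rho>0 where "\<rho>0 = min 1 (1 / (2 * \<omega>))"
  have \<rho>0: "0 < \<rho>0" using \<omega> by (simp add: \<rho>0_def)
  have vol: "measure lebesgue (ball (c::'a) r) < 1" if "0 < r" "r < \<rho>0" for c r
  proof -
    have "r ^ ?n \<le> r ^ 1" using that by (intro power_decreasing) (auto simp: \<rho>0_def Suc_leI)
    then have "\<omega> * r ^ ?n \<le> \<omega> * r" using \<omega> by simp
    also have "\<dots> \<le> \<omega> * (1 / (2 * \<omega>))" using \<omega> that by (intro mult_left_mono) (auto simp: \<rho>0_def)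
    also have "\<dots> < 1" using \<omega> by simp
    finally show ?thesis using that by (simp add: measure_lebesgue_ball \<omega>_def del: measure_completion)
  qed
  obtain C \<rho> where C: "C > 0" "\<rho> > 0" "\<And>(g :: 'a \<Rightarrow> real) M. 
    g \<in> borel_measurable lebesgue \<Longrightarrow> 0 \<le> M \<Longrightarrow>
    (\<forall>c r. 0 < r \<longrightarrow> r < \<rho>0 \<longrightarrow> (\<exists>P. poly_deg_le ?d P \<and>
       (\<integral>\<^sup>+x\<in>ball c r. ennreal \<bar>g x - P x\<bar> \<partial>lebesgue) \<le> ennreal (M * r ^ ?n * r powr \<beta>))) \<Longrightarrow>
    (\<exists>G. continuous_on UNIV G \<and> (AE x in lebesgue. g x = G x) \<and>
       (\<forall>x h. h \<noteq> 0 \<longrightarrow> norm h \<le> \<rho> \<longrightarrow> \<bar>fdiff h (Suc ?d) G x\<bar> \<le> C * M * norm h powr \<beta>))"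
    using campanato_imp_lipschitz[OF \<beta> \<rho>0, of ?d, where 'a = 'a] by auto
  define w where "w = \<omega> powr (1 / p)"
  have w: "0 < w" using \<omega> by (simp add: w_def)
  \<comment> \<open>The first summand serves steps up to \<rho>, the second longer ones, where the
    bound \<open>2 ^ Suc ?d * A\<close> is combined with \<rho>^(-\<beta>) |h|^\<beta> \<ge>
    1.\<close>
  define C1 where "C1 = C * w + 2 ^ Suc ?d * \<rho> powr (- \<beta>)"
  have C1: "0 < C1" unfolding C1_def using C w by (intro add_pos_pos) auto
  have "\<exists>G A N. 0 \<le> A \<and> 0 \<le> N \<and> Linf_norm g = ereal A \<and> campanato_norm p g = ereal N \<and> G \<in> cont_reps g \<and>
      (AE x in lebesgue. \<bar>g x\<bar> \<le> A) \<and> (\<forall>x. \<bar>G x\<bar> \<le> A) \<and>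
      (\<forall>x h. h \<noteq> 0 \<longrightarrow> \<bar>fdiff h (nat \<lfloor>\<beta>\<rfloor> + 1) G x\<bar> \<le> C1 * (A + N) * norm h powr \<beta>)"
    if g: "in_Linf g" "in_campanato p g" for g :: "'a \<Rightarrow> real"
  proof -
    have gm: "g \<in> borel_measurable lebesgue" and gfin: "Linf_norm g < \<infinity>" using g by (auto simp: in_Linf_def)
    obtain A where A: "0 \<le> A" "Linf_norm g = ereal A" "AE x in lebesgue. \<bar>g x\<bar> \<le> A"
      using gfin by (rule Linf_norm_realE)
    let ?I = "\<lambda>B. ereal (1 / orlicz_norm p (indicator B)) *
        enn2ereal (\<integral>\<^sup>+ x\<in>B. ennreal \<bar>g x - proj_poly ?d B g x\<bar> \<partial>lebesgue)"
    let ?J = "\<lambda>B. ereal (1 / orlicz_norm p (indicator B)) * enn2ereal (\<integral>\<^sup>+ x\<in>B. ennreal \<bar>g x\<bar> \<partial>lebesgue)"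
    let ?S = "{ball c r | (c::'a) r. r > 0 \<and> measure lebesgue (ball c r) < 1}"
    let ?L = "{ball c r | (c::'a) r. r > 0 \<and> measure lebesgue (ball c r) \<ge> 1}"
    have norm_eq: "campanato_norm p g = (SUP B\<in>?S. ?I B) + (SUP B\<in>?L. ?J B)" by (simp add: campanato_norm_def)
    note orl = orlicz_norm_ball_pos[OF p, where 'a = 'a]
    \<comment> \<open>Each supremum can be bounded by the sum of the two only if the other is
      nonnegative, and that needs a ball of either kind to exist.\<close>
    have Ipos: "0 \<le> (SUP B\<in>?S. ?I B)"
    proof -
      have "0 \<le> ?I (ball 0 (\<rho>0 / 2))"
        using orl[of "\<rho>0 / 2" 0] \<rho>0 by (intro ereal_0_le_mult) (auto simp: less_imp_le)
      also have "\<dots> \<le> (SUP B\<in>?S. ?I B)"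
      proof (rule SUP_upper)
        have "0 < \<rho>0 / 2" "\<rho>0 / 2 < \<rho>0" using \<rho>0 by simp_all
        then show "ball 0 (\<rho>0 / 2) \<in> ?S" using vol by blast
      qed
      finally show ?thesis .
    qed
    have Jpos: "0 \<le> (SUP B\<in>?L. ?J B)"
    proof -
      define R where "R = max 1 (1 / \<omega>)"
      have R: "1 \<le> R" by (simp add: R_def)
      have "1 \<le> \<omega> * R" using \<omega> by (auto simp: R_def max_def field_simps)
      also have "\<dots> \<le> \<omega> * R ^ ?n" using \<omega> R power_increasing[of 1 ?n R] by (simp add: Suc_leI)
      finally have "measure lebesgue (ball (0::'a) R) \<ge> 1" using R by (simp add: measure_lebesgue_ball \<omega>_def del: measure_completion)
      then have mem: "ball (0::'a) R \<in> ?L" using R by (auto intro!: exI[of _ "0::'a"] exI[of _ R])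
      have "0 \<le> ?J (ball 0 R)"
        using orl[of R 0] R by (intro ereal_0_le_mult) (auto simp: less_imp_le)
      also have "\<dots> \<le> (SUP B\<in>?L. ?J B)" by (rule SUP_upper[OF mem])
      finally show ?thesis .
    qed
    have fin: "campanato_norm p g < \<infinity>" "L1_loc g" using g by (auto simp: in_campanato_def)
    have "0 \<le> campanato_norm p g" unfolding norm_eq using Ipos Jpos by simp
    then obtain N where N: "campanato_norm p g = ereal N" "0 \<le> N" using fin(1) by (cases "campanato_norm p g") auto
    have IN: "?I B \<le> ereal N" if "B \<in> ?S" for B
    proof -
      have "?I B \<le> (SUP B\<in>?S. ?I B)" by (rule SUP_upper[OF that])
      also have "\<dots> \<le> (SUP B\<in>?S. ?I B) + (SUP B\<in>?L. ?J B)" using Jpos by (simp add: ereal_le_add_self)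
      finally show ?thesis unfolding norm_eq[symmetric] N .
    qed
    have "\<exists>P. poly_deg_le ?d P \<and> (\<integral>\<^sup>+x\<in>ball c r. ennreal \<bar>g x - P x\<bar> \<partial>lebesgue) \<le> ennreal (N * w * r ^ ?n * r powr \<beta>)"
      if r: "0 < r" "r < \<rho>0" for c r
    proof (intro exI conjI)
      let ?o = "orlicz_norm p (indicator (ball c r))"
      let ?i = "\<integral>\<^sup>+x\<in>ball c r. ennreal \<bar>g x - proj_poly ?d (ball c r) g x\<bar> \<partial>lebesgue"
      show "poly_deg_le ?d (proj_poly ?d (ball c r) g)"
        by (rule proj_poly(1)[OF r(1) L1_loc_set_integrable_ball[OF fin(2)]])
      have o: "0 < ?o" by (rule orl[OF r(1)])
      have "ereal (1 / ?o) * enn2ereal ?i \<le> ereal N" by (rule IN) (use r vol in blast)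
      \<comment> \<open>An infinite integral is excluded, since a positive multiple of it is at most
        \<open>N\<close>.\<close>
      then have "?i \<le> ennreal (N * ?o)"
      proof (cases ?i)
        case (real i)
        then have "1 / ?o * i \<le> N" using \<open>ereal (1 / ?o) * enn2ereal ?i \<le> ereal N\<close> by simp
        then have "i \<le> N * ?o" using o by (simp add: field_simps)
        then show ?thesis using real by (simp add: ennreal_leI)
      next
        case top
        then show ?thesis using \<open>ereal (1 / ?o) * enn2ereal ?i \<le> ereal N\<close> o by simp
      qed
      also have "\<dots> \<le> ennreal (N * w * r ^ ?n * r powr \<beta>)"
      proof (rule ennreal_leI)
        have "?o \<le> measure lebesgue (ball c r) powr (1 / p)" by (rule orlicz_norm_ball_bounds(1)[OF p r(1)])
        also have "\<dots> = w * (r ^ ?n * r powr \<beta>)"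
          using r measure_lebesgue_ball[of r c] ball_volume_powr[OF p(1) r(1), of \<omega> ?n] by (simp only: \<omega>_def w_def \<beta>_def)
        finally have "N * ?o \<le> N * (w * (r ^ ?n * r powr \<beta>))" using N by (intro mult_left_mono) auto
        then show "N * ?o \<le> N * w * r ^ ?n * r powr \<beta>" by (simp add: mult_ac)
      qed
      finally show "?i \<le> ennreal (N * w * r ^ ?n * r powr \<beta>)" .
    qed
    then obtain G where G: "continuous_on UNIV G" "AE x in lebesgue. g x = G x"
      "\<And>x h. h \<noteq> 0 \<Longrightarrow> norm h \<le> \<rho> \<Longrightarrow> \<bar>fdiff h (Suc ?d) G x\<bar> \<le> C * (N * w) * norm h powr \<beta>"
      using C(3)[OF gm, of "N * w"] N(2) w by auto
    have rep: "G \<in> cont_reps g" using G by (simp add: cont_reps_def)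
    have GA: "\<bar>G x\<bar> \<le> A" for x by (rule abs_cont_rep_le[OF rep A(3)])
    have "\<bar>fdiff h (nat \<lfloor>\<beta>\<rfloor> + 1) G x\<bar> \<le> C1 * (A + N) * norm h powr \<beta>" if h: "h \<noteq> 0" for x h
    proof -
      have "\<bar>fdiff h (Suc ?d) G x\<bar> \<le> C1 * (A + N) * norm h powr \<beta>"
      proof (cases "norm h \<le> \<rho>")
        case True
        have "\<bar>fdiff h (Suc ?d) G x\<bar> \<le> C * (N * w) * norm h powr \<beta>" by (rule G(3)[OF h True])
        also have "\<dots> \<le> C1 * (A + N) * norm h powr \<beta>"
        proof (rule mult_right_mono)
          have "C * (N * w) = (C * w) * N" by simp
          also have "\<dots> \<le> C1 * (A + N)" using C w A(1) N(2) by (intro mult_mono) (auto simp: C1_def)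
          finally show "C * (N * w) \<le> C1 * (A + N)" .
        qed simp
        finally show ?thesis .
      next
        case False
        have "\<rho> powr \<beta> \<le> norm h powr \<beta>" using False C \<beta> by (intro powr_mono2) auto
        then have "\<rho> powr (-\<beta>) * \<rho> powr \<beta> \<le> \<rho> powr (-\<beta>) * norm h powr \<beta>" by (intro mult_left_mono) auto
        then have 1: "1 \<le> \<rho> powr (-\<beta>) * norm h powr \<beta>" using C by (simp add: powr_add[symmetric])
        have "\<bar>fdiff h (Suc ?d) G x\<bar> \<le> 2 ^ Suc ?d * A" by (rule abs_fdiff_le) (rule GA)
        also have "\<dots> \<le> 2 ^ Suc ?d * A * (\<rho> powr (-\<beta>) * norm h powr \<beta>)"
          using mult_left_mono[OF 1, of "2 ^ Suc ?d * A"] A(1) by simp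
        also have "\<dots> = (2 ^ Suc ?d * \<rho> powr (-\<beta>)) * A * norm h powr \<beta>" by simp
        also have "\<dots> \<le> C1 * (A + N) * norm h powr \<beta>"
          using C w A(1) N(2) by (intro mult_right_mono mult_mono) (auto simp: C1_def)
        finally show ?thesis .
      qed
      then show ?thesis by (simp only: d Suc_eq_plus1)
    qed
    then show ?thesis using A N rep GA by blast
  qed
  with C1 show ?thesis by blast
qed

text \<open>Uniform approximation of the continuous representative bounds the error of the
  projection, which is nearly best; on small balls the powers of r then cancel against the norm of
  the indicator. On large balls the bound \<open>A |B|\<close> meets a norm of order at least
  |B|.\<close>

lemma in_Lambda_imp_campanato:
  fixes p :: real and g :: "'a::euclidean_space \<Rightarrow> real"
  assumes p: "0 < p" "p < 1" and g: "in_Lambda (real DIM('a) * (1 / p - 1)) g"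
  shows "in_Linf g" and "in_campanato p g"
proof -
  let ?n = "DIM('a)" and ?d = "camp_d TYPE('a) p"
  define \<beta> where "\<beta> = real ?n * (1 / p - 1)"
  define \<omega> where "\<omega> = unit_ball_vol (real ?n)"
  have \<omega>: "0 < \<omega>" by (simp add: \<omega>_def)
  have \<beta>: "0 < \<beta>" unfolding \<beta>_def using p by (intro mult_pos_pos) auto
  have d: "?d = nat \<lfloor>\<beta>\<rfloor>" by (simp add: camp_d_def \<beta>_def)
  have \<beta>k: "\<beta> < real (Suc ?d)" unfolding d using \<beta> by linarith
  obtain G A M where A: "0 \<le> A" and M: "0 \<le> M" and rep: "G \<in> cont_reps g" and gm[measurable]: "g \<in> borel_measurable lebesgue"
    and L: "Linf_norm g = ereal A" and "lip_semi \<beta> G = ereal M" "Lambda_norm \<beta> g = ereal (A + M)" and gA: "AE x in lebesgue. \<bar>g x\<bar> \<le> A" and GA: "\<And>x. \<bar>G x\<bar> \<le> A"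
    and GM: "\<And>x h. h \<noteq> 0 \<Longrightarrow> \<bar>fdiff h (nat \<lfloor>\<beta>\<rfloor> + 1) G x\<bar> \<le> M * norm h powr \<beta>"
    using g unfolding \<beta>_def[symmetric] by (rule in_LambdaE) (rule that)
  show "in_Linf g" using gm L by (simp add: in_Linf_def)
  have loc: "L1_loc g"
    unfolding L1_loc_def
  proof (intro allI impI)
    fix K :: "'a set" assume "compact K"
    then have K: "K \<in> lmeasurable" by (rule lmeasurable_compact)
    then have [measurable]: "K \<in> sets lebesgue" by auto
    have "set_integrable lebesgue K (\<lambda>_. A)"
      using K unfolding set_integrable_def by (simp add: lmeasurable_iff_integrable)
    then show "set_integrable lebesgue K g"
    proof (rule set_integrable_bound)
      show "set_borel_measurable lebesgue K g" unfolding set_borel_measurable_def by measurable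
      show "AE x in lebesgue. x \<in> K \<longrightarrow> norm (g x) \<le> norm A" using gA by eventually_elim (use A in auto)
    qed
  qed
  have cG: "continuous_on UNIV G" and gG: "AE x in lebesgue. g x = G x" using rep by (auto simp: cont_reps_def)
  \<comment> \<open>Here k = d + 1, so \<open>Suc ?d - 1\<close> is the degree of the Campanato
    projection.\<close>
  obtain K where K: "K > 0" "\<And>c r. 0 < r \<Longrightarrow> \<exists>P. poly_deg_le (Suc ?d - 1) P \<and> (\<forall>x\<in>ball c r. \<bar>G x - P x\<bar> \<le> K * r powr \<beta>)"
    using lipschitz_imp_poly_approx[OF \<beta> \<beta>k cG GA, of M] GM by (auto simp: d simp del: fdiff.simps)
  let ?I = "\<lambda>B. ereal (1 / orlicz_norm p (indicator B)) *
      enn2ereal (\<integral>\<^sup>+ x\<in>B. ennreal \<bar>g x - proj_poly ?d B g x\<bar> \<partial>lebesgue)"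
  let ?J = "\<lambda>B. ereal (1 / orlicz_norm p (indicator B)) * enn2ereal (\<integral>\<^sup>+ x\<in>B. ennreal \<bar>g x\<bar> \<partial>lebesgue)"
  let ?S = "{ball c r | (c::'a) r. r > 0 \<and> measure lebesgue (ball c r) < 1}"
  let ?L = "{ball c r | (c::'a) r. r > 0 \<and> measure lebesgue (ball c r) \<ge> 1}"
  \<comment> \<open>Lets the integral be replaced by an upper bound and the norm of the indicator by
    a positive lower bound.\<close>
  have quotient: "ereal (1 / b) * enn2ereal i \<le> ereal (j / b')"
    if "i \<le> ennreal j" "0 \<le> j" "0 < b'" "b' \<le> b" for i b b' j
  proof -
    have "enn2ereal i \<le> ereal j" using that(1,2) by (metis enn2ereal_ennreal less_eq_ennreal.rep_eq)
    then have "ereal (1 / b) * enn2ereal i \<le> ereal (1 / b) * ereal j"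
      using that by (intro ereal_mult_left_mono) auto
    also have "\<dots> \<le> ereal (j / b')" using that by (simp add: divide_left_mono)
    finally show ?thesis .
  qed
  have "(SUP B\<in>?S. ?I B) \<le> ereal (K * \<omega> / (\<omega> / 2) powr (1 / p))"
  proof (rule SUP_least)
    fix B assume "B \<in> ?S"
    then obtain c r where B: "B = ball c r" and r: "0 < r" and m1: "measure lebesgue (ball c r) < 1" by blast
    let ?m = "measure lebesgue (ball c r)"
    have m: "?m = \<omega> * r ^ ?n" using r by (simp only: measure_lebesgue_ball[OF less_imp_le] \<omega>_def)
    obtain P where P: "poly_deg_le ?d P" "\<And>x. x \<in> ball c r \<Longrightarrow> \<bar>G x - P x\<bar> \<le> K * r powr \<beta>" using K(2)[OF r, of c] by auto
    have near: "AE x in lebesgue. x \<in> ball c r \<longrightarrow> \<bar>g x - P x\<bar> \<le> K * r powr \<beta>"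
      using gG by eventually_elim (use P(2) in auto)
    have "(\<integral>\<^sup>+ x\<in>ball c r. ennreal \<bar>g x - proj_poly ?d (ball c r) g x\<bar> \<partial>lebesgue) \<le> ennreal ((K * r powr \<beta>) * ?m)"
      by (rule proj_poly_near_best[OF r L1_loc_set_integrable_ball[OF loc] P(1) _ near]) (use K r in auto)
    moreover have "(?m / 2) powr (1 / p) \<le> orlicz_norm p (indicator (ball c r))"
      by (rule orlicz_norm_ball_bounds(2)[OF p r m1])
    moreover have "0 < (?m / 2) powr (1 / p)" unfolding m using \<omega> r by simp
    ultimately have "?I B \<le> ereal ((K * r powr \<beta>) * ?m / (?m / 2) powr (1 / p))"
      unfolding B by (intro quotient) (use K r in auto)
    also have "(?m / 2) powr (1 / p) = (\<omega> / 2) powr (1 / p) * (r ^ ?n * r powr \<beta>)"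
      using ball_volume_powr[OF p(1) r, of "\<omega> / 2" ?n] by (simp add: m \<beta>_def del: measure_completion)
    also have "(K * r powr \<beta>) * ?m / \<dots> = K * \<omega> / (\<omega> / 2) powr (1 / p)"
      unfolding m using r by simp
    finally show "?I B \<le> ereal (K * \<omega> / (\<omega> / 2) powr (1 / p))" .
  qed
  moreover have "(SUP B\<in>?L. ?J B) \<le> ereal (A / ((1 / 2) powr (1 / p) / 2))"
  proof (rule SUP_least)
    fix B assume "B \<in> ?L"
    then obtain c r where B: "B = ball c r" and r: "0 < r" and m1: "measure lebesgue (ball c r) \<ge> 1" by blast
    let ?m = "measure lebesgue (ball c r)"
    have "(\<integral>\<^sup>+ x\<in>ball c r. ennreal \<bar>g x\<bar> \<partial>lebesgue) \<le> (\<integral>\<^sup>+ x\<in>ball c r. ennreal A \<partial>lebesgue)"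
    proof (rule nn_integral_mono_AE)
      show "AE x in lebesgue. ennreal \<bar>g x\<bar> * indicator (ball c r) x \<le> ennreal A * indicator (ball c r) x"
        using gA by eventually_elim (auto intro!: mult_right_mono ennreal_leI)
    qed
    also have "\<dots> = ennreal A * emeasure lebesgue (ball c r)" by (rule nn_integral_cmult_indicator) simp
    also have "\<dots> = ennreal (A * ?m)"
      unfolding emeasure_lebesgue_ball[OF less_imp_le[OF r]] measure_lebesgue_ball[OF less_imp_le[OF r]]
      using A by (rule ennreal_mult'[symmetric])
    finally have "(\<integral>\<^sup>+ x\<in>ball c r. ennreal \<bar>g x\<bar> \<partial>lebesgue) \<le> ennreal (A * ?m)" .
    moreover have "(1 / 2) powr (1 / p) / 2 * ?m \<le> orlicz_norm p (indicator (ball c r))"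
      by (rule orlicz_norm_ball_bounds(3)[OF p r m1])
    moreover have "0 < (1 / 2) powr (1 / p) / 2 * ?m"
    proof (rule mult_pos_pos)
      show "0 < ?m" using m1 by linarith
    qed simp
    ultimately have "?J B \<le> ereal (A * ?m / ((1 / 2) powr (1 / p) / 2 * ?m))"
      unfolding B by (intro quotient) (use A in auto)
    also have "A * ?m / ((1 / 2) powr (1 / p) / 2 * ?m) = A / ((1 / 2) powr (1 / p) / 2)"
      using m1 by (intro mult_divide_mult_cancel_right) linarith
    finally show "?J B \<le> ereal (A / ((1 / 2) powr (1 / p) / 2))" .
  qed
  ultimately have "campanato_norm p g \<le> ereal (K * \<omega> / (\<omega> / 2) powr (1 / p)) + ereal (A / ((1 / 2) powr (1 / p) / 2))"
    unfolding campanato_norm_def by (rule add_mono)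
  then have "campanato_norm p g < \<infinity>" by (rule le_less_trans) simp
  with loc show "in_campanato p g" by (simp add: in_campanato_def)
qed

section \<open>Multipliers\<close>

text \<open>Both functions are replaced by their continuous representatives, whose product is the
  representative of the product.\<close>

lemma multiplier_bound:
  fixes p :: real
  assumes p: "0 < p" "p < 1"
  defines "\<beta> \<equiv> real DIM('a::euclidean_space) * (1 / p - 1)"
  shows "\<exists>C>0. \<forall>(g :: 'a \<Rightarrow> real) f. in_Linf g \<and> in_campanato p g \<and> in_Lambda \<beta> f \<longrightarrow>
     in_Lambda \<beta> (\<lambda>x. g x * f x) \<and>
     Lambda_norm \<beta> (\<lambda>x. g x * f x) \<le> ereal C * (Linf_norm g + campanato_norm p g) * Lambda_norm \<beta> f"
proof -
  have \<beta>: "0 < \<beta>" unfolding \<beta>_def using p by (intro mult_pos_pos) auto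
  have \<beta>k: "\<beta> < real (nat \<lfloor>\<beta>\<rfloor> + 1)" using \<beta> by linarith
  obtain C1 where C1: "C1 > 0" "\<And>g :: 'a \<Rightarrow> real. in_Linf g \<and> in_campanato p g \<Longrightarrow>
    (\<exists>G A N. 0 \<le> A \<and> 0 \<le> N \<and> Linf_norm g = ereal A \<and> campanato_norm p g = ereal N \<and> G \<in> cont_reps g \<and>
      (AE x in lebesgue. \<bar>g x\<bar> \<le> A) \<and> (\<forall>x. \<bar>G x\<bar> \<le> A) \<and>
      (\<forall>x h. h \<noteq> 0 \<longrightarrow> \<bar>fdiff h (nat \<lfloor>\<beta>\<rfloor> + 1) G x\<bar> \<le> C1 * (A + N) * norm h powr \<beta>))"
    using campanato_lipschitz_representative[OF p, where 'a = 'a] unfolding \<beta>_def by blast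
  obtain C2 where C2: "C2 > 0" "\<forall>(f :: 'a \<Rightarrow> real) g A M B N.
      (\<forall>x. \<bar>f x\<bar> \<le> A) \<longrightarrow> (\<forall>h x. h \<noteq> 0 \<longrightarrow> \<bar>fdiff h (nat \<lfloor>\<beta>\<rfloor> + 1) f x\<bar> \<le> M * norm h powr \<beta>) \<longrightarrow>
      (\<forall>x. \<bar>g x\<bar> \<le> B) \<longrightarrow> (\<forall>h x. h \<noteq> 0 \<longrightarrow> \<bar>fdiff h (nat \<lfloor>\<beta>\<rfloor> + 1) g x\<bar> \<le> N * norm h powr \<beta>) \<longrightarrow>
      (\<forall>h x. h \<noteq> 0 \<longrightarrow> \<bar>fdiff h (nat \<lfloor>\<beta>\<rfloor> + 1) (\<lambda>x. f x * g x) x\<bar> \<le> C2 * (A + M) * (B + N) * norm h powr \<beta>)"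
    using lipschitz_mult[OF \<beta> \<beta>k, where 'a = 'a] by (elim exE conjE)
  \<comment> \<open>The leading 1 pays for the sup norm \<open>A * B\<close>; \<open>1 + C1\<close>
    bounds sup norm and difference constant of \<open>G\<close> together by a multiple of
    \<open>A + N\<close>.\<close>
  define C where "C = 1 + C2 * (1 + C1)"
  have C: "0 < C" using C1 C2 by (simp add: C_def add_pos_pos)
  have "in_Lambda \<beta> (\<lambda>x. g x * f x) \<and>
     Lambda_norm \<beta> (\<lambda>x. g x * f x) \<le> ereal C * (Linf_norm g + campanato_norm p g) * Lambda_norm \<beta> f"
    if g: "in_Linf g" "in_campanato p g" and f: "in_Lambda \<beta> f" for g f :: "'a \<Rightarrow> real"
  proof -
    obtain G A N where G: "0 \<le> A" "0 \<le> N" "Linf_norm g = ereal A" "campanato_norm p g = ereal N" "G \<in> cont_reps g"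
      "AE x in lebesgue. \<bar>g x\<bar> \<le> A" "\<forall>x. \<bar>G x\<bar> \<le> A"
      "\<forall>x h. h \<noteq> 0 \<longrightarrow> \<bar>fdiff h (nat \<lfloor>\<beta>\<rfloor> + 1) G x\<bar> \<le> C1 * (A + N) * norm h powr \<beta>"
      using C1(2)[of g] g by blast
    obtain F B M where F: "0 \<le> B" "0 \<le> M" "F \<in> cont_reps f" and [measurable]: "f \<in> borel_measurable lebesgue"
      and "Linf_norm f = ereal B" "lip_semi \<beta> F = ereal M"
      and Fn: "Lambda_norm \<beta> f = ereal (B + M)" "AE x in lebesgue. \<bar>f x\<bar> \<le> B" "\<And>x. \<bar>F x\<bar> \<le> B"
      "\<And>x h. h \<noteq> 0 \<Longrightarrow> \<bar>fdiff h (nat \<lfloor>\<beta>\<rfloor> + 1) F x\<bar> \<le> M * norm h powr \<beta>"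
      using f by (rule in_LambdaE) (rule that)
    have [measurable]: "g \<in> borel_measurable lebesgue" using g by (simp add: in_Linf_def)
    have m: "(\<lambda>x. g x * f x) \<in> borel_measurable lebesgue" by measurable
    have "AE x in lebesgue. g x = G x" "AE x in lebesgue. f x = F x" using G(5) F(3) by (auto simp: cont_reps_def)
    then have "AE x in lebesgue. g x * f x = G x * F x" by eventually_elim simp
    moreover have "continuous_on UNIV (\<lambda>x. G x * F x)" using G(5) F(3) by (auto simp: cont_reps_def intro!: continuous_intros)
    ultimately have rep: "(\<lambda>x. G x * F x) \<in> cont_reps (\<lambda>x. g x * f x)" by (simp add: cont_reps_def)
    have AB: "AE x in lebesgue. \<bar>g x * f x\<bar> \<le> A * B"
      using G(6) Fn(2) by eventually_elim (use G(1) in \<open>auto simp: abs_mult intro!: mult_mono\<close>)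
    have diff: "\<bar>fdiff h (nat \<lfloor>\<beta>\<rfloor> + 1) (\<lambda>x. G x * F x) x\<bar> \<le> (C2 * (A + C1 * (A + N)) * (B + M)) * norm h powr \<beta>" if "h \<noteq> 0" for h x
      by (rule C2(2)[rule_format]) (use G Fn that in blast)+
    note res = in_LambdaI[OF m rep AB diff]
    have "A * B + C2 * (A + C1 * (A + N)) * (B + M) \<le> C * (A + N) * (B + M)"
    proof -
      have 1: "A * B \<le> (A + N) * (B + M)" using G F by (intro mult_mono) auto
      have "A + C1 * (A + N) \<le> (1 + C1) * (A + N)" using G by (simp add: algebra_simps)
      then have "C2 * (A + C1 * (A + N)) * (B + M) \<le> C2 * ((1 + C1) * (A + N)) * (B + M)"
        using C2 F by (intro mult_right_mono mult_left_mono) auto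
      with 1 show ?thesis by (simp add: C_def algebra_simps)
    qed
    then have "Lambda_norm \<beta> (\<lambda>x. g x * f x) \<le> ereal (C * (A + N) * (B + M))"
      using res(2) by (meson ereal_less_eq(3) order_trans)
    then show ?thesis using res(1) by (simp add: G Fn)
  qed
  with C show ?thesis by blast
qed

theorem theorem3p1:
  fixes p :: real
  assumes "0 < p" "p < 1"
  defines "\<beta> \<equiv> real DIM('a::euclidean_space) * (1 / p - 1)"
  shows "(\<forall>g :: 'a \<Rightarrow> real.
            (in_Linf g \<and> in_campanato p g) \<longleftrightarrow>
            (\<exists>Cg>0. \<forall>f. in_Lambda \<beta> f \<longrightarrow>
                 in_Lambda \<beta> (\<lambda>x. g x * f x) \<and>
                 Lambda_norm \<beta> (\<lambda>x. g x * f x) \<le> ereal Cg * Lambda_norm \<beta> f))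
       \<and> (\<exists>C>0. \<forall>(g :: 'a \<Rightarrow> real) f. in_Linf g \<and> in_campanato p g \<and> in_Lambda \<beta> f \<longrightarrow>
            Lambda_norm \<beta> (\<lambda>x. g x * f x)
              \<le> ereal C * (Linf_norm g + campanato_norm p g) * Lambda_norm \<beta> f)"
proof -
  obtain C where C: "C > 0" "\<And>(g :: 'a \<Rightarrow> real) f. in_Linf g \<Longrightarrow> in_campanato p g \<Longrightarrow> in_Lambda \<beta> f \<Longrightarrow>
     in_Lambda \<beta> (\<lambda>x. g x * f x) \<and>
     Lambda_norm \<beta> (\<lambda>x. g x * f x) \<le> ereal C * (Linf_norm g + campanato_norm p g) * Lambda_norm \<beta> f"
    using multiplier_bound[OF assms(1,2), where 'a = 'a] unfolding \<beta>_def by blast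
  have "\<exists>Cg>0. \<forall>f. in_Lambda \<beta> f \<longrightarrow> in_Lambda \<beta> (\<lambda>x. g x * f x) \<and>
                 Lambda_norm \<beta> (\<lambda>x. g x * f x) \<le> ereal Cg * Lambda_norm \<beta> f"
    if g: "in_Linf g" "in_campanato p g" for g :: "'a \<Rightarrow> real"
  proof -
    obtain A N where AN: "0 \<le> A" "0 \<le> N" "Linf_norm g = ereal A" "campanato_norm p g = ereal N"
      using campanato_lipschitz_representative[OF assms(1,2), where 'a = 'a] g by blast
    \<comment> \<open>The added 1 makes the multiplier constant positive even if both norms of
      \<open>g\<close> vanish.\<close>
    have "Lambda_norm \<beta> (\<lambda>x. g x * f x) \<le> ereal (C * (A + N) + 1) * Lambda_norm \<beta> f" if f: "in_Lambda \<beta> f" for f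
    proof -
      obtain L where L: "0 \<le> L" "Lambda_norm \<beta> f = ereal L"
        using f by (rule in_LambdaE) (metis add_nonneg_nonneg)
      have "Lambda_norm \<beta> (\<lambda>x. g x * f x) \<le> ereal (C * (A + N) * L)"
        using C(2)[OF g f] by (simp add: AN L)
      also have "\<dots> \<le> ereal ((C * (A + N) + 1) * L)" using L by (simp add: algebra_simps)
      finally show ?thesis by (simp add: L)
    qed
    moreover have "0 < C * (A + N) + 1" using C AN by (simp add: add_nonneg_pos)
    ultimately show ?thesis using C(2)[OF g] by blast
  qed
  moreover have "in_Linf g \<and> in_campanato p g"
    if "\<exists>Cg>0. \<forall>f. in_Lambda \<beta> f \<longrightarrow> in_Lambda \<beta> (\<lambda>x. g x * f x) \<and>
                 Lambda_norm \<beta> (\<lambda>x. g x * f x) \<le> ereal Cg * Lambda_norm \<beta> f" for g :: "'a \<Rightarrow> real"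
  proof -
    \<comment> \<open>Testing the multiplier on the constant 1, whose differences vanish, places
      \<open>g\<close> itself in the Lipschitz space.\<close>
    have "in_Lambda \<beta> (\<lambda>_::'a. 1)"
    proof (rule in_LambdaI(1)[where G = "\<lambda>_. 1" and A = 1 and M = 0])
      fix x h :: 'a
      show "\<bar>fdiff h (nat \<lfloor>\<beta>\<rfloor> + 1) (\<lambda>_. 1) x\<bar> \<le> 0 * norm h powr \<beta>" by (simp add: fdiff_const del: fdiff.simps)
    qed (auto simp: cont_reps_def)
    then have "in_Lambda \<beta> (\<lambda>x. g x * 1)" using that by blast
    then show ?thesis using in_Lambda_imp_campanato[OF assms(1,2), of g] unfolding \<beta>_def by simp
  qed
  ultimately show ?thesis using C by blast
qed

end
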